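(* Let $\Omega\subset\mathbb{R}^d$ be open and let $(M_p)_{p\in\mathbb{N}}$ be a weight sequence satisfying (M.1), (M.2), (M.3). (Beurling case) Let $f=[(f_\varepsilon)]\in\mathcal{G}^{\infty,(M_p)}(\Omega)$. Then $f=0$ in $\mathcal{G}^{(M_p)}(\Omega)$ if and only if there exists $\varepsilon_0\in(0,1)$ such that for every $h>0$ and every $\kappa\in\mathcal{D}^{(M_p)}(\Omega)$ there exists $C=C_{h,\kappa}>0$ with $$\Big|\int_\Omega f_\varepsilon(t)\kappa(t)\,dt\Big|\,e^{M(h/\varepsilon)}<C,\qquad \varepsilon<\varepsilon_0.$$ (Roumieu case) Let $f=[(f_\varepsilon)]\in\mathcal{G}^{\infty,\{M_p\}}(\Omega)$. Then $f=0$ in $\mathcal{G}^{\{M_p\}}(\Omega)$ if and only if there exists $\varepsilon_0\in(0,1)$ such that for every $(h_i)\in\mathfrak{R}$ and every $\kappa\in\mathcal{D}^{\{M_p\}}(\Omega)$ there exists $C=C_{(h_i),\kappa}>0$ with $$\Big|\int_\Omega f_\varepsilon(t)\kappa(t)\,dt\Big|\,e^{N_{(h_i)}(1/\varepsilon)}<C,\qquad \varepsilon<\varepsilon_0.$$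
   Context: Conventions: $\mathbb{N}=\{0,1,2,\dots\}$, $\mathbb{Z}_+=\{1,2,\dots\}$. Functions are complex valued. For nets indexed by $\varepsilon\in(0,1)$, $a_\varepsilon=O(b_\varepsilon)$ means that there are $C>0$ and $\varepsilon_0\in(0,1)$ with $|a_\varepsilon|\le C b_\varepsilon$ for $\varepsilon\in(0,\varepsilon_0)$. All compact sets $K\subset\subset\Omega$ are assumed regular in the sense of Komatsu (Whitney-type regularity: finitely many connected components, and any two points $x,y$ of the same component can be joined by a rectifiable curve in $K$ of length at most $C_K|x-y|$). Weight sequence: $(M_p)_{p\in\mathbb{N}}$ is a sequence of positive numbers with $M_0=1$ such that, for some constants $c_0,H\ge1$: (M.1) $M_p^2\le M_{p-1}M_{p+1}$, $p\in\mathbb{Z}_+$; (M.2) $M_p\le c_0H^p\min_{0\le q\le p}M_{p-q}M_q$, $p\in\mathbb{N}$; (M.3) $\sum_{j=p+1}^\infty M_{j-1}/M_j\le c_0\,p\,M_p/M_{p+1}$, $p\in\mathbb{Z}_+$. For $\alpha\in\mathbb{N}^d$, $M_\alpha:=M_{|\alpha|}$. $M(\rho)=\sup_{p\in\mathbb{N}}\ln_+(\rho^p/M_p)$ for $\rho>0$, $M(0)=0$, where $\ln_+=\max(\ln,0)$. $\mathfrak{R}$ is the set of all positive monotonically increasing sequences $(r_i)_{i\in\mathbb{Z}_+}$ with $r_i\to\infty$; for $(r_i)\in\mathfrak{R}$, $N_{(r_i)}(\rho)=\sup_{p\in\mathbb{N}}\ln_+\big(\rho^p/(M_p\prod_{i=1}^pr_i)\big)$,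 $\rho>0$. Function spaces: for $K\subset\subset\Omega$, $h>0$, $(r_i)\in\mathfrak{R}$, $\phi\in C^\infty(\Omega)$ put $\|\phi\|_{K,h}=\sup_{x\in K,\alpha\in\mathbb{N}^d}\frac{|\phi^{(\alpha)}(x)|}{h^{|\alpha|}M_\alpha}$ and $\|\phi\|_{K,(r_i)}=\sup_{x\in K,\alpha\in\mathbb{N}^d}\frac{|\phi^{(\alpha)}(x)|}{M_\alpha\prod_{i\le|\alpha|}r_i}$. $\mathcal{E}^{(M_p)}(\Omega)$ (resp. $\mathcal{E}^{\{M_p\}}(\Omega)$) is the space of $\phi\in C^\infty(\Omega)$ with $\|\phi\|_{K,h}<\infty$ for all $K\subset\subset\Omega$, $h>0$ (resp. $\|\phi\|_{K,(r_i)}<\infty$ for all $K\subset\subset\Omega$, $(r_i)\in\mathfrak{R}$). $\mathcal{D}^{(M_p)}(\Omega)$ (resp. $\mathcal{D}^{\{M_p\}}(\Omega)$) is the space of compactly supported elements of $\mathcal{E}^{(M_p)}(\Omega)$ (resp. $\mathcal{E}^{\{M_p\}}(\Omega)$). Generalized ultradistributions: $\mathcal{E}_M^{(M_p)}(\Omega)$ is the set of nets $(g_\varepsilon)\in(\mathcal{E}^{(M_p)}(\Omega))^{(0,1)}$ such that for all $K\subset\subset\Omega$, $h>0$ there is $k\ge0$ with $\|g_\varepsilon\|_{K,h}=O(e^{M(k/\varepsilon)})$; $\mathcal{N}^{(M_p)}(\Omega)$ is the set of nets in $(\mathcal{E}^{(M_p)}(\Omega))^{(0,1)}$ such that for all $K\subset\subset\Omega$,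 $h>0$, $k\ge0$: $\|g_\varepsilon\|_{K,h}=O(e^{-M(k/\varepsilon)})$. $\mathcal{E}_M^{\{M_p\}}(\Omega)$ is the set of nets $(g_\varepsilon)\in(\mathcal{E}^{\{M_p\}}(\Omega))^{(0,1)}$ such that for all $K\subset\subset\Omega$, $(h_i)\in\mathfrak{R}$ there is $(k_i)\in\mathfrak{R}$ with $\|g_\varepsilon\|_{K,(h_i)}=O(e^{N_{(k_i)}(1/\varepsilon)})$; $\mathcal{N}^{\{M_p\}}(\Omega)$ is the set of nets in $(\mathcal{E}^{\{M_p\}}(\Omega))^{(0,1)}$ such that for all $K\subset\subset\Omega$, $(h_i),(k_i)\in\mathfrak{R}$: $\|g_\varepsilon\|_{K,(h_i)}=O(e^{-N_{(k_i)}(1/\varepsilon)})$. For $*$ equal to $(M_p)$ or $\{M_p\}$, $\mathcal{G}^*(\Omega)=\mathcal{E}_M^*(\Omega)/\mathcal{N}^*(\Omega)$, and $[(g_\varepsilon)]$ denotes the class of the net $(g_\varepsilon)$; thus $f=[(f_\varepsilon)]$ means that $(f_\varepsilon)$ is the net representing $f$. Regularity: $f\in\mathcal{G}^{\infty,(M_p)}(\Omega)$ if $f\in\mathcal{G}^{(M_p)}(\Omega)$ has a representative $(g_\varepsilon)\in\mathcal{E}_M^{(M_p)}(\Omega)$ such that for every $K\subset\subset\Omega$ there is $k>0$ such that for every $h>0$: $\|g_\varepsilon\|_{K,h}=O(e^{M(k/\varepsilon)})$. $f\in\mathcal{G}^{\infty,\{M_p\}}(\Omega)$ if $f\in\mathcal{G}^{\{M_p\}}(\Omega)$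 has a representative $(g_\varepsilon)\in\mathcal{E}_M^{\{M_p\}}(\Omega)$ such that for every $K\subset\subset\Omega$ there is $(k_i)\in\mathfrak{R}$ such that for every $(h_i)\in\mathfrak{R}$: $\|g_\varepsilon\|_{K,(h_i)}=O(e^{N_{(k_i)}(1/\varepsilon)})$.
   Formalization: As stated, "f=0 implies the bound" fails, since ε₀ cannot be uniform over all κ for arbitrary nets; the formal equivalence lets ε₀ depend on a compact set K containing supp κ (uniform in h, resp. (h_i), and such κ). The converse is also proved as stated. *)

theory Defs
  imports "HOL-Analysis.Analysis"
begin

section \<open>Weight sequences and associated functions\<close>

text \<open>The conditions (M.1), (M.2), (M.3), with \<open>M 0 = 1\<close>. The summability clause is part of (M.3):
  \<open>infsum\<close> is 0 for a divergent series.\<close>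

definition weight_sequence :: "(nat \<Rightarrow> real) \<Rightarrow> bool" where
  "weight_sequence M \<longleftrightarrow>
     (\<forall>p. 0 < M p) \<and> M 0 = 1 \<and>
     (\<forall>p\<ge>1. (M p)\<^sup>2 \<le> M (p - 1) * M (p + 1)) \<and>
     (\<exists>c\<^sub>0\<ge>1. \<exists>H\<ge>1.
        (\<forall>p. M p \<le> c\<^sub>0 * H ^ p * (MIN q\<in>{..p}. M (p - q) * M q)) \<and>
        (\<forall>p\<ge>1. (\<lambda>j. M (j - 1) / M j) summable_on {p + 1..} \<and>
           (\<Sum>\<^sub>\<infinity>j\<in>{p + 1..}. M (j - 1) / M j) \<le> c\<^sub>0 * real p * M p / M (p + 1)))"

definition ln_plus :: "real \<Rightarrow> real" where
  "ln_plus x = max (ln x) 0"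

text \<open>At \<open>\<rho> = 0\<close> the formula gives 0 if \<open>M 0 = 1\<close>, because \<open>ln 0 = 0\<close>.\<close>

definition assoc_fun :: "(nat \<Rightarrow> real) \<Rightarrow> real \<Rightarrow> real" where
  "assoc_fun M \<rho> = (SUP p. ln_plus (\<rho> ^ p / M p))"

text \<open>Sequences \<open>(r\<^sub>i)\<close> are indexed by \<open>i \<ge> 1\<close>; the value \<open>r 0\<close> is never used.\<close>

definition Rseq :: "(nat \<Rightarrow> real) set" where
  "Rseq = {r. (\<forall>i\<ge>1. 0 < r i) \<and> mono_on {1..} r \<and> filterlim r at_top sequentially}"

definition seq_weight :: "(nat \<Rightarrow> real) \<Rightarrow> (nat \<Rightarrow> real) \<Rightarrow> nat \<Rightarrow> real" where
  "seq_weight M r p = M p * (\<Prod>i=1..p. r i)"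

definition assoc_fun_seq :: "(nat \<Rightarrow> real) \<Rightarrow> (nat \<Rightarrow> real) \<Rightarrow> real \<Rightarrow> real" where
  "assoc_fun_seq M r = assoc_fun (seq_weight M r)"

section \<open>Regular compact sets\<close>

definition curve_length_le :: "(real \<Rightarrow> 'a::metric_space) \<Rightarrow> real \<Rightarrow> bool" where
  "curve_length_le g L \<longleftrightarrow>
     (\<forall>ts. sorted ts \<and> set ts \<subseteq> {0..1} \<longrightarrow>
        (\<Sum>i<length ts - 1. dist (g (ts ! i)) (g (ts ! Suc i))) \<le> L)"

definition regular_compact :: "'a::real_normed_vector set \<Rightarrow> bool" where
  "regular_compact K \<longleftrightarrow>
     compact K \<and> finite (components K) \<and>
     (\<exists>C>0. \<forall>A\<in>components K. \<forall>x\<in>A. \<forall>y\<in>A. \<exists>g.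
        path g \<and> path_image g \<subseteq> K \<and> pathstart g = x \<and> pathfinish g = y \<and>
        curve_length_le g (C * norm (x - y)))"

definition cpts :: "'a::real_normed_vector set \<Rightarrow> 'a set set" where
  "cpts \<Omega> = {K. regular_compact K \<and> K \<subseteq> \<Omega>}"

section \<open>Smooth functions and ultradifferentiable functions\<close>

text \<open>Functions on an open set \<open>\<Omega>\<close> are represented by total functions whose values outside \<open>\<Omega>\<close>
  are irrelevant.\<close>

definition partial :: "'d \<Rightarrow> (real^'d \<Rightarrow> complex) \<Rightarrow> real^'d \<Rightarrow> complex" where
  "partial i \<phi> x = frechet_derivative \<phi> (at x) (axis i 1)"

definition partials :: "'d list \<Rightarrow> (real^'d \<Rightarrow> complex) \<Rightarrow> real^'d \<Rightarrow> complex" where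
  "partials is \<phi> = foldr partial is \<phi>"

definition smooth_on :: "(real^'d) set \<Rightarrow> (real^'d \<Rightarrow> complex) \<Rightarrow> bool" where
  "smooth_on \<Omega> \<phi> \<longleftrightarrow> (\<forall>is. \<forall>x\<in>\<Omega>. partials is \<phi> differentiable at x)"

text \<open>A multi-index is a function \<open>\<alpha> :: 'd \<Rightarrow> nat\<close>. The index type carries no order, so the derivative
  is taken along some list of coordinates in which each \<open>i\<close> occurs \<open>\<alpha> i\<close> times; for smooth functions
  all such lists give the same result.\<close>

definition multi_deriv :: "('d::finite \<Rightarrow> nat) \<Rightarrow> (real^'d \<Rightarrow> complex) \<Rightarrow> real^'d \<Rightarrow> complex" where
  "multi_deriv \<alpha> \<phi> = partials (SOME is. \<forall>i. count_list is i = \<alpha> i) \<phi>"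

abbreviation multi_abs :: "('d::finite \<Rightarrow> nat) \<Rightarrow> nat" where
  "multi_abs \<alpha> \<equiv> (\<Sum>i\<in>UNIV. \<alpha> i)"

definition ultra_norm ::
    "(nat \<Rightarrow> real) \<Rightarrow> (real^'d::finite) set \<Rightarrow> (real^'d \<Rightarrow> complex) \<Rightarrow> ennreal" where
  "ultra_norm w K \<phi> = (SUP x\<in>K. SUP \<alpha>. ennreal (norm (multi_deriv \<alpha> \<phi> x) / w (multi_abs \<alpha>)))"

definition norm_B ::
    "(nat \<Rightarrow> real) \<Rightarrow> (real^'d::finite) set \<Rightarrow> real \<Rightarrow> (real^'d \<Rightarrow> complex) \<Rightarrow> ennreal" where
  "norm_B M K h = ultra_norm (\<lambda>p. h ^ p * M p) K"

definition norm_R ::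
    "(nat \<Rightarrow> real) \<Rightarrow> (real^'d::finite) set \<Rightarrow> (nat \<Rightarrow> real) \<Rightarrow> (real^'d \<Rightarrow> complex) \<Rightarrow> ennreal" where
  "norm_R M K r = ultra_norm (seq_weight M r) K"

definition E_B :: "(nat \<Rightarrow> real) \<Rightarrow> (real^'d::finite) set \<Rightarrow> (real^'d \<Rightarrow> complex) set" where
  "E_B M \<Omega> = {\<phi>. smooth_on \<Omega> \<phi> \<and> (\<forall>K\<in>cpts \<Omega>. \<forall>h>0. norm_B M K h \<phi> < \<infinity>)}"

definition E_R :: "(nat \<Rightarrow> real) \<Rightarrow> (real^'d::finite) set \<Rightarrow> (real^'d \<Rightarrow> complex) set" where
  "E_R M \<Omega> = {\<phi>. smooth_on \<Omega> \<phi> \<and> (\<forall>K\<in>cpts \<Omega>. \<forall>r\<in>Rseq. norm_R M K r \<phi> < \<infinity>)}"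

abbreviation supp :: "(real^'d::finite) set \<Rightarrow> (real^'d \<Rightarrow> complex) \<Rightarrow> (real^'d) set" where
  "supp \<Omega> \<phi> \<equiv> closure (support_on \<Omega> \<phi>)"

definition D_B :: "(nat \<Rightarrow> real) \<Rightarrow> (real^'d::finite) set \<Rightarrow> (real^'d \<Rightarrow> complex) set" where
  "D_B M \<Omega> = {\<phi>\<in>E_B M \<Omega>. compact (supp \<Omega> \<phi>) \<and> supp \<Omega> \<phi> \<subseteq> \<Omega>}"

definition D_R :: "(nat \<Rightarrow> real) \<Rightarrow> (real^'d::finite) set \<Rightarrow> (real^'d \<Rightarrow> complex) set" where
  "D_R M \<Omega> = {\<phi>\<in>E_R M \<Omega>. compact (supp \<Omega> \<phi>) \<and> supp \<Omega> \<phi> \<subseteq> \<Omega>}"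

section \<open>Generalized ultradistributions\<close>

text \<open>A net indexed by \<open>\<epsilon> \<in> (0,1)\<close> is a total function of \<open>\<epsilon>\<close>; only indices in \<open>(0,1)\<close> matter.\<close>

type_synonym 'd net = "real \<Rightarrow> real^'d \<Rightarrow> complex"

definition bigO_net :: "(real \<Rightarrow> ennreal) \<Rightarrow> (real \<Rightarrow> real) \<Rightarrow> bool" where
  "bigO_net a b \<longleftrightarrow> (\<exists>C>0. \<exists>\<epsilon>\<^sub>0\<in>{0<..<1}. \<forall>\<epsilon>\<in>{0<..<\<epsilon>\<^sub>0}. a \<epsilon> \<le> ennreal (C * b \<epsilon>))"

definition moderate_B :: "(nat \<Rightarrow> real) \<Rightarrow> (real^'d::finite) set \<Rightarrow> 'd net set" where
  "moderate_B M \<Omega> = {g. (\<forall>\<epsilon>\<in>{0<..<1}. g \<epsilon> \<in> E_B M \<Omega>) \<and>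
     (\<forall>K\<in>cpts \<Omega>. \<forall>h>0. \<exists>k\<ge>0.
        bigO_net (\<lambda>\<epsilon>. norm_B M K h (g \<epsilon>)) (\<lambda>\<epsilon>. exp (assoc_fun M (k / \<epsilon>))))}"

definition negligible_B :: "(nat \<Rightarrow> real) \<Rightarrow> (real^'d::finite) set \<Rightarrow> 'd net set" where
  "negligible_B M \<Omega> = {g. (\<forall>\<epsilon>\<in>{0<..<1}. g \<epsilon> \<in> E_B M \<Omega>) \<and>
     (\<forall>K\<in>cpts \<Omega>. \<forall>h>0. \<forall>k\<ge>0.
        bigO_net (\<lambda>\<epsilon>. norm_B M K h (g \<epsilon>)) (\<lambda>\<epsilon>. exp (- assoc_fun M (k / \<epsilon>))))}"

definition moderate_R :: "(nat \<Rightarrow> real) \<Rightarrow> (real^'d::finite) set \<Rightarrow> 'd net set" where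
  "moderate_R M \<Omega> = {g. (\<forall>\<epsilon>\<in>{0<..<1}. g \<epsilon> \<in> E_R M \<Omega>) \<and>
     (\<forall>K\<in>cpts \<Omega>. \<forall>h\<in>Rseq. \<exists>k\<in>Rseq.
        bigO_net (\<lambda>\<epsilon>. norm_R M K h (g \<epsilon>)) (\<lambda>\<epsilon>. exp (assoc_fun_seq M k (1 / \<epsilon>))))}"

definition negligible_R :: "(nat \<Rightarrow> real) \<Rightarrow> (real^'d::finite) set \<Rightarrow> 'd net set" where
  "negligible_R M \<Omega> = {g. (\<forall>\<epsilon>\<in>{0<..<1}. g \<epsilon> \<in> E_R M \<Omega>) \<and>
     (\<forall>K\<in>cpts \<Omega>. \<forall>h\<in>Rseq. \<forall>k\<in>Rseq.
        bigO_net (\<lambda>\<epsilon>. norm_R M K h (g \<epsilon>)) (\<lambda>\<epsilon>. exp (- assoc_fun_seq M k (1 / \<epsilon>))))}"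

definition quot_rel :: "'d net set \<Rightarrow> 'd net set \<Rightarrow> ('d net \<times> 'd net) set" where
  "quot_rel E N = {(f, g). f \<in> E \<and> g \<in> E \<and> (\<lambda>\<epsilon> x. f \<epsilon> x - g \<epsilon> x) \<in> N}"

definition G_B :: "(nat \<Rightarrow> real) \<Rightarrow> (real^'d::finite) set \<Rightarrow> 'd net set set" where
  "G_B M \<Omega> = moderate_B M \<Omega> // quot_rel (moderate_B M \<Omega>) (negligible_B M \<Omega>)"

definition G_R :: "(nat \<Rightarrow> real) \<Rightarrow> (real^'d::finite) set \<Rightarrow> 'd net set set" where
  "G_R M \<Omega> = moderate_R M \<Omega> // quot_rel (moderate_R M \<Omega>) (negligible_R M \<Omega>)"

definition class_B :: "(nat \<Rightarrow> real) \<Rightarrow> (real^'d::finite) set \<Rightarrow> 'd net \<Rightarrow> 'd net set" where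
  "class_B M \<Omega> f = quot_rel (moderate_B M \<Omega>) (negligible_B M \<Omega>) `` {f}"

definition class_R :: "(nat \<Rightarrow> real) \<Rightarrow> (real^'d::finite) set \<Rightarrow> 'd net \<Rightarrow> 'd net set" where
  "class_R M \<Omega> f = quot_rel (moderate_R M \<Omega>) (negligible_R M \<Omega>) `` {f}"

definition zero_B :: "(nat \<Rightarrow> real) \<Rightarrow> (real^'d::finite) set \<Rightarrow> 'd net set" where
  "zero_B M \<Omega> = class_B M \<Omega> (\<lambda>\<epsilon> x. 0)"

definition zero_R :: "(nat \<Rightarrow> real) \<Rightarrow> (real^'d::finite) set \<Rightarrow> 'd net set" where
  "zero_R M \<Omega> = class_R M \<Omega> (\<lambda>\<epsilon> x. 0)"

definition Ginf_B :: "(nat \<Rightarrow> real) \<Rightarrow> (real^'d::finite) set \<Rightarrow> 'd net set set" where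
  "Ginf_B M \<Omega> = {f\<in>G_B M \<Omega>. \<exists>g\<in>moderate_B M \<Omega>. f = class_B M \<Omega> g \<and>
     (\<forall>K\<in>cpts \<Omega>. \<exists>k>0. \<forall>h>0.
        bigO_net (\<lambda>\<epsilon>. norm_B M K h (g \<epsilon>)) (\<lambda>\<epsilon>. exp (assoc_fun M (k / \<epsilon>))))}"

definition Ginf_R :: "(nat \<Rightarrow> real) \<Rightarrow> (real^'d::finite) set \<Rightarrow> 'd net set set" where
  "Ginf_R M \<Omega> = {f\<in>G_R M \<Omega>. \<exists>g\<in>moderate_R M \<Omega>. f = class_R M \<Omega> g \<and>
     (\<forall>K\<in>cpts \<Omega>. \<exists>k\<in>Rseq. \<forall>h\<in>Rseq.
        bigO_net (\<lambda>\<epsilon>. norm_R M K h (g \<epsilon>)) (\<lambda>\<epsilon>. exp (assoc_fun_seq M k (1 / \<epsilon>))))}"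

section \<open>Decay of the pairings with a set of test functions\<close>

text \<open>The threshold \<open>\<epsilon>\<^sub>0\<close> is common to all \<open>h\<close> and to all \<open>\<kappa> \<in> T\<close>. If \<open>T\<close> is the set of all test
  functions on a nonempty \<open>\<Omega>\<close>, such a common threshold need not exist for a negligible net, as
  nothing is assumed about the dependence on \<open>\<epsilon>\<close>: for \<open>\<epsilon> \<in> (1/(n+1), 1/n)\<close> put
  \<open>f\<^sub>\<epsilon> = \<phi>\<^sub>n / (\<epsilon> - 1/(n+1))\<close>, where the \<open>\<phi>\<^sub>n \<noteq> 0\<close> are real test functions whose supports form a
  locally finite disjoint family in \<open>\<Omega>\<close>, and \<open>f\<^sub>\<epsilon> = 0\<close> for all other \<open>\<epsilon>\<close>. It does exist if
  \<open>T\<close> consists of test functions supported in one compact subset of \<open>\<Omega>\<close>.\<close>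

definition weak_decay_B ::
    "(nat \<Rightarrow> real) \<Rightarrow> (real^'d::finite) set \<Rightarrow> (real^'d \<Rightarrow> complex) set \<Rightarrow> 'd net \<Rightarrow> bool" where
  "weak_decay_B M \<Omega> T f \<longleftrightarrow>
     (\<exists>\<epsilon>\<^sub>0\<in>{0<..<1}. \<forall>h>0. \<forall>\<kappa>\<in>T. \<exists>C>0. \<forall>\<epsilon>\<in>{0<..<\<epsilon>\<^sub>0}.
        norm (LINT t:\<Omega>|lborel. f \<epsilon> t * \<kappa> t) * exp (assoc_fun M (h / \<epsilon>)) < C)"

definition weak_decay_R ::
    "(nat \<Rightarrow> real) \<Rightarrow> (real^'d::finite) set \<Rightarrow> (real^'d \<Rightarrow> complex) set \<Rightarrow> 'd net \<Rightarrow> bool" where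
  "weak_decay_R M \<Omega> T f \<longleftrightarrow>
     (\<exists>\<epsilon>\<^sub>0\<in>{0<..<1}. \<forall>h\<in>Rseq. \<forall>\<kappa>\<in>T. \<exists>C>0. \<forall>\<epsilon>\<in>{0<..<\<epsilon>\<^sub>0}.
        norm (LINT t:\<Omega>|lborel. f \<epsilon> t * \<kappa> t) * exp (assoc_fun_seq M h (1 / \<epsilon>)) < C)"

end

theory Submission
  imports Defs "HOL-Complex_Analysis.Cauchy_Integral_Formula"
begin

text \<open>Only the direction from weak decay to negligibility needs an idea. Let \<open>g\<close> be a regular
  representative and fix a small ball. By a gliding hump argument the decay of the pairings is uniform:
  \<open>\<bar>\<integral> g\<^sub>\<epsilon> \<kappa>\<bar> \<le> C e\<^sup>-\<^sup>M\<^sup>(\<^sup>k\<^sup>/\<^sup>\<epsilon>\<^sup>) \<parallel>\<kappa>\<parallel>\<close> for one of the norms defining the topology of the test functions.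
  This may be applied to test functions depending on \<open>\<epsilon>\<close>, and the choice
  \<open>\<kappa> = \<partial>\<^sup>\<alpha> (\<theta> cnj (\<partial>\<^sup>\<alpha> g\<^sub>\<epsilon>))\<close> with a bump function \<open>\<theta> \<ge> 0\<close> turns the pairing into \<open>\<integral> \<theta> \<bar>\<partial>\<^sup>\<alpha> g\<^sub>\<epsilon>\<bar>\<^sup>2\<close>,
  up to sign. Regularity bounds the norm of \<open>\<kappa>\<close> by a growth rate not depending on \<open>k\<close>, so these weighted
  \<open>L\<^sup>2\<close> norms decay at every rate. Regularity also bounds the Lipschitz constants of \<open>\<partial>\<^sup>\<alpha> g\<^sub>\<epsilon>\<close>, hence the suprema
  decay as well; the losses are absorbed by (M.2), because \<open>k\<close> is arbitrary. Bump functions come from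
  \<open>exp (- 1 / x\<^sup>a)\<close>, as (M.3) makes \<open>M\<close> dominate a Gevrey sequence. In the Roumieu case Komatsu's lemma
  reduces all bounds by sequences in \<open>Rseq\<close> to geometric ones.\<close>

section \<open>Calculus of iterated partial derivatives\<close>

text \<open>Nothing is assumed about the dependence of a net on \<epsilon>, so uniformity must come
  from the test functions. A gliding hump needs convergence of suitable series of test functions,
  hence a decreasing sequence of weights; the geometric weights provide one in the Beurling case.
  The Roumieu test space is not of this kind, but on a fixed ball a regular net satisfies a single
  geometric bound for all small \<epsilon>, so the test functions built from it lie in one Banach
  space. Passing from L^2 to the supremum costs a power. Let d be the dimension, \<open>e0\<close>
  the growth rate of the regular net and \<open>e\<close> the decay rate of the pairings. Lipschitz
  constants and norms of the test functions are both of order \<open>e0\<close>, and the power d + 2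
  of a derivative is bounded by a multiple of \<open>e0 ^ (d + 1) / e\<close>. As \<open>e0\<close>
  is fixed before \<open>e\<close>, one may take \<open>e\<close> above
  \<open>et ^ (d + 2) * e0 ^ (d + 1)\<close> for the target rate \<open>et\<close>; (M.2) makes the
  rates closed under such products. For a derivative of order n, the Lipschitz constant contributes
  M_n^d and the norm of \<kappa> contributes M_n^2, so the root of order d + 2 leaves the right
  weight up to a geometric factor.\<close>

lemma partial_cong:
  assumes "open S" "x \<in> S" "\<And>y. y \<in> S \<Longrightarrow> u y = v y"
  shows "partial i u x = partial i v x"
proof -
  have "(u has_derivative D) (at x) \<longleftrightarrow> (v has_derivative D) (at x)" for D
    using has_derivative_transform_within_open[of u D x UNIV S v]
      has_derivative_transform_within_open[of v D x UNIV S u] assms by auto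
  then show ?thesis by (simp add: partial_def frechet_derivative_def)
qed

lemma partials_Nil [simp]: "partials [] u = u"
  and partials_Cons: "partials (i # is) u = partial i (partials is u)"
  and partials_append: "partials (is @ js) u = partials is (partials js u)"
  by (simp_all add: partials_def)

lemma partials_cong:
  assumes "open S" "x \<in> S" "\<And>y. y \<in> S \<Longrightarrow> u y = v y"
  shows "partials is u x = partials is v x"
  using assms(2)
proof (induction "is" arbitrary: x)
  case (Cons i "is")
  then show ?case using assms(1) by (auto simp: partials_Cons intro: partial_cong)
qed (use assms in auto)

lemma differentiable_cong_open:
  assumes "open S" "x \<in> S" "\<And>y. y \<in> S \<Longrightarrow> u y = v y" "u differentiable at x"
  shows "v differentiable at x"
proof -
  obtain D where "(u has_derivative D) (at x)" using assms(4) differentiable_def by blast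
  then have "(v has_derivative D) (at x)"
    using has_derivative_transform_within_open[of u D x UNIV S v] assms by auto
  then show ?thesis unfolding differentiable_def by blast
qed

lemma has_derivative_partial:
  fixes u :: "real^'d::finite \<Rightarrow> complex"
  assumes "u differentiable at x"
  shows "(u has_derivative (\<lambda>h. \<Sum>i\<in>UNIV. h $ i *\<^sub>R partial i u x)) (at x)"
proof -
  let ?D = "frechet_derivative u (at x)"
  have D: "(u has_derivative ?D) (at x)" using assms frechet_derivative_works by blast
  then have lin: "linear ?D" by (rule has_derivative_linear)
  have "?D h = (\<Sum>i\<in>UNIV. h $ i *\<^sub>R partial i u x)" for h
  proof -
    have "?D h = ?D (\<Sum>i\<in>UNIV. h $ i *\<^sub>R axis i 1)"
      using basis_expansion[of h] by (simp add: scalar_mult_eq_scaleR)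
    also have "\<dots> = (\<Sum>i\<in>UNIV. h $ i *\<^sub>R partial i u x)"
      by (simp add: linear_sum[OF lin] linear_scale[OF lin] partial_def)
    finally show ?thesis .
  qed
  then have "?D = (\<lambda>h. \<Sum>i\<in>UNIV. h $ i *\<^sub>R partial i u x)" by blast
  then show ?thesis using D by simp
qed

lemma partial_eqI:
  "(u has_derivative D) (at x) \<Longrightarrow> partial i u x = D (axis i 1)"
  unfolding partial_def using frechet_derivative_at by metis

lemma partial_add:
  assumes "u differentiable at x" "v differentiable at x"
  shows "partial i (\<lambda>x. u x + v x) x = partial i u x + partial i v x"
proof -
  have "(u has_derivative frechet_derivative u (at x)) (at x)" "(v has_derivative frechet_derivative v (at x)) (at x)"
    using assms frechet_derivative_works by blast+
  from partial_eqI[OF has_derivative_add[OF this]] show ?thesis by (simp add: partial_def)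
qed

lemma partial_mult:
  assumes "u differentiable at x" "v differentiable at x"
  shows "partial i (\<lambda>x. u x * v x) x = partial i u x * v x + u x * partial i v x"
proof -
  have "(u has_derivative frechet_derivative u (at x)) (at x)" "(v has_derivative frechet_derivative v (at x)) (at x)"
    using assms frechet_derivative_works by blast+
  from partial_eqI[OF has_derivative_mult[OF this]] show ?thesis by (simp add: partial_def add.commute)
qed

lemma partial_bounded_linear:
  assumes "bounded_linear L" "u differentiable at x"
  shows "partial i (\<lambda>x. L (u x)) x = L (partial i u x)"
proof -
  have "(u has_derivative frechet_derivative u (at x)) (at x)"
    using assms frechet_derivative_works by blast
  from partial_eqI[OF bounded_linear.has_derivative[OF assms(1) this]] show ?thesis
    by (simp add: partial_def)
qed

text \<open>Differentiability to finite order is the induction invariant for products.\<close>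

definition smooth_upto :: "nat \<Rightarrow> (real^'d) set \<Rightarrow> (real^'d \<Rightarrow> complex) \<Rightarrow> bool" where
  "smooth_upto n S u \<longleftrightarrow> (\<forall>is. length is \<le> n \<longrightarrow> (\<forall>x\<in>S. partials is u differentiable at x))"

lemma smooth_on_iff_upto: "smooth_on S u \<longleftrightarrow> (\<forall>n. smooth_upto n S u)"
  by (auto simp: smooth_on_def smooth_upto_def)

lemma smooth_upto_mono: "smooth_upto n S u \<Longrightarrow> m \<le> n \<Longrightarrow> smooth_upto m S u"
  by (auto simp: smooth_upto_def)

lemma smooth_upto_diff: "smooth_upto n S u \<Longrightarrow> x \<in> S \<Longrightarrow> u differentiable at x"
  by (metis smooth_upto_def le0 list.size(3) partials_Nil)

lemma smooth_upto_partial: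
  fixes u :: "real^'d::finite \<Rightarrow> complex"
  shows "smooth_upto (Suc n) S u \<Longrightarrow> smooth_upto n S (partial i u)"
  unfolding smooth_upto_def
proof (intro allI impI ballI)
  fix "is" :: "'d list" and x
  assume "\<forall>is. length is \<le> Suc n \<longrightarrow> (\<forall>x\<in>S. partials is u differentiable at x)" "length is \<le> n" "x \<in> S"
  from this(1)[rule_format, of "is @ [i]" x] this(2,3)
  show "partials is (partial i u) differentiable at x" by (simp add: partials_append partials_Cons)
qed

lemma smooth_upto_cong:
  fixes u v :: "real^'d::finite \<Rightarrow> complex"
  assumes "open S" "\<And>y. y \<in> S \<Longrightarrow> u y = v y" "smooth_upto n S u"
  shows "smooth_upto n S v"
  unfolding smooth_upto_def
proof (intro allI impI ballI)
  fix "is" :: "'d list" and x assume "length is \<le> n" "x \<in> S"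
  then have "partials is u differentiable at x" using assms by (auto simp: smooth_upto_def)
  then show "partials is v differentiable at x"
    by (rule differentiable_cong_open[OF assms(1) \<open>x \<in> S\<close>, rotated])
      (rule partials_cong[OF assms(1) _ assms(2)])
qed

lemma partials_add_upto:
  assumes "open S" "smooth_upto n S u" "smooth_upto n S v" "length is \<le> Suc n" "x \<in> S"
  shows "partials is (\<lambda>x. u x + v x) x = partials is u x + partials is v x"
  using assms(4,5)
proof (induction "is" arbitrary: x)
  case (Cons i "is")
  have "partials (i # is) (\<lambda>x. u x + v x) x = partial i (\<lambda>x. partials is u x + partials is v x) x"
    unfolding partials_Cons by (rule partial_cong[OF assms(1)]) (use Cons in auto)
  also have "\<dots> = partials (i # is) u x + partials (i # is) v x"
    using assms(2,3) Cons.prems by (auto simp: smooth_upto_def partials_Cons intro!: partial_add)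
  finally show ?case .
qed auto

lemma smooth_upto_add:
  fixes u v :: "real^'d::finite \<Rightarrow> complex"
  assumes "open S" "smooth_upto n S u" "smooth_upto n S v"
  shows "smooth_upto n S (\<lambda>x. u x + v x)"
  unfolding smooth_upto_def
proof (intro allI impI ballI)
  fix "is" :: "'d list" and x assume *: "length is \<le> n" "x \<in> S"
  show "partials is (\<lambda>x. u x + v x) differentiable at x"
    by (rule differentiable_cong_open[OF assms(1) *(2), of "\<lambda>x. partials is u x + partials is v x"])
      (use assms * partials_add_upto[OF assms] in \<open>auto simp: smooth_upto_def intro!: differentiable_add\<close>)
qed

lemma smooth_upto_mult:
  fixes u v :: "real^'d::finite \<Rightarrow> complex"
  assumes "open S" "smooth_upto n S u" "smooth_upto n S v"
  shows "smooth_upto n S (\<lambda>x. u x * v x)"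
  using assms(2,3)
proof (induction n arbitrary: u v)
  case 0
  then show ?case by (auto simp: smooth_upto_def intro!: differentiable_mult)
next
  case (Suc n)
  have n: "smooth_upto n S u" "smooth_upto n S v" using Suc.prems by (auto elim: smooth_upto_mono)
  show ?case unfolding smooth_upto_def
  proof (intro allI impI ballI)
    fix "is" :: "'d list" and x assume *: "length is \<le> Suc n" "x \<in> S"
    show "partials is (\<lambda>x. u x * v x) differentiable at x"
    \<comment> \<open>The last entry of the list is the derivative taken first. Splitting it off
      turns the product into a sum of products to which the induction hypothesis on \<open>n\<close>
      applies.\<close>
    proof (cases "is" rule: rev_cases)
      case Nil
      then show ?thesis using Suc.prems smooth_upto_diff * by (auto intro!: differentiable_mult)
    next
      case (snoc js i)
      have "smooth_upto n S (\<lambda>x. partial i u x * v x + u x * partial i v x)"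
        by (intro smooth_upto_add assms Suc.IH smooth_upto_partial n Suc.prems)
      moreover have "partial i u x * v x + u x * partial i v x = partial i (\<lambda>x. u x * v x) x" if "x \<in> S" for x
        using Suc.prems smooth_upto_diff that by (subst partial_mult) auto
      ultimately have "smooth_upto n S (partial i (\<lambda>x. u x * v x))"
        by (rule smooth_upto_cong[OF assms(1), rotated])
      then show ?thesis using * snoc by (auto simp: smooth_upto_def partials_append partials_Cons)
    qed
  qed
qed

lemma smooth_on_diff: "smooth_on S u \<Longrightarrow> x \<in> S \<Longrightarrow> u differentiable at x"
  by (metis smooth_on_def partials_Nil)

lemma smooth_on_partials: "smooth_on S u \<Longrightarrow> smooth_on S (partials js u)"
  by (simp add: smooth_on_def flip: partials_append)

lemma smooth_on_partial: "smooth_on S u \<Longrightarrow> smooth_on S (partial i u)"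
  using smooth_on_partials[of S u "[i]"] by (simp add: partials_Cons)

lemma smooth_on_cong:
  "\<lbrakk>open S; \<And>y. y \<in> S \<Longrightarrow> u y = v y; smooth_on S u\<rbrakk> \<Longrightarrow> smooth_on S v"
  using smooth_upto_cong unfolding smooth_on_iff_upto by blast

lemma smooth_on_add:
  "\<lbrakk>open S; smooth_on S u; smooth_on S v\<rbrakk> \<Longrightarrow> smooth_on S (\<lambda>x. u x + v x)"
  using smooth_upto_add unfolding smooth_on_iff_upto by blast

lemma smooth_on_mult:
  "\<lbrakk>open S; smooth_on S u; smooth_on S v\<rbrakk> \<Longrightarrow> smooth_on S (\<lambda>x. u x * v x)"
  using smooth_upto_mult unfolding smooth_on_iff_upto by blast

lemma smooth_on_continuous_on: "smooth_on S u \<Longrightarrow> continuous_on S u"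
  by (meson continuous_at_imp_continuous_on differentiable_imp_continuous_within smooth_on_diff)

lemma partials_add:
  "\<lbrakk>open S; smooth_on S u; smooth_on S v; x \<in> S\<rbrakk>
    \<Longrightarrow> partials is (\<lambda>x. u x + v x) x = partials is u x + partials is v x"
  by (rule partials_add_upto[of S "length is"]) (auto simp: smooth_on_iff_upto)

lemma partials_bounded_linear:
  assumes "open S" "bounded_linear L" "smooth_on S u" "x \<in> S"
  shows "partials is (\<lambda>x. L (u x)) x = L (partials is u x)"
  using assms(4)
proof (induction "is" arbitrary: x)
  case (Cons i "is")
  have "partials (i # is) (\<lambda>x. L (u x)) x = partial i (\<lambda>x. L (partials is u x)) x"
    unfolding partials_Cons by (rule partial_cong[OF assms(1)]) (use Cons in auto)
  also have "\<dots> = L (partials (i # is) u x)"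
    using assms Cons.prems by (auto simp: smooth_on_def partials_Cons intro!: partial_bounded_linear)
  finally show ?case .
qed auto

lemma smooth_on_bounded_linear:
  fixes u :: "real^'d::finite \<Rightarrow> complex"
  assumes "open S" "bounded_linear L" "smooth_on S u"
  shows "smooth_on S (\<lambda>x. L (u x))"
  unfolding smooth_on_def
proof (intro allI ballI)
  fix "is" :: "'d list" and x assume x: "x \<in> S"
  have "(\<lambda>x. L (partials is u x)) differentiable at x"
    using assms(3) x bounded_linear.has_derivative[OF assms(2)]
    unfolding smooth_on_def differentiable_def by blast
  then show "partials is (\<lambda>x. L (u x)) differentiable at x"
    by (rule differentiable_cong_open[OF assms(1) x, rotated])
      (rule partials_bounded_linear[OF assms, symmetric])
qed

lemma partials_zero: "partials is (\<lambda>x. 0) = (\<lambda>x. 0)"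
proof (induction "is")
  case (Cons i "is")
  then show ?case by (simp add: partials_Cons partial_def)
qed simp

lemma smooth_on_zero: "smooth_on S (\<lambda>x. 0)"
  by (auto simp: smooth_on_def partials_zero)

lemma partials_eq_0:
  assumes "open S" "x \<in> S" "\<And>y. y \<in> S \<Longrightarrow> u y = 0"
  shows "partials is u x = 0"
  using partials_cong[OF assms(1,2), of u "\<lambda>_. 0"] assms(3) by (simp add: partials_zero)

lemma smooth_on_partials_diff:
  "smooth_on S u \<Longrightarrow> x \<in> S \<Longrightarrow> partials is u differentiable at x"
  by (auto simp: smooth_on_def)

text \<open>The hypothesis couples the bounds for \<open>u\<close> and \<open>v\<close>, so that it is inherited by the pairs
  \<open>(\<partial>\<^sub>iu, v)\<close> and \<open>(u, \<partial>\<^sub>iv)\<close> and no binomial coefficients occur.\<close>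

lemma norm_partials_mult_le:
  assumes "open S" "smooth_on S u" "smooth_on S v" "x \<in> S"
    and "\<And>is js. norm (partials is u x) * norm (partials js v x)
           \<le> Q * a ^ length is * b ^ length js * Z (length is + length js)"
  shows "norm (partials is (\<lambda>x. u x * v x) x) \<le> Q * (a + b) ^ length is * Z (length is)"
  using assms(2,3,5)
proof (induction "is" arbitrary: u v Q Z rule: rev_induct)
  case Nil
  then show ?case using Nil(3)[of "[]" "[]"] by (simp add: norm_mult)
next
  case (snoc i "is")
  have "partials (is @ [i]) (\<lambda>x. u x * v x) x
      = partials is (\<lambda>x. partial i u x * v x + u x * partial i v x) x"
    unfolding partials_append partials_Cons partials_Nil
    by (rule partials_cong[OF assms(1,4)])
      (use snoc.prems smooth_on_diff in \<open>auto intro!: partial_mult\<close>)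
  also have "\<dots> = partials is (\<lambda>x. partial i u x * v x) x + partials is (\<lambda>x. u x * partial i v x) x"
    by (intro partials_add[OF assms(1) _ _ assms(4)] smooth_on_mult assms(1) smooth_on_partial snoc.prems)
  \<comment> \<open>Both summands fall under the induction hypothesis with the sequence
    \<open>Z\<close> shifted by one; the constants \<open>Q * a\<close> and \<open>Q * b\<close> add
    up to the new factor \<open>a + b\<close>.\<close>
  also have "norm \<dots> \<le> (Q * a) * (a + b) ^ length is * Z (Suc (length is))
      + (Q * b) * (a + b) ^ length is * Z (Suc (length is))"
  proof (intro norm_triangle_mono)
    show "norm (partials is (\<lambda>x. partial i u x * v x) x)
        \<le> (Q * a) * (a + b) ^ length is * Z (Suc (length is))"
    proof (rule snoc.IH[OF smooth_on_partial[OF snoc.prems(1)] snoc.prems(2)])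
      show "norm (partials is (partial i u) x) * norm (partials js v x)
          \<le> Q * a * a ^ length is * b ^ length js * Z (Suc (length is + length js))" for "is" js
        using snoc.prems(3)[of "is @ [i]" js] by (simp add: partials_append partials_Cons mult_ac)
    qed
    show "norm (partials is (\<lambda>x. u x * partial i v x) x)
        \<le> (Q * b) * (a + b) ^ length is * Z (Suc (length is))"
    proof (rule snoc.IH[OF snoc.prems(1) smooth_on_partial[OF snoc.prems(2)]])
      show "norm (partials is u x) * norm (partials js (partial i v) x)
          \<le> Q * b * a ^ length is * b ^ length js * Z (Suc (length is + length js))" for "is" js
        using snoc.prems(3)[of "is" "js @ [i]"] by (simp add: partials_append partials_Cons mult_ac)
    qed
  qed
  finally show ?case by (simp add: algebra_simps)
qed

subsection \<open>Symmetry of mixed derivatives\<close>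

text \<open>The mean value theorem is applied twice to the second difference: in direction
  \<open>p\<close> to \<open>F (x + h *\<^sub>R q + s *\<^sub>R p) - F (x + s *\<^sub>R p)\<close>
  as a function of \<open>s\<close>, then in direction \<open>q\<close> to \<open>A\<close>. The
  condition on \<open>h\<close> keeps the whole parallelogram inside the ball.\<close>

lemma mixed_difference_mvt:
  fixes F A B :: "'a::real_normed_vector \<Rightarrow> real"
  assumes A: "\<And>y. y \<in> ball x r \<Longrightarrow> ((\<lambda>s. F (y + s *\<^sub>R p)) has_real_derivative A y) (at 0)"
    and B: "\<And>y. y \<in> ball x r \<Longrightarrow> ((\<lambda>t. A (y + t *\<^sub>R q)) has_real_derivative B y) (at 0)"
    and h: "0 < h" "h * (norm p + norm q) < r"
  shows "\<exists>\<xi> \<eta>. 0 < \<xi> \<and> \<xi> < h \<and> 0 < \<eta> \<and> \<eta> < h \<and>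
    F (x + h *\<^sub>R p + h *\<^sub>R q) - F (x + h *\<^sub>R p) - F (x + h *\<^sub>R q) + F x = h\<^sup>2 * B (x + \<xi> *\<^sub>R p + \<eta> *\<^sub>R q)"
proof -
  have inball: "x + s *\<^sub>R p + t *\<^sub>R q \<in> ball x r" if "0 \<le> s" "s \<le> h" "0 \<le> t" "t \<le> h" for s t
  proof -
    have "norm (s *\<^sub>R p + t *\<^sub>R q) \<le> s * norm p + t * norm q"
      using that norm_triangle_ineq[of "s *\<^sub>R p" "t *\<^sub>R q"] by simp
    also have "\<dots> \<le> h * norm p + h * norm q"
      using that by (intro add_mono mult_right_mono) auto
    finally show ?thesis using h by (simp add: dist_norm algebra_simps norm_minus_commute)
  qed
  have shift: "((\<lambda>s. G (y + s *\<^sub>R v)) has_real_derivative D) (at s)"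
    if "((\<lambda>s'. G ((y + s *\<^sub>R v) + s' *\<^sub>R v)) has_real_derivative D) (at 0)" for G D s and y v :: 'a
  proof -
    have "(\<lambda>x. G (y + (x + s) *\<^sub>R v)) = (\<lambda>s'. G ((y + s *\<^sub>R v) + s' *\<^sub>R v))"
      by (simp add: algebra_simps)
    then show ?thesis using that DERIV_shift[of "\<lambda>s. G (y + s *\<^sub>R v)" D 0 s] by simp
  qed
  let ?g = "\<lambda>s. F (x + h *\<^sub>R q + s *\<^sub>R p) - F (x + s *\<^sub>R p)"
  have "\<exists>z>0. z < h \<and> ?g h - ?g 0 = (h - 0) * (A (x + h *\<^sub>R q + z *\<^sub>R p) - A (x + z *\<^sub>R p))"
  proof (rule MVT2[OF h(1)])
    fix s assume "0 \<le> s" "s \<le> h"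
    then have "x + h *\<^sub>R q + s *\<^sub>R p \<in> ball x r" "x + s *\<^sub>R p \<in> ball x r"
      using inball[of s 0] inball[of s h] h by (simp_all add: add_ac)
    then show "(?g has_real_derivative A (x + h *\<^sub>R q + s *\<^sub>R p) - A (x + s *\<^sub>R p)) (at s)"
      using shift[OF A] by (intro DERIV_diff) auto
  qed
  then obtain \<xi> where \<xi>: "0 < \<xi>" "\<xi> < h"
    and 1: "?g h - ?g 0 = h * (A (x + h *\<^sub>R q + \<xi> *\<^sub>R p) - A (x + \<xi> *\<^sub>R p))" by auto
  have "\<exists>z>0. z < h \<and> A (x + \<xi> *\<^sub>R p + h *\<^sub>R q) - A (x + \<xi> *\<^sub>R p + 0 *\<^sub>R q)
      = (h - 0) * B (x + \<xi> *\<^sub>R p + z *\<^sub>R q)"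
    by (rule MVT2[OF h(1)], rule shift, rule B, rule inball) (use \<xi> in auto)
  then obtain \<eta> where \<eta>: "0 < \<eta>" "\<eta> < h"
    and 2: "A (x + \<xi> *\<^sub>R p + h *\<^sub>R q) - A (x + \<xi> *\<^sub>R p) = h * B (x + \<xi> *\<^sub>R p + \<eta> *\<^sub>R q)" by auto
  have "F (x + h *\<^sub>R p + h *\<^sub>R q) - F (x + h *\<^sub>R p) - F (x + h *\<^sub>R q) + F x = h\<^sup>2 * B (x + \<xi> *\<^sub>R p + \<eta> *\<^sub>R q)"
    using 1 2 by (simp add: algebra_simps power2_eq_square)
  then show ?thesis using \<xi> \<eta> by blast
qed

text \<open>The second difference does not change when \<open>p\<close> and \<open>q\<close> are
  exchanged, so a value of \<open>B\<close> and a value of \<open>B'\<close> at points arbitrarily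
  close to \<open>x\<close> coincide; continuity at \<open>x\<close> does the rest.\<close>

lemma mixed_derivatives_eq:
  fixes F A A' B B' :: "'a::real_normed_vector \<Rightarrow> real"
  assumes "0 < r"
    and A: "\<And>y. y \<in> ball x r \<Longrightarrow> ((\<lambda>s. F (y + s *\<^sub>R p)) has_real_derivative A y) (at 0)"
    and B: "\<And>y. y \<in> ball x r \<Longrightarrow> ((\<lambda>t. A (y + t *\<^sub>R q)) has_real_derivative B y) (at 0)"
    and A': "\<And>y. y \<in> ball x r \<Longrightarrow> ((\<lambda>s. F (y + s *\<^sub>R q)) has_real_derivative A' y) (at 0)"
    and B': "\<And>y. y \<in> ball x r \<Longrightarrow> ((\<lambda>t. A' (y + t *\<^sub>R p)) has_real_derivative B' y) (at 0)"
    and cont: "isCont B x" "isCont B' x"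
  shows "B x = B' x"
proof (rule ccontr)
  assume "B x \<noteq> B' x"
  define e where "e = \<bar>B x - B' x\<bar> / 2"
  have e: "0 < e" using \<open>B x \<noteq> B' x\<close> by (simp add: e_def)
  obtain d where d: "0 < d" "\<And>y. dist y x < d \<Longrightarrow> dist (B y) (B x) < e"
    using cont(1) e unfolding continuous_at_eps_delta by blast
  obtain d' where d': "0 < d'" "\<And>y. dist y x < d' \<Longrightarrow> dist (B' y) (B' x) < e"
    using cont(2) e unfolding continuous_at_eps_delta by blast
  define m where "m = min r (min d d')"
  define h where "h = m / (2 * (norm p + norm q + 1))"
  have m: "0 < m" "m \<le> r" "m \<le> d" "m \<le> d'" using assms d d' by (auto simp: m_def)
  have pq: "0 < norm p + norm q + 1" by (smt (verit) norm_ge_zero)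
  have h: "0 < h" using m pq by (simp add: h_def)
  have "h * c = m / 2" if "h = m / (2 * c)" "0 < c" for c :: real using that by simp
  from this[OF h_def pq] have "h * (norm p + norm q + 1) = m / 2" .
  then have hm: "h * (norm p + norm q) < m" using m h by (simp add: algebra_simps)
  obtain \<xi> \<eta> where 1: "0 < \<xi>" "\<xi> < h" "0 < \<eta>" "\<eta> < h"
    "F (x + h *\<^sub>R p + h *\<^sub>R q) - F (x + h *\<^sub>R p) - F (x + h *\<^sub>R q) + F x = h\<^sup>2 * B (x + \<xi> *\<^sub>R p + \<eta> *\<^sub>R q)"
    using mixed_difference_mvt[OF A B h] hm m by force
  obtain \<eta>' \<xi>' where 2: "0 < \<xi>'" "\<xi>' < h" "0 < \<eta>'" "\<eta>' < h"
    "F (x + h *\<^sub>R q + h *\<^sub>R p) - F (x + h *\<^sub>R q) - F (x + h *\<^sub>R p) + F x = h\<^sup>2 * B' (x + \<eta>' *\<^sub>R q + \<xi>' *\<^sub>R p)"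
    using mixed_difference_mvt[OF A' B' h] hm m by (force simp: add.commute)
  have eq: "B (x + \<xi> *\<^sub>R p + \<eta> *\<^sub>R q) = B' (x + \<eta>' *\<^sub>R q + \<xi>' *\<^sub>R p)"
    using 1(5) 2(5) h by (simp add: algebra_simps)
  have near: "dist (x + s *\<^sub>R p + t *\<^sub>R q) x < m" if "0 < s" "s < h" "0 < t" "t < h" for s t
  proof -
    have "norm (s *\<^sub>R p + t *\<^sub>R q) \<le> s * norm p + t * norm q"
      using that norm_triangle_ineq[of "s *\<^sub>R p" "t *\<^sub>R q"] by simp
    also have "\<dots> \<le> h * norm p + h * norm q"
      using that by (intro add_mono mult_right_mono) auto
    finally show ?thesis using hm by (simp add: dist_norm algebra_simps)
  qed
  have "dist (B (x + \<xi> *\<^sub>R p + \<eta> *\<^sub>R q)) (B x) < e"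
    by (rule d(2)) (use near[OF 1(1-4)] m in simp)
  moreover have "dist (B' (x + \<eta>' *\<^sub>R q + \<xi>' *\<^sub>R p)) (B' x) < e"
    by (rule d'(2)) (use near[OF 2(1-4)] m in \<open>simp add: add_ac\<close>)
  moreover have "dist (B x) (B' x) \<le> dist (B' (x + \<eta>' *\<^sub>R q + \<xi>' *\<^sub>R p)) (B x)
      + dist (B' (x + \<eta>' *\<^sub>R q + \<xi>' *\<^sub>R p)) (B' x)" by (rule dist_triangle3)
  moreover have "dist (B x) (B' x) = e + e" by (simp add: e_def dist_real_def)
  ultimately show False unfolding eq by linarith
qed

lemma has_vector_derivative_partial_line:
  fixes u :: "real^'d::finite \<Rightarrow> complex"
  assumes "u differentiable at x"
  shows "((\<lambda>s. u (x + s *\<^sub>R axis i 1)) has_vector_derivative partial i u x) (at 0)"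
proof -
  let ?D = "frechet_derivative u (at x)"
  have D: "(u has_derivative ?D) (at (x + 0 *\<^sub>R axis i 1))"
    using assms frechet_derivative_works by auto
  have "((\<lambda>s. x + s *\<^sub>R axis i 1) has_derivative (\<lambda>s. s *\<^sub>R axis i 1)) (at 0)"
    by (auto intro!: derivative_eq_intros)
  from has_derivative_compose[OF this D]
  show ?thesis
    using D by (simp add: has_vector_derivative_def partial_def linear_scale has_derivative_linear)
qed

text \<open>The mean value theorem behind \<open>mixed_derivatives_eq\<close> concerns real
  functions, hence the separate treatment of real and imaginary parts.\<close>

lemma partial_commute:
  fixes u :: "real^'d::finite \<Rightarrow> complex"
  assumes "open S" "smooth_on S u" "x \<in> S"
  shows "partial i (partial j u) x = partial j (partial i u) x"
proof -
  obtain r where r: "0 < r" "ball x r \<subseteq> S" using assms open_contains_ball by blast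
  have 1: "((\<lambda>s. u (y + s *\<^sub>R axis k 1)) has_vector_derivative partial k u y) (at 0)"
    if "y \<in> ball x r" for y k
    using that r assms smooth_on_diff has_vector_derivative_partial_line by blast
  have 2: "((\<lambda>s. partial l u (y + s *\<^sub>R axis k 1)) has_vector_derivative partial k (partial l u) y) (at 0)"
    if "y \<in> ball x r" for y k l
    using that r assms smooth_on_diff smooth_on_partial has_vector_derivative_partial_line by blast
  have cont: "isCont (partial k (partial l u)) x" for k l
    using assms smooth_on_diff smooth_on_partial differentiable_imp_continuous_within by blast
  have Re1: "((\<lambda>s. Re (u (y + s *\<^sub>R axis k 1))) has_real_derivative Re (partial k u y)) (at 0)"
    if "y \<in> ball x r" for y k
    using bounded_linear.has_vector_derivative[OF bounded_linear_Re 1[OF that]]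
    by (simp add: has_real_derivative_iff_has_vector_derivative)
  have Re2: "((\<lambda>s. Re (partial l u (y + s *\<^sub>R axis k 1))) has_real_derivative Re (partial k (partial l u) y)) (at 0)"
    if "y \<in> ball x r" for y k l
    using bounded_linear.has_vector_derivative[OF bounded_linear_Re 2[OF that]]
    by (simp add: has_real_derivative_iff_has_vector_derivative)
  have Re: "Re (partial i (partial j u) x) = Re (partial j (partial i u) x)"
    by (rule mixed_derivatives_eq[OF r(1) Re1 Re2 Re1 Re2]) (use cont in \<open>auto intro!: continuous_intros\<close>)
  have Im1: "((\<lambda>s. Im (u (y + s *\<^sub>R axis k 1))) has_real_derivative Im (partial k u y)) (at 0)"
    if "y \<in> ball x r" for y k
    using bounded_linear.has_vector_derivative[OF bounded_linear_Im 1[OF that]]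
    by (simp add: has_real_derivative_iff_has_vector_derivative)
  have Im2: "((\<lambda>s. Im (partial l u (y + s *\<^sub>R axis k 1))) has_real_derivative Im (partial k (partial l u) y)) (at 0)"
    if "y \<in> ball x r" for y k l
    using bounded_linear.has_vector_derivative[OF bounded_linear_Im 2[OF that]]
    by (simp add: has_real_derivative_iff_has_vector_derivative)
  have Im: "Im (partial i (partial j u) x) = Im (partial j (partial i u) x)"
    by (rule mixed_derivatives_eq[OF r(1) Im1 Im2 Im1 Im2]) (use cont in \<open>auto intro!: continuous_intros\<close>)
  show ?thesis using Re Im by (rule complex_eqI)
qed

lemma partial_partials_commute:
  fixes u :: "real^'d::finite \<Rightarrow> complex"
  assumes "open S" "smooth_on S u" "x \<in> S"
  shows "partial i (partials js u) x = partials js (partial i u) x"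
  using assms(3)
proof (induction js arbitrary: x)
  case (Cons j js)
  have "partial i (partials (j # js) u) x = partial j (partial i (partials js u)) x"
    unfolding partials_Cons by (rule partial_commute[OF assms(1) smooth_on_partials[OF assms(2)] Cons.prems])
  also have "\<dots> = partial j (partials js (partial i u)) x"
    by (rule partial_cong[OF assms(1) Cons.prems Cons.IH])
  finally show ?case by (simp add: partials_Cons)
qed auto

lemma partials_mset_cong:
  fixes u :: "real^'d::finite \<Rightarrow> complex"
  assumes "open S" "smooth_on S u" "x \<in> S" "mset is = mset js"
  shows "partials is u x = partials js u x"
  using assms(3,4)
proof (induction "is" arbitrary: js x)
  case (Cons i "is")
  have "i \<in> set js" using Cons.prems(2) by (metis list.set_intros(1) set_mset_mset)
  then obtain js1 js2 where js: "js = js1 @ i # js2" by (meson split_list)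
  have "mset is = mset (js1 @ js2)" using Cons.prems(2) js by simp
  then have "partials is u y = partials (js1 @ js2) u y" if "y \<in> S" for y
    using Cons.IH that by blast
  then have "partials (i # is) u x = partial i (partials (js1 @ js2) u) x"
    using partial_cong[OF assms(1) Cons.prems(1)] unfolding partials_Cons by blast
  also have "\<dots> = partials js u x"
    unfolding js partials_append partials_Cons
    by (rule partial_partials_commute[OF assms(1) smooth_on_partials[OF assms(2)] Cons.prems(1)])
  finally show ?case .
qed auto

section \<open>Multi-indices and lists of coordinates\<close>

lemma length_eq_sum_count_list:
  "length is = (\<Sum>i\<in>UNIV. count_list is (i :: 'd::finite))"
proof (induction "is")
  case (Cons a "is")
  have "count_list (a # is) i = count_list is i + (if a = i then 1 else 0)" for i by simp
  then show ?case using Cons by (simp only: sum.distrib) simp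
qed simp

lemma ex_list_count:
  fixes \<alpha> :: "'d::finite \<Rightarrow> nat"
  shows "\<exists>is. \<forall>i. count_list is i = \<alpha> i"
proof -
  have "\<exists>is. \<forall>i. count_list is i = (if i \<in> A then \<alpha> i else 0)" if "finite A" for A :: "'d set"
    using that
  proof induction
    case (insert a A)
    then obtain js where js: "\<And>i. count_list js i = (if i \<in> A then \<alpha> i else 0)" by auto
    have "count_list (replicate n a) i = (if i = a then n else 0)" for n i
      by (induction n) auto
    then show ?case using insert js by (intro exI[of _ "replicate (\<alpha> a) a @ js"]) auto
  qed (auto intro: exI[of _ "[]"])
  from this[of UNIV] show ?thesis by auto
qed

lemma multi_deriv_list:
  fixes \<alpha> :: "'d::finite \<Rightarrow> nat"
  obtains "is" where "multi_deriv \<alpha> u = partials is u" "length is = multi_abs \<alpha>"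
proof
  let ?is = "SOME is. \<forall>i. count_list is i = \<alpha> i"
  show "multi_deriv \<alpha> u = partials ?is u" by (simp add: multi_deriv_def)
  have "\<forall>i. count_list ?is i = \<alpha> i" using someI_ex[OF ex_list_count] .
  then show "length ?is = multi_abs \<alpha>" by (simp add: length_eq_sum_count_list)
qed

lemma multi_deriv_count_list:
  fixes u :: "real^'d::finite \<Rightarrow> complex"
  assumes "open S" "smooth_on S u" "x \<in> S"
  shows "multi_deriv (count_list is) u x = partials is u x"
proof -
  have "\<forall>i. count_list (SOME js. \<forall>i. count_list js i = count_list is i) i = count_list is i"
    using someI_ex[OF ex_list_count] .
  then have "mset (SOME js. \<forall>i. count_list js i = count_list is i) = mset is"
    by (intro multiset_eqI) (simp add: count_mset)
  then show ?thesis unfolding multi_deriv_def by (rule partials_mset_cong[OF assms])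
qed

text \<open>Seminorms are handled from here on as bounds over all lists of coordinates, which suit
  induction. This passage is what the symmetry of mixed derivatives is for:
  \<open>multi_deriv\<close> follows one chosen list per multi-index.\<close>

lemma ultra_norm_le_iff:
  fixes u :: "real^'d::finite \<Rightarrow> complex"
  assumes "open S" "smooth_on S u" "K \<subseteq> S" "\<And>n. 0 < w n" "0 \<le> C"
  shows "ultra_norm w K u \<le> ennreal C \<longleftrightarrow> (\<forall>x\<in>K. \<forall>is. norm (partials is u x) \<le> C * w (length is))"
proof -
  have "ultra_norm w K u \<le> ennreal C \<longleftrightarrow>
      (\<forall>x\<in>K. \<forall>\<alpha>. norm (multi_deriv \<alpha> u x) \<le> C * w (multi_abs \<alpha>))"
    using assms(4,5) by (auto simp: ultra_norm_def SUP_le_iff divide_le_eq)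
  also have "\<dots> \<longleftrightarrow> (\<forall>x\<in>K. \<forall>is. norm (partials is u x) \<le> C * w (length is))"
  proof (intro ball_cong refl iffI allI)
    fix x "is" assume "x \<in> K" and *: "\<forall>\<alpha>. norm (multi_deriv \<alpha> u x) \<le> C * w (multi_abs \<alpha>)"
    then have "multi_deriv (count_list is) u x = partials is u x"
      using multi_deriv_count_list[OF assms(1,2)] assms(3) by blast
    then show "norm (partials is u x) \<le> C * w (length is)"
      using *[rule_format, of "count_list is"] by (simp flip: length_eq_sum_count_list)
  next
    fix x \<alpha> assume *: "\<forall>is. norm (partials is u x) \<le> C * w (length is)"
    obtain "is" where "multi_deriv \<alpha> u = partials is u" "length is = multi_abs \<alpha>"
      by (rule multi_deriv_list)
    then show "norm (multi_deriv \<alpha> u x) \<le> C * w (multi_abs \<alpha>)" using * by metis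
  qed
  finally show ?thesis .
qed

section \<open>Weight sequences\<close>

lemma power_le_fact_times_exp:
  fixes x :: real
  assumes "0 \<le> x"
  shows "x ^ n \<le> fact n * exp x"
proof -
  have "(\<Sum>k\<in>{n}. x ^ k /\<^sub>R fact k) \<le> exp x"
    unfolding exp_def using assms summable_exp_generic[of x] by (intro sum_le_suminf) auto
  then show ?thesis by (simp add: field_simps)
qed

text \<open>The constants of (M.2) and (M.3) become parameters. The minimum in (M.2) is unfolded
  into all splittings \<open>p + q\<close>, and the sum in (M.3) is reindexed by
  \<open>j = n + p + 1\<close> as an ordinary series.\<close>

locale weight =
  fixes M :: "nat \<Rightarrow> real" and c0 H :: real
  assumes M_pos [simp]: "0 < M p" and M_0 [simp]: "M 0 = 1"
    and M1: "(M (Suc p))\<^sup>2 \<le> M p * M (Suc (Suc p))"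
    and c0: "1 \<le> c0" and H: "1 \<le> H"
    and M2: "M (p + q) \<le> c0 * H ^ (p + q) * (M p * M q)"
    and M3_summable: "summable (\<lambda>n. M n / M (Suc n))"
    and M3: "1 \<le> p \<Longrightarrow> (\<Sum>n. M (n + p) / M (Suc (n + p))) \<le> c0 * real p * M p / M (Suc p)"
begin

text \<open>The usual quotients m_p = M_p / M_(p-1), with the index shifted by one.\<close>

definition \<mu> :: "nat \<Rightarrow> real" where "\<mu> n = M (Suc n) / M n"

lemma \<mu>_pos [simp]: "0 < \<mu> n" by (simp add: \<mu>_def)

lemma \<mu>_nonneg [simp]: "0 \<le> \<mu> n" using \<mu>_pos[of n] by linarith

lemma M_nz [simp]: "M n \<noteq> 0" using M_pos[of n] by linarith

lemma M_nonneg [simp]: "0 \<le> M n" using M_pos[of n] by linarith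

lemma M_Suc: "M (Suc n) = M n * \<mu> n" by (simp add: \<mu>_def)

lemma \<mu>_mono: "m \<le> n \<Longrightarrow> \<mu> m \<le> \<mu> n"
proof (induction rule: dec_induct)
  case (step n)
  have "\<mu> n \<le> \<mu> (Suc n)"
    using M1[of n] by (simp add: \<mu>_def divide_le_eq le_divide_eq power2_eq_square mult.commute)
  then show ?case using step by simp
qed auto

text \<open>Since \<open>M 0 = 1\<close>, \<open>M q\<close> is the product of the first
  \<open>q\<close> quotients \<open>\<mu>\<close>, and \<open>M (p + q) / M p\<close> is a product
  of \<open>q\<close> later ones, which are at least as large.\<close>

lemma M_mult_le: "M p * M q \<le> M (p + q)"
proof (induction q)
  case (Suc q)
  have "M p * M (Suc q) = (M p * M q) * \<mu> q" by (simp add: M_Suc)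
  also have "\<dots> \<le> M (p + q) * \<mu> (p + q)"
    by (intro mult_mono Suc \<mu>_mono) (auto intro: less_imp_le)
  finally show ?case by (simp add: M_Suc)
qed auto

text \<open>Strong non-quasianalyticity: the tails \<open>T p\<close> satisfy \<open>T (p + 1) \<le> (1 - 1 / (c0 p)) T p\<close>, so they
  decay like a negative power of \<open>p\<close>, and \<open>\<mu>\<close> grows faster than linearly.\<close>

lemma \<mu>_growth:
  obtains N c where "1 \<le> (N::nat)" "0 < c" "\<And>n. real (Suc n) ^ Suc N \<le> c * \<mu> n ^ N"
proof -
  define a where "a n = M n / M (Suc n)" for n
  define T where "T p = (\<Sum>n. a (n + p))" for p
  have a: "0 < a n" "a n = 1 / \<mu> n" for n by (simp_all add: a_def \<mu>_def)
  have a_antimono: "a n \<le> a m" if "m \<le> n" for m n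
    using \<mu>_mono[OF that] by (simp add: a frac_le)
  have sa: "summable (\<lambda>n. a (n + p))" for p
    using M3_summable by (simp add: a_def summable_iff_shift[of "\<lambda>n. M n / M (Suc n)" p])
  have T_nonneg: "0 \<le> T p" for p
    unfolding T_def by (intro suminf_nonneg sa less_imp_le a)
  have T_Suc: "T p = a p + T (Suc p)" for p
    using suminf_split_head[OF sa[of p]] by (simp add: T_def)
  have T_le: "T p \<le> c0 * real p * a p" if "1 \<le> p" for p
    using M3[OF that] by (simp add: T_def a_def)
  \<comment> \<open>By Bernoulli, \<open>N \<ge> c0\<close> gives
    \<open>(1 + 1 / (c0 * p)) ^ N \<ge> 1 + 1 / p\<close>. Hence
    \<open>(1 - 1 / (c0 * p)) ^ N \<le> p / (p + 1)\<close>, and \<open>p * T p ^ N\<close> does not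
    increase.\<close>
  define N where "N = nat \<lceil>c0\<rceil>"
  have N: "c0 \<le> real N" "1 \<le> N" using c0 by (simp_all add: N_def) linarith+
  have step: "real (Suc p) * T (Suc p) ^ N \<le> real p * T p ^ N" if p: "1 \<le> p" for p
  proof -
    define x where "x = 1 / (c0 * real p)"
    have cp: "1 \<le> c0 * real p" using c0 p by (simp add: mult_ge1_I)
    have x: "0 < x" "x \<le> 1" using cp by (simp_all add: x_def)
    have "T p / (c0 * real p) \<le> a p"
      using T_le[OF p] cp by (subst divide_le_eq) (simp add: mult_ac)
    then have "T (Suc p) \<le> (1 - x) * T p" using T_Suc[of p] by (simp add: x_def algebra_simps)
    then have "T (Suc p) ^ N \<le> ((1 - x) * T p) ^ N" by (intro power_mono T_nonneg)
    then have 1: "T (Suc p) ^ N \<le> (1 - x) ^ N * T p ^ N" by (simp add: power_mult_distrib)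
    have "real N * x \<ge> 1 / real p"
      using N(1) c0 p by (simp add: x_def divide_simps)
    then have "1 + 1 / real p \<le> (1 + x) ^ N"
      using Bernoulli_inequality[of x N] x by linarith
    then have "(1 - x) ^ N * (1 + 1 / real p) \<le> (1 - x) ^ N * (1 + x) ^ N"
      using x by (intro mult_left_mono) auto
    also have "\<dots> = (1 - x * x) ^ N" by (simp add: power_mult_distrib [symmetric] algebra_simps)
    also have "\<dots> \<le> 1"
    proof (intro power_le_one)
      show "0 \<le> 1 - x * x" using x mult_le_one[of x x] by simp
    qed simp
    finally have "(1 - x) ^ N * real (Suc p) \<le> real p" using p by (simp add: field_simps)
    then have "(1 - x) ^ N * real (Suc p) * T p ^ N \<le> real p * T p ^ N"
      by (intro mult_right_mono) (simp_all add: T_nonneg)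
    moreover have "real (Suc p) * T (Suc p) ^ N \<le> real (Suc p) * ((1 - x) ^ N * T p ^ N)"
      by (intro mult_left_mono 1) simp
    moreover have "real (Suc p) * ((1 - x) ^ N * T p ^ N) = (1 - x) ^ N * real (Suc p) * T p ^ N"
      by (simp only: mult_ac)
    ultimately show ?thesis by linarith
  qed
  have pT: "real p * T p ^ N \<le> T 1 ^ N" if "1 \<le> p" for p
    using that by (induction rule: dec_induct) (use step in \<open>auto intro: order_trans\<close>)
  \<comment> \<open>The tail \<open>T p\<close> contains the \<open>p\<close> terms from
    \<open>a p\<close> to \<open>a (2 * p - 1)\<close>, each at least \<open>a (2 * p)\<close>. This
    turns decay of the tails into decay of single terms and brings in the remaining powers of
    \<open>p\<close>.\<close>
  have a_even: "real p ^ Suc N * a (2 * p) ^ N \<le> T 1 ^ N" if p: "1 \<le> p" for p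
  proof -
    have "real p * a (2 * p) = (\<Sum>n<p. a (2 * p))" by simp
    also have "\<dots> \<le> (\<Sum>n<p. a (n + p))" by (intro sum_mono a_antimono) auto
    also have "\<dots> \<le> T p" unfolding T_def by (intro sum_le_suminf sa ballI less_imp_le a) auto
    finally have "(real p * a (2 * p)) ^ N \<le> T p ^ N"
      using a(1)[of "2 * p"] by (intro power_mono) auto
    then have "real p * (real p * a (2 * p)) ^ N \<le> real p * T p ^ N" by (intro mult_left_mono) auto
    also have "\<dots> \<le> T 1 ^ N" by (rule pT[OF p])
    finally show ?thesis by (simp add: power_mult_distrib mult_ac)
  qed
  \<comment> \<open>The first entry of the maximum serves \<open>n \<ge> 2\<close>, where
    \<open>n + 1 \<le> 5 * (n div 2)\<close>, the second serves \<open>n < 2\<close>; the summand 1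
    makes \<open>c\<close> positive.\<close>
  define c where "c = max (5 ^ Suc N * T 1 ^ N) (2 ^ Suc N * a 0 ^ N) + 1"
  have "real (Suc n) ^ Suc N * a n ^ N \<le> c" for n
  proof (cases "n < 2")
    case True
    then have "real (Suc n) ^ Suc N * a n ^ N \<le> 2 ^ Suc N * a 0 ^ N"
      using a(1) by (intro mult_mono power_mono a_antimono) (auto intro: less_imp_le)
    then show ?thesis by (simp add: c_def)
  next
    case False
    define p where "p = n div 2"
    have p: "1 \<le> p" "Suc n \<le> 5 * p" "2 * p \<le> n" using False by (auto simp: p_def)
    have "real (Suc n) ^ Suc N * a n ^ N \<le> (5 * real p) ^ Suc N * a (2 * p) ^ N"
      using a(1) p by (intro mult_mono power_mono a_antimono) (auto intro: less_imp_le)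
    also have "\<dots> = 5 ^ Suc N * (real p ^ Suc N * a (2 * p) ^ N)"
      by (simp add: power_mult_distrib mult_ac)
    also have "\<dots> \<le> 5 ^ Suc N * T 1 ^ N" by (intro mult_left_mono a_even p) simp
    finally show ?thesis by (simp add: c_def)
  qed
  then have "(real (Suc n) ^ Suc N * a n ^ N) * \<mu> n ^ N \<le> c * \<mu> n ^ N" for n
    by (intro mult_right_mono) auto
  moreover have "(real (Suc n) ^ Suc N * a n ^ N) * \<mu> n ^ N = real (Suc n) ^ Suc N" for n
  proof -
    have "a n * \<mu> n = 1" using \<mu>_pos[of n] by (simp add: a(2) del: \<mu>_pos)
    then show ?thesis by (simp only: mult.assoc flip: power_mult_distrib) simp
  qed
  ultimately have "real (Suc n) ^ Suc N \<le> c * \<mu> n ^ N" for n by metis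
  moreover have "0 < c" using T_nonneg[of 1] by (simp add: c_def) (smt (verit) zero_le_mult_iff zero_le_power)
  ultimately show ?thesis using N(2) that by blast
qed

text \<open>After taking a-th roots this says that \<open>M\<close> dominates the Gevrey sequence
  n!^(1 + 1/a) times any geometric factor.\<close>

lemma fact_power_le_M:
  obtains a :: nat where "2 \<le> a" "\<And>D. 0 \<le> D \<Longrightarrow> \<exists>C. \<forall>n. fact n ^ Suc a * D ^ n \<le> C * M n ^ a"
proof -
  obtain N c where N: "1 \<le> (N::nat)" "0 < c" "\<And>n. real (Suc n) ^ Suc N \<le> c * \<mu> n ^ N"
    using \<mu>_growth by blast
  \<comment> \<open>Squaring the growth estimate gives the exponent \<open>a + 2\<close> on the
    factorial, one more than claimed. The spare \<open>fact n\<close> absorbs all geometric factors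
    at the cost of the constant \<open>exp (c\<^sup>2 * D)\<close>.\<close>
  define a where "a = 2 * N"
  have \<mu>: "real (Suc n) ^ (a + 2) \<le> c\<^sup>2 * \<mu> n ^ a" for n
  proof -
    have "real (Suc n) ^ (a + 2) = (real (Suc n) ^ Suc N)\<^sup>2"
      unfolding power_mult[symmetric] by (rule arg_cong) (simp add: a_def)
    also have "\<dots> \<le> (c * \<mu> n ^ N)\<^sup>2" by (intro power_mono N(3)) simp
    finally show ?thesis by (simp add: a_def power_mult_distrib mult.commute flip: power_mult)
  qed
  have fact: "fact n ^ (a + 2) \<le> (c\<^sup>2) ^ n * M n ^ a" for n
  proof (induction n)
    case (Suc n)
    have "fact (Suc n) ^ (a + 2) = real (Suc n) ^ (a + 2) * (fact n :: real) ^ (a + 2)"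
      by (simp add: power_mult_distrib del: power_Suc of_nat_Suc)
    also have "\<dots> \<le> (c\<^sup>2 * \<mu> n ^ a) * ((c\<^sup>2) ^ n * M n ^ a)" by (intro mult_mono \<mu> Suc) auto
    finally show ?case by (simp add: M_Suc power_mult_distrib mult_ac)
  qed auto
  have "\<exists>C. \<forall>n. fact n ^ Suc a * D ^ n \<le> C * M n ^ a" if D: "0 \<le> D" for D
  proof (intro exI allI)
    fix n
    have "(fact n ^ Suc a * D ^ n) * fact n = fact n ^ (a + 2) * D ^ n" by simp
    also have "\<dots> \<le> ((c\<^sup>2) ^ n * M n ^ a) * D ^ n" by (intro mult_right_mono fact) (use D in auto)
    also have "\<dots> = (c\<^sup>2 * D) ^ n * M n ^ a" by (simp add: power_mult_distrib)
    also have "\<dots> \<le> (exp (c\<^sup>2 * D) * fact n) * M n ^ a"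
    proof (intro mult_right_mono)
      show "(c\<^sup>2 * D) ^ n \<le> exp (c\<^sup>2 * D) * fact n"
        using power_le_fact_times_exp[of "c\<^sup>2 * D" n] D by (simp add: mult.commute)
    qed (simp)
    finally have "(fact n ^ Suc a * D ^ n) * fact n \<le> (exp (c\<^sup>2 * D) * M n ^ a) * fact n"
      by (simp add: mult_ac)
    then show "fact n ^ Suc a * D ^ n \<le> exp (c\<^sup>2 * D) * M n ^ a"
      by (rule mult_right_le_imp_le) simp
  qed
  moreover have "2 \<le> a" using N by (simp add: a_def)
  ultimately show ?thesis using that by blast
qed

end

lemma weight_sequence_weight:
  assumes "weight_sequence M"
  obtains c0 H where "weight M c0 H"
proof -
  from assms obtain c0 H where *: "\<forall>p. 0 < M p" "M 0 = 1"
    "\<forall>p\<ge>1. (M p)\<^sup>2 \<le> M (p - 1) * M (p + 1)" "1 \<le> c0" "1 \<le> H"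
    "\<forall>p. M p \<le> c0 * H ^ p * (MIN q\<in>{..p}. M (p - q) * M q)"
    "\<forall>p\<ge>1. (\<lambda>j. M (j - 1) / M j) summable_on {p + 1..} \<and>
           (\<Sum>\<^sub>\<infinity>j\<in>{p + 1..}. M (j - 1) / M j) \<le> c0 * real p * M p / M (p + 1)"
    unfolding weight_sequence_def by blast
  have nn: "0 \<le> M p" "M p \<noteq> 0" for p using *(1) less_imp_le by (auto simp: less_le)
  have sums: "summable (\<lambda>n. M (n + p) / M (Suc (n + p))) \<and>
      (\<Sum>n. M (n + p) / M (Suc (n + p))) \<le> c0 * real p * M p / M (Suc p)" if "1 \<le> p" for p
  proof -
    have bij: "bij_betw (\<lambda>n. n + Suc p) UNIV {p + 1..}"
      by (rule bij_betwI[where g = "\<lambda>n. n - Suc p"]) auto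
    have "((\<lambda>j. M (j - 1) / M j) has_sum (\<Sum>\<^sub>\<infinity>j\<in>{p + 1..}. M (j - 1) / M j)) {p + 1..}"
      using *(7) that by (simp add: has_sum_infsum)
    then have "((\<lambda>n. M (n + p) / M (Suc (n + p))) has_sum (\<Sum>\<^sub>\<infinity>j\<in>{p + 1..}. M (j - 1) / M j)) UNIV"
      using has_sum_reindex_bij_betw[OF bij, of "\<lambda>j. M (j - 1) / M j"] by simp
    then have "(\<lambda>n. M (n + p) / M (Suc (n + p))) sums (\<Sum>\<^sub>\<infinity>j\<in>{p + 1..}. M (j - 1) / M j)"
      by (rule has_sum_imp_sums)
    then show ?thesis using *(7) that by (auto simp: sums_iff)
  qed
  have "weight M c0 H"
  proof
    show "(M (Suc p))\<^sup>2 \<le> M p * M (Suc (Suc p))" for p using *(3)[rule_format, of "Suc p"] by simp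
    show "M (p + q) \<le> c0 * H ^ (p + q) * (M p * M q)" for p q
    proof -
      have "(MIN r\<in>{..p + q}. M (p + q - r) * M r) \<le> M (p + q - q) * M q"
        by (rule Min_le) (auto intro!: image_eqI[of _ _ q])
      then have "c0 * H ^ (p + q) * (MIN r\<in>{..p + q}. M (p + q - r) * M r) \<le> c0 * H ^ (p + q) * (M p * M q)"
        using *(4,5) by (intro mult_left_mono) auto
      then show ?thesis using *(6) order_trans by blast
    qed
    show "summable (\<lambda>n. M n / M (Suc n))"
      using sums[of 1] by (simp add: summable_Suc_iff[of "\<lambda>n. M n / M (Suc n)"])
    show "(\<Sum>n. M (n + p) / M (Suc (n + p))) \<le> c0 * real p * M p / M (Suc p)" if "1 \<le> p" for p
      using sums[OF that] by blast
  qed (use * in auto)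
  then show ?thesis using that by blast
qed

section \<open>Bump functions\<close>

text \<open>With s = t^a and a \<ge> 2, the left side is at most s^n exp (- s), hence at most n!.
  The n-th derivative of exp (- 1 / x^a) thus costs only n!^(1/a) beyond the n! of Cauchy's
  estimate.\<close>

lemma power_times_exp_le_fact:
  fixes t :: real
  assumes "0 \<le> t" "2 \<le> a"
  shows "(t ^ n * exp (- (t ^ a) / 2)) ^ a \<le> fact n"
proof -
  define s where "s = t ^ a"
  have s: "0 \<le> s" using assms by (simp add: s_def)
  have "(t ^ n * exp (- (t ^ a) / 2)) ^ a = s ^ n * exp (- (real a * s / 2))"
    by (simp add: s_def power_mult_distrib mult.commute flip: power_mult exp_of_nat_mult)
  also have "\<dots> \<le> s ^ n * exp (- s)"
  proof -
    have "2 * s \<le> real a * s" using assms s by (intro mult_right_mono) auto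
    then have "s \<le> real a * s / 2" by simp
    then show ?thesis using s by (intro mult_left_mono) auto
  qed
  also have "\<dots> \<le> fact n"
    using power_le_fact_times_exp[OF s, of n] by (simp add: exp_minus divide_simps mult.commute)
  finally show ?thesis .
qed

lemma power_times_exp_le_fact':
  fixes t :: real
  assumes "0 \<le> t" "2 \<le> a"
  shows "t ^ n * exp (- (t ^ a) / 2) \<le> fact n"
proof (rule ccontr)
  assume "\<not> ?thesis"
  then have less: "fact n < t ^ n * exp (- (t ^ a) / 2)" by simp
  then have "1 \<le> t ^ n * exp (- (t ^ a) / 2)" using fact_ge_1[of n] by (smt (verit))
  then have "t ^ n * exp (- (t ^ a) / 2) \<le> (t ^ n * exp (- (t ^ a) / 2)) ^ a"
    using assms(2) by (intro self_le_power) auto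
  then show False using power_times_exp_le_fact[OF assms, of n] less by linarith
qed

text \<open>\<open>F n\<close> is the n-th derivative of exp (- 1 / x^a) for \<open>x > 0\<close>,
  extended by 0. The bounds are Cauchy's inequality on the disc of radius \<open>c * x\<close> about
  \<open>x\<close>: its size scales with \<open>x\<close>, so 1 / z^a keeps a real part of at least
  half of 1 / x^a there.\<close>

lemma flat_function:
  fixes a :: nat
  assumes a: "2 \<le> a"
  obtains F :: "nat \<Rightarrow> real \<Rightarrow> real" and c :: real where
    "0 < c" "\<And>n x. (F n has_real_derivative F (Suc n) x) (at x)"
    "\<And>n x. x \<le> 0 \<Longrightarrow> F n x = 0" "\<And>x. 0 < x \<Longrightarrow> F 0 x = exp (- inverse (x ^ a))"
    "\<And>n x. \<bar>F n x\<bar> \<le> fact n * (1 / c) ^ n * (\<bar>inverse x\<bar> ^ n * exp (- (\<bar>inverse x\<bar> ^ a) / 2))"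
proof -
  define f where "f z = exp (- inverse (z ^ a))" for z :: complex
  define F where "F n x = (if 0 < x then Re ((deriv ^^ n) f (of_real x)) else 0)" for n and x :: real
  define S where "S = {z :: complex. 0 < Re z}"
  have S: "open S" by (simp add: S_def open_halfspace_Re_gt)
  have hol: "f holomorphic_on S" unfolding f_def S_def by (auto intro!: holomorphic_intros)
  define g where "g w = Re (inverse ((1 + w) ^ a))" for w :: complex
  have "isCont g 0" unfolding g_def
    by (intro continuous_Re continuous_at_within_inverse continuous_power continuous_add
        continuous_const continuous_ident) auto
  then obtain d where d: "0 < d" "\<And>w. dist w 0 < d \<Longrightarrow> dist (g w) (g 0) < 1/2"
    unfolding continuous_at_eps_delta by (meson half_gt_zero zero_less_one)
  \<comment> \<open>The entry \<open>d / 2\<close> comes from continuity of \<open>g\<close> at 0,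
    where \<open>g 0 = 1\<close>; the entry \<open>1 / 2\<close> keeps the disc of radius
    \<open>c * x\<close> in the right half plane.\<close>
  define c where "c = min (d / 2) (1 / 2)"
  have c: "0 < c" "c < 1" using d by (auto simp: c_def)
  have half: "1/2 \<le> Re (inverse ((1 + w) ^ a))" if "norm w \<le> c" for w
  proof -
    have "g 0 = 1" by (simp add: g_def)
    moreover have "dist w 0 < d" using that d(1) by (auto simp: c_def)
    ultimately have "\<bar>g w - 1\<bar> < 1/2" using d(2) by (metis dist_real_def)
    then show ?thesis unfolding g_def by linarith
  qed
  have bound: "norm ((deriv ^^ n) f (of_real x)) \<le> fact n * (1 / c) ^ n * (inverse x ^ n * exp (- (inverse x ^ a) / 2))"
    if x: "0 < x" for n x
  proof -
    have "norm ((deriv ^^ n) f (of_real x)) \<le> fact n * exp (- (inverse x ^ a) / 2) / (c * x) ^ n"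
    proof (rule Cauchy_inequality)
      have sub: "cball (of_real x) (c * x) \<subseteq> S"
      proof
        fix z :: complex assume "z \<in> cball (of_real x) (c * x)"
        then have "\<bar>Re (of_real x - z)\<bar> \<le> c * x"
          using abs_Re_le_cmod order_trans by (fastforce simp: dist_norm)
        moreover have "c * x < x" using c x by simp
        ultimately show "z \<in> S" by (auto simp: S_def)
      qed
      then show "continuous_on (cball (of_real x) (c * x)) f" "f holomorphic_on ball (of_real x) (c * x)"
        using hol by (meson holomorphic_on_imp_continuous_on continuous_on_subset
            holomorphic_on_subset ball_subset_cball subset_trans)+
      show "0 < c * x" using c x by simp
      fix z :: complex assume z: "norm (of_real x - z) = c * x"
      define w where "w = (z - of_real x) / of_real x"
      have "norm w = c" using z x by (simp add: w_def norm_divide norm_minus_commute)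
      then have w: "1/2 \<le> Re (inverse ((1 + w) ^ a))" using half by simp
      have "z = of_real x * (1 + w)" using x by (simp add: w_def field_simps)
      then have "inverse (z ^ a) = of_real (inverse x ^ a) * inverse ((1 + w) ^ a)"
        by (simp add: power_mult_distrib power_inverse)
      then have "Re (inverse (z ^ a)) = inverse x ^ a * Re (inverse ((1 + w) ^ a))"
        by (simp del: of_real_power of_real_inverse)
      also have "\<dots> \<ge> inverse x ^ a * (1/2)" using x w by (intro mult_left_mono) auto
      finally show "norm (f z) \<le> exp (- (inverse x ^ a) / 2)" by (simp add: f_def)
    qed
    then show ?thesis using x c by (simp add: power_mult_distrib field_simps)
  qed
  have F_bound: "\<bar>F n x\<bar> \<le> fact n * (1 / c) ^ n * (\<bar>inverse x\<bar> ^ n * exp (- (\<bar>inverse x\<bar> ^ a) / 2))" for n x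
  proof (cases "0 < x")
    case True
    then have "\<bar>F n x\<bar> \<le> norm ((deriv ^^ n) f (of_real x))" by (simp add: F_def abs_Re_le_cmod)
    then show ?thesis using bound[OF True, of n] True by simp
  qed (use c in \<open>auto simp: F_def intro!: mult_nonneg_nonneg\<close>)
  have deriv_pos: "(F n has_real_derivative F (Suc n) x) (at x)" if x: "0 < x" for n x
  proof -
    have "(deriv ^^ n) f holomorphic_on S" using hol S by (rule holomorphic_higher_deriv)
    then have "((deriv ^^ n) f has_field_derivative (deriv ^^ Suc n) f (of_real x)) (at (of_real x))"
      using S x by (simp add: holomorphic_derivI S_def)
    from bounded_linear.has_vector_derivative[OF bounded_linear_Re has_vector_derivative_real_field[OF this]]
    have "((\<lambda>x. Re ((deriv ^^ n) f (of_real x))) has_real_derivative F (Suc n) x) (at x)"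
      using x by (simp add: has_real_derivative_iff_has_vector_derivative F_def)
    then show ?thesis
      by (rule has_field_derivative_transform_within_open[where S = "{0<..}"]) (use x in \<open>auto simp: F_def\<close>)
  qed
  have deriv_neg: "(F n has_real_derivative F (Suc n) x) (at x)" if x: "x < 0" for n x
    by (rule has_field_derivative_transform_within_open[of "\<lambda>_. 0" _ _ "{..<0}"]) (use x in \<open>auto simp: F_def\<close>)
  \<comment> \<open>The exponential is spent on two extra powers of
    \<open>t = 1 / \<bar>h\<bar>\<close>: \<open>F n h\<close> is of order \<open>h\<^sup>2\<close>,
    so the difference quotient at 0 tends to 0.\<close>
  have deriv_0: "(F n has_real_derivative F (Suc n) 0) (at 0)" for n
  proof -
    define K where "K = fact n * (1 / c) ^ n * fact (n + 2)"
    have "norm (F n h / h) \<le> K * \<bar>h\<bar>" if "h \<noteq> 0" for h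
    proof -
      define t where "t = \<bar>inverse h\<bar>"
      have t: "0 < t" "\<bar>h\<bar> = inverse t" using that by (simp_all add: t_def)
      have "\<bar>F n h\<bar> \<le> fact n * (1 / c) ^ n * (t ^ n * exp (- (t ^ a) / 2))"
        using F_bound[of n h] by (simp add: t_def)
      also have "t ^ n * exp (- (t ^ a) / 2) = (t ^ (n + 2) * exp (- (t ^ a) / 2)) / t\<^sup>2"
        using t by (simp add: power_add power2_eq_square)
      also have "\<dots> \<le> fact (n + 2) / t\<^sup>2"
        using power_times_exp_le_fact'[OF less_imp_le[OF t(1)] a] by (rule divide_right_mono) simp
      finally have "\<bar>F n h\<bar> \<le> fact n * (1 / c) ^ n * (fact (n + 2) / t\<^sup>2)" using c by simp
      also have "\<dots> = K * \<bar>h\<bar> * \<bar>h\<bar>" by (simp add: K_def t(2) power2_eq_square field_simps)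
      finally show ?thesis using that by (simp add: divide_le_eq)
    qed
    then have "\<forall>\<^sub>F h in at 0. norm (F n h / h) \<le> K * \<bar>h\<bar>" by (simp add: eventually_at_filter)
    moreover have "((\<lambda>h. K * \<bar>h\<bar>) \<longlongrightarrow> 0) (at 0)" by (auto intro!: tendsto_eq_intros)
    ultimately have "((\<lambda>h. F n h / h) \<longlongrightarrow> 0) (at 0)" by (rule Lim_null_comparison)
    then show ?thesis by (simp add: DERIV_def F_def)
  qed
  show ?thesis
  proof (rule that[of c F])
    show "(F n has_real_derivative F (Suc n) x) (at x)" for n x
      using deriv_pos deriv_neg deriv_0 by (metis linorder_neqE_linordered_idom)
    show "F 0 x = exp (- inverse (x ^ a))" if "0 < x" for x
    proof -
      have "f (of_real x) = of_real (exp (- inverse (x ^ a)))" by (simp add: f_def flip: exp_of_real)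
      then show ?thesis using that by (simp add: F_def del: of_real_exp)
    qed
  qed (use c F_bound in \<open>auto simp: F_def\<close>)
qed

text \<open>The n! of Cauchy's estimate and the n!^(1/a) from the exponential combine to the Gevrey
  bound that \<open>fact_power_le_M\<close> places below \<open>M\<close>, with every
  \<open>h\<close>. Comparing a-th powers avoids fractional exponents.\<close>

lemma (in weight) flat_function_M:
  obtains F :: "nat \<Rightarrow> real \<Rightarrow> real" where
    "\<And>n x. (F n has_real_derivative F (Suc n) x) (at x)" "\<And>x. x \<le> 0 \<Longrightarrow> F 0 x = 0"
    "\<And>x. 0 < x \<Longrightarrow> 0 < F 0 x" "mono (F 0)"
    "\<And>h. 0 < h \<Longrightarrow> \<exists>C\<ge>1. \<forall>n x. \<bar>F n x\<bar> \<le> C * h ^ n * M n"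
proof -
  obtain a :: nat where a: "2 \<le> a" "\<And>D. 0 \<le> D \<Longrightarrow> \<exists>C. \<forall>n. fact n ^ Suc a * D ^ n \<le> C * M n ^ a"
    using fact_power_le_M by blast
  obtain F :: "nat \<Rightarrow> real \<Rightarrow> real" and c where F: "0 < c"
    "\<And>n x. (F n has_real_derivative F (Suc n) x) (at x)"
    "\<And>n x. x \<le> 0 \<Longrightarrow> F n x = 0" "\<And>x. 0 < x \<Longrightarrow> F 0 x = exp (- inverse (x ^ a))"
    "\<And>n x. \<bar>F n x\<bar> \<le> fact n * (1 / c) ^ n * (\<bar>inverse x\<bar> ^ n * exp (- (\<bar>inverse x\<bar> ^ a) / 2))"
    using flat_function[OF a(1)] by metis
  show ?thesis
  proof (rule that[of F])
    show "(F n has_real_derivative F (Suc n) x) (at x)" for n x by (rule F(2))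
    show "mono (F 0)"
    proof
      fix x y :: real assume "x \<le> y"
      show "F 0 x \<le> F 0 y"
      proof (cases "0 < x")
        case True
        then show ?thesis using \<open>x \<le> y\<close> by (simp add: F(4) power_mono le_imp_inverse_le)
      next
        case False
        then show ?thesis using F(3)[of x 0] F(3)[of y 0] F(4)[of y] by (cases "0 < y") auto
      qed
    qed
    fix h :: real assume h: "0 < h"
    obtain C where C: "\<And>n. fact n ^ Suc a * ((1 / (c * h)) ^ a) ^ n \<le> C * M n ^ a"
      using a(2)[of "(1 / (c * h)) ^ a"] F(1) h by auto
    have "\<bar>F n x\<bar> \<le> max 1 C * h ^ n * M n" for n x
    proof -
      define y where "y = \<bar>inverse x\<bar> ^ n * exp (- (\<bar>inverse x\<bar> ^ a) / 2)"
      have "\<bar>F n x\<bar> ^ a \<le> (fact n * (1 / c) ^ n * y) ^ a"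
        using F(5)[of n x] by (intro power_mono) (auto simp: y_def)
      also have "\<dots> = fact n ^ a * ((1 / c) ^ n) ^ a * y ^ a" by (simp add: power_mult_distrib)
      also have "\<dots> \<le> fact n ^ a * ((1 / c) ^ n) ^ a * fact n"
        using power_times_exp_le_fact[OF _ a(1), of "\<bar>inverse x\<bar>" n] F(1)
        by (intro mult_left_mono) (auto simp: y_def)
      also have "\<dots> = (h ^ n) ^ a * (fact n ^ Suc a * ((1 / (c * h)) ^ a) ^ n)"
      proof -
        have "(1 / c) ^ n = h ^ n * (1 / (c * h)) ^ n" using h by (simp flip: power_mult_distrib)
        then have "((1 / c) ^ n) ^ a = (h ^ n) ^ a * ((1 / (c * h)) ^ a) ^ n"
          by (simp add: power_mult_distrib mult.commute flip: power_mult)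
        then show ?thesis by (simp add: mult_ac)
      qed
      also have "\<dots> \<le> (h ^ n) ^ a * (C * M n ^ a)" using h by (intro mult_left_mono C) auto
      also have "\<dots> \<le> (h ^ n) ^ a * (max 1 C ^ a * M n ^ a)"
      proof -
        have "C \<le> max 1 C" by simp
        also have "\<dots> \<le> max 1 C ^ a" using a(1) by (intro self_le_power) auto
        finally show ?thesis using h by (intro mult_left_mono mult_right_mono) auto
      qed
      also have "\<dots> = (max 1 C * h ^ n * M n) ^ a" by (simp add: power_mult_distrib mult_ac)
      finally show ?thesis using a(1) h by (subst (asm) power_mono_iff) auto
    qed
    then show "\<exists>C\<ge>1. \<forall>n x. \<bar>F n x\<bar> \<le> C * h ^ n * M n" by (intro exI[of _ "max 1 C"]) auto
  qed (use F(3)[of _ 0] F(4) in auto)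
qed

lemma partials_coordinate:
  fixes F :: "nat \<Rightarrow> real \<Rightarrow> real" and i :: "'d::finite" and c s :: real
  assumes F: "\<And>n x. (F n has_real_derivative F (Suc n) x) (at x)"
  defines "U \<equiv> \<lambda>n (x :: real^'d). complex_of_real (s ^ n * F n (c + s * x $ i))"
  shows "partials is (U n) = (if set is \<subseteq> {i} then U (n + length is) else (\<lambda>x. 0))" (is ?A)
    and "smooth_on S (U n)" (is ?B)
proof -
  have U: "(U n has_derivative (\<lambda>h. of_real (s ^ n * (F (Suc n) (c + s * x $ i) * (s * h $ i))))) (at x)" for n x
    unfolding U_def
    by (intro has_derivative_of_real has_derivative_mult_right
        has_derivative_compose[where g = "F n", OF _ F[THEN has_field_derivative_imp_has_derivative]])
      (auto intro!: derivative_eq_intros bounded_linear_imp_has_derivative bounded_linear_vec_nth)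
  have P0: "partial j (U n) x = of_real (s ^ n * (F (Suc n) (c + s * x $ i) * (s * axis j 1 $ i)))" for j n x
    by (rule partial_eqI[OF U])
  have P: "partial j (U n) = (if j = i then U (Suc n) else (\<lambda>x. 0))" for j n
  proof (cases "j = i")
    case True
    show ?thesis by (rule ext) (simp only: P0 True if_True, simp add: U_def axis_def)
  qed (auto simp: P0 fun_eq_iff axis_def)
  show A: "partials is (U n) = (if set is \<subseteq> {i} then U (n + length is) else (\<lambda>x. 0))" for "is" n
  proof (induction "is")
    case (Cons j "is")
    have "partial j (\<lambda>x. 0) = (\<lambda>x. 0)" using partials_zero[of "[j]"] by (simp add: partials_Cons)
    then show ?case using Cons by (simp add: partials_Cons P)
  qed simp
  have "U n differentiable at x" for n x using U unfolding differentiable_def by blast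
  then show ?B by (auto simp: smooth_on_def A)
qed

lemma partials_one: "partials is (\<lambda>x. 1) = (\<lambda>x. if is = [] then 1 else 0)"
proof (induction "is" rule: rev_induct)
  case (snoc i "is")
  have "partial i (\<lambda>x. 1 :: complex) = (\<lambda>x. 0)" by (simp add: partial_def fun_eq_iff)
  then show ?case by (simp add: partials_append partials_Cons partials_zero)
qed simp

text \<open>Each further factor adds its geometric constant \<open>b\<close> in
  \<open>norm_partials_mult_le\<close>, whence \<open>card A * b\<close>; the coupled bound required
  there comes from \<open>M_mult_le\<close>.\<close>

lemma (in weight) prod_bounds:
  fixes v :: "'i \<Rightarrow> real^'d::finite \<Rightarrow> complex"
  assumes "open S" "finite A" "x \<in> S" "0 \<le> b" "1 \<le> C"
    and "\<And>i. i \<in> A \<Longrightarrow> smooth_on S (v i)"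
    and "\<And>i is. i \<in> A \<Longrightarrow> norm (partials is (v i) x) \<le> C * b ^ length is * M (length is)"
  shows "smooth_on S (\<lambda>x. \<Prod>i\<in>A. v i x) \<and>
    norm (partials is (\<lambda>x. \<Prod>i\<in>A. v i x) x) \<le> C ^ card A * (real (card A) * b) ^ length is * M (length is)"
  using assms(2,6,7)
proof (induction A arbitrary: "is")
  case empty
  show ?case by (auto simp: smooth_on_def partials_one)
next
  case (insert j A)
  let ?w = "\<lambda>x. \<Prod>i\<in>A. v i x"
  have IH: "smooth_on S ?w"
    "\<And>is. norm (partials is ?w x) \<le> C ^ card A * (real (card A) * b) ^ length is * M (length is)"
    using insert by simp_all
  have eq: "(\<lambda>x. \<Prod>i\<in>insert j A. v i x) = (\<lambda>x. v j x * ?w x)" using insert by simp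
  have "norm (partials is (\<lambda>x. v j x * ?w x) x)
      \<le> (C * C ^ card A) * (b + real (card A) * b) ^ length is * M (length is)" for "is"
  proof (rule norm_partials_mult_le[OF assms(1) _ IH(1) assms(3)])
    show "smooth_on S (v j)" using insert by simp
    fix "is" js :: "'d list"
    have "norm (partials is (v j) x) * norm (partials js ?w x)
      \<le> (C * b ^ length is * M (length is)) * (C ^ card A * (real (card A) * b) ^ length js * M (length js))"
      using insert.prems IH(2) assms(4,5) by (intro mult_mono) auto
    also have "\<dots> = C * C ^ card A * b ^ length is * (real (card A) * b) ^ length js * (M (length is) * M (length js))"
      by (simp add: mult_ac)
    also have "\<dots> \<le> C * C ^ card A * b ^ length is * (real (card A) * b) ^ length js * M (length is + length js)"
      using assms(4,5) by (intro mult_left_mono M_mult_le) auto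
    finally show "norm (partials is (v j) x) * norm (partials js ?w x)
      \<le> C * C ^ card A * b ^ length is * (real (card A) * b) ^ length js * M (length is + length js)" .
  qed
  moreover have "smooth_on S (\<lambda>x. v j x * ?w x)"
    by (intro smooth_on_mult assms(1) IH) (use insert in auto)
  ultimately show ?case using insert unfolding eq by (simp add: algebra_simps)
qed

text \<open>The bump is the product, over all coordinates, of the flat function at
  \<open>\<rho> + (x $ i - y $ i)\<close> and at \<open>\<rho> - (x $ i - y $ i)\<close>. The
  constants do not depend on the centre \<open>y\<close>, because only translates occur.\<close>

lemma (in weight) bump_functions:
  assumes "0 < \<rho>"
  obtains \<theta> :: "real^'d::finite \<Rightarrow> real^'d \<Rightarrow> real" and \<delta> :: real where
    "\<And>y S. smooth_on S (\<lambda>x. complex_of_real (\<theta> y x))" "\<And>y x. 0 \<le> \<theta> y x"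
    "\<And>y x i. \<rho> \<le> \<bar>x $ i - y $ i\<bar> \<Longrightarrow> \<theta> y x = 0"
    "0 < \<delta>" "\<And>y x. (\<And>i. \<bar>x $ i - y $ i\<bar> \<le> \<rho> / 2) \<Longrightarrow> \<delta> \<le> \<theta> y x"
    "\<And>h. 0 < h \<Longrightarrow> \<exists>C\<ge>1. \<forall>y x is.
       norm (partials is (\<lambda>x. complex_of_real (\<theta> y x)) x) \<le> C * h ^ length is * M (length is)"
proof -
  obtain F :: "nat \<Rightarrow> real \<Rightarrow> real" where F:
    "\<And>n x. (F n has_real_derivative F (Suc n) x) (at x)" "\<And>x. x \<le> 0 \<Longrightarrow> F 0 x = 0"
    "\<And>x. 0 < x \<Longrightarrow> 0 < F 0 x" "mono (F 0)"
    "\<And>h. 0 < h \<Longrightarrow> \<exists>C\<ge>1. \<forall>n x. \<bar>F n x\<bar> \<le> C * h ^ n * M n"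
    using flat_function_M by metis
  define s where "s b = (if b then 1 else - 1 :: real)" for b
  define \<theta> where "\<theta> y x = (\<Prod>(i, b)\<in>UNIV. F 0 (\<rho> + s b * (x $ i - y $ i)))" for y x :: "real^'d"
  \<comment> \<open>The same factors in the form \<open>c + s * x $ i\<close>, with the power
    \<open>s b ^ 0\<close>, are the case \<open>n = 0\<close> of
    \<open>partials_coordinate\<close>.\<close>
  define v where "v y = (\<lambda>(i, b) x. complex_of_real (s b ^ 0 * F 0 ((\<rho> - s b * y $ i) + s b * x $ i)))" for y :: "real^'d"
  have \<theta>_v: "(\<lambda>x. complex_of_real (\<theta> y x)) = (\<lambda>x. \<Prod>k\<in>UNIV. v y k x)" for y
    unfolding \<theta>_def v_def of_real_prod by (intro ext prod.cong) (auto simp: algebra_simps)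
  have F0: "0 \<le> F 0 x" for x using F(2,3)[of x] by (cases "0 < x") auto
  have smooth_v: "smooth_on S (v y k)" for y k S
    unfolding v_def by (cases k) (simp only: prod.case, rule partials_coordinate(2)[where F = F, OF F(1)])
  have smooth: "smooth_on S (\<lambda>x. complex_of_real (\<theta> y x))" for y S
  proof -
    have "smooth_on UNIV (\<lambda>x. \<Prod>k\<in>A. v y k x)" if "finite A" for A
      using that by induction (auto simp: smooth_on_def[of _ "\<lambda>x. 1"] partials_one intro!: smooth_on_mult smooth_v)
    from this[of UNIV] show ?thesis unfolding \<theta>_v by (auto simp: smooth_on_def)
  qed
  have bound: "\<exists>C\<ge>1. \<forall>y x is. norm (partials is (\<lambda>x. complex_of_real (\<theta> y x)) x) \<le> C * h ^ length is * M (length is)"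
    if h: "0 < h" for h
  proof -
    let ?n = "card (UNIV :: ('d \<times> bool) set)"
    have n: "0 < ?n" by (simp add: card_gt_0_iff)
    \<comment> \<open>Dividing \<open>h\<close> by the number of factors compensates the factor
      \<open>card A\<close> in \<open>prod_bounds\<close>.\<close>
    obtain C where C: "1 \<le> C" "\<And>n x. \<bar>F n x\<bar> \<le> C * (h / ?n) ^ n * M n"
      using F(5)[of "h / ?n"] h n by auto
    have "norm (partials is (v y k) x) \<le> C * (h / ?n) ^ length is * M (length is)" for y k x "is"
    proof -
      obtain i b where k: "k = (i, b)" by (cases k)
      have *: "\<bar>s b ^ length is * F (length is) (\<rho> - s b * y $ i + s b * x $ i)\<bar> \<le> C * (h / ?n) ^ length is * M (length is)"
        using C(2) by (simp add: abs_mult power_abs s_def)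
      show ?thesis unfolding k v_def prod.case
        using * C(1) h n by (subst partials_coordinate(1)[where F = F, OF F(1)])
          (auto simp: norm_mult simp del: of_real_mult of_real_power intro!: mult_nonneg_nonneg)
    qed
    then have "norm (partials is (\<lambda>x. \<Prod>k\<in>UNIV. v y k x) x) \<le> C ^ ?n * (real ?n * (h / ?n)) ^ length is * M (length is)" for y x "is"
      using prod_bounds[of UNIV UNIV x "h / ?n" C "v y" "is"] C(1) h n smooth_v by auto
    then show ?thesis using n C(1) unfolding \<theta>_v by (intro exI[of _ "C ^ ?n"]) (auto simp: one_le_power)
  qed
  show ?thesis
  proof (rule that[of \<theta> "F 0 (\<rho> / 2) ^ card (UNIV :: ('d \<times> bool) set)"])
    show "0 \<le> \<theta> y x" for y x unfolding \<theta>_def by (intro prod_nonneg) (auto simp: F0)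
    show "\<theta> y x = 0" if "\<rho> \<le> \<bar>x $ i - y $ i\<bar>" for y x i
    proof -
      define b where "b = (x $ i - y $ i < 0)"
      have "F 0 (\<rho> + s b * (x $ i - y $ i)) = 0" by (rule F(2)) (use that in \<open>auto simp: s_def b_def\<close>)
      then show ?thesis unfolding \<theta>_def by (intro prod_zero bexI[of _ "(i, b)"]) auto
    qed
    show "0 < F 0 (\<rho> / 2) ^ card (UNIV :: ('d \<times> bool) set)" using F(3) assms by simp
    show "F 0 (\<rho> / 2) ^ card (UNIV :: ('d \<times> bool) set) \<le> \<theta> y x" if "\<And>i. \<bar>x $ i - y $ i\<bar> \<le> \<rho> / 2" for y x
    proof -
      have "(\<Prod>k\<in>(UNIV :: ('d \<times> bool) set). F 0 (\<rho> / 2)) \<le> \<theta> y x"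
        unfolding \<theta>_def
      proof (rule prod_mono)
        fix k :: "'d \<times> bool"
        obtain i b where k: "k = (i, b)" by (cases k)
        have "\<rho> / 2 \<le> \<rho> + s b * (x $ i - y $ i)" 
        proof -
          have "\<bar>s b * (x $ i - y $ i)\<bar> \<le> \<rho> / 2" using that[of i] by (simp add: s_def abs_mult)
          then show ?thesis by linarith
        qed
        then show "0 \<le> F 0 (\<rho> / 2) \<and> F 0 (\<rho> / 2) \<le> (case k of (i, b) \<Rightarrow> F 0 (\<rho> + s b * (x $ i - y $ i)))"
          using F0 F(4) by (auto simp: k mono_def)
      qed
      then show ?thesis by simp
    qed
  qed (fact smooth bound)+
qed

section \<open>Associated functions\<close>

lemma exp_ln_plus: "0 \<le> x \<Longrightarrow> x \<le> exp (ln_plus x)"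
  by (cases "x = 0") (auto simp: ln_plus_def max_def not_le less_imp_le dest: less_le_trans)

lemma ln_plus_le:
  assumes "0 \<le> x" "x \<le> B" "1 \<le> B"
  shows "ln_plus x \<le> ln B"
  using assms by (cases "x = 0") (auto simp: ln_plus_def)

text \<open>The last clause bounds the set under the supremum in \<open>assoc_fun\<close>; for an
  unbounded set the real \<open>SUP\<close> would carry no information.\<close>

definition good_weight :: "(nat \<Rightarrow> real) \<Rightarrow> bool" where
  "good_weight w \<longleftrightarrow> (\<forall>p. 0 < w p) \<and> w 0 = 1 \<and> (\<forall>\<rho>\<ge>0. \<exists>B. \<forall>p. \<rho> ^ p \<le> B * w p)"

text \<open>Together with \<open>exp_assoc_fun_ge\<close>: the exponential of the associated
  function is the least \<open>B\<close> with \<open>\<rho> ^ p \<le> B * w p\<close> for all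
  \<open>p\<close>. This characterization keeps logarithms and suprema out of what follows.\<close>

lemma exp_assoc_fun_le:
  assumes "good_weight w" "0 \<le> \<rho>" "\<And>p. \<rho> ^ p \<le> B * w p"
  shows "exp (assoc_fun w \<rho>) \<le> B"
proof -
  have B: "1 \<le> B" using assms(3)[of 0] assms(1) by (simp add: good_weight_def)
  have "\<rho> ^ p / w p \<le> B" for p
    using assms(1) assms(3)[of p] by (simp add: good_weight_def divide_le_eq)
  then have "assoc_fun w \<rho> \<le> ln B"
    unfolding assoc_fun_def using assms(1,2) B
    by (intro cSUP_least ln_plus_le) (auto simp: good_weight_def less_imp_le)
  then show ?thesis using B by (metis exp_le_cancel_iff exp_ln less_le_trans zero_less_one)
qed

lemma exp_assoc_fun_ge:
  assumes "good_weight w" "0 \<le> \<rho>"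
  shows "\<rho> ^ p \<le> exp (assoc_fun w \<rho>) * w p"
proof -
  obtain B where B: "\<And>p. \<rho> ^ p \<le> B * w p" using assms unfolding good_weight_def by blast
  have B1: "1 \<le> B" using B[of 0] assms(1) by (simp add: good_weight_def)
  have w: "0 < w p" for p using assms(1) by (simp add: good_weight_def)
  have "\<rho> ^ p / w p \<le> B" for p using w B[of p] by (simp add: divide_le_eq)
  then have "ln_plus (\<rho> ^ p / w p) \<le> ln B" for p
    using assms(2) B1 w by (intro ln_plus_le) (auto simp: less_imp_le)
  then have "ln_plus (\<rho> ^ p / w p) \<le> assoc_fun w \<rho>"
    unfolding assoc_fun_def by (intro cSUP_upper bdd_aboveI[of _ "ln B"]) auto
  then have "\<rho> ^ p / w p \<le> exp (assoc_fun w \<rho>)"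
    using exp_ln_plus[of "\<rho> ^ p / w p"] w[of p] assms(2)
    by (smt (verit) divide_nonneg_pos exp_le_cancel_iff zero_le_power)
  then show ?thesis using w[of p] by (simp add: divide_le_eq)
qed

lemma exp_assoc_fun_ge_1: "good_weight w \<Longrightarrow> 0 \<le> \<rho> \<Longrightarrow> 1 \<le> exp (assoc_fun w \<rho>)"
  using exp_assoc_fun_ge[of w \<rho> 0] by (simp add: good_weight_def)

lemma exp_assoc_fun_mono:
  assumes "good_weight w" "0 \<le> \<rho>" "\<rho> \<le> \<rho>'"
  shows "exp (assoc_fun w \<rho>) \<le> exp (assoc_fun w \<rho>')"
proof (rule exp_assoc_fun_le[OF assms(1,2)])
  fix p
  have "\<rho> ^ p \<le> \<rho>' ^ p" using assms by (intro power_mono)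
  also have "\<dots> \<le> exp (assoc_fun w \<rho>') * w p" using assms by (intro exp_assoc_fun_ge) auto
  finally show "\<rho> ^ p \<le> exp (assoc_fun w \<rho>') * w p" .
qed

text \<open>The hypothesis on the weights, which comes from (M.2) in both cases, bounds
  \<open>\<rho>1 ^ p * \<rho>2 ^ q\<close> for independent \<open>p\<close> and \<open>q\<close>.
  Optimizing over \<open>p\<close> for fixed \<open>q\<close>, then over \<open>q\<close>, gives the
  product of the exponentials.\<close>

lemma exp_assoc_fun_mult_le:
  assumes "good_weight w1" "good_weight w2" "good_weight w" "0 < \<rho>1" "0 < \<rho>2" "0 < \<rho>" "0 \<le> B"
    and "\<And>p q. \<rho>1 ^ p * \<rho>2 ^ q * w (p + q) \<le> B * \<rho> ^ (p + q) * (w1 p * w2 q)"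
  shows "exp (assoc_fun w1 \<rho>1) * exp (assoc_fun w2 \<rho>2) \<le> B * exp (assoc_fun w \<rho>)"
proof -
  let ?E = "exp (assoc_fun w \<rho>)"
  have pos: "0 < w p" "0 < w1 p" "0 < w2 p" for p using assms(1-3) by (auto simp: good_weight_def)
  have pq: "\<rho>1 ^ p * \<rho>2 ^ q \<le> B * ?E * (w1 p * w2 q)" for p q
  proof -
    have "\<rho>1 ^ p * \<rho>2 ^ q * w (p + q) \<le> B * \<rho> ^ (p + q) * (w1 p * w2 q)" by (rule assms)
    also have "\<dots> \<le> B * (?E * w (p + q)) * (w1 p * w2 q)"
      using assms pos by (intro mult_right_mono mult_left_mono exp_assoc_fun_ge) (auto intro: less_imp_le)
    finally have "(\<rho>1 ^ p * \<rho>2 ^ q) * w (p + q) \<le> (B * ?E * (w1 p * w2 q)) * w (p + q)"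
      by (simp add: mult_ac)
    then show ?thesis using pos(1) by (rule mult_right_le_imp_le)
  qed
  have "exp (assoc_fun w1 \<rho>1) \<le> B * ?E * w2 q / \<rho>2 ^ q" for q
    by (rule exp_assoc_fun_le) (use assms pq in \<open>auto simp: le_divide_eq mult_ac\<close>)
  then have "\<rho>2 ^ q \<le> B * ?E / exp (assoc_fun w1 \<rho>1) * w2 q" for q
    using assms(5) by (simp add: le_divide_eq mult_ac)
  then have "exp (assoc_fun w2 \<rho>2) \<le> B * ?E / exp (assoc_fun w1 \<rho>1)"
    using assms by (intro exp_assoc_fun_le) auto
  then show ?thesis by (simp add: le_divide_eq mult.commute)
qed

subsection \<open>Sequences in \<open>Rseq\<close>\<close>

lemma bounded_if_eventually_decreasing:
  fixes s :: "nat \<Rightarrow> real"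
  assumes "\<And>p. N \<le> p \<Longrightarrow> s (Suc p) \<le> s p"
  shows "\<exists>C\<ge>1. \<forall>p. s p \<le> C"
proof -
  define C where "C = max 1 (Max (s ` {..N}))"
  have "s p \<le> C" if "p \<le> N" for p
    unfolding C_def using that by (simp add: max.coboundedI2)
  moreover have "s p \<le> C" if "N \<le> p" for p
    using that by (induction rule: dec_induct) (use assms calculation[of N] in \<open>auto intro: order_trans\<close>)
  ultimately show ?thesis by (intro exI[of _ C]) (metis C_def max.cobounded1 nle_le)
qed

lemma Rseq_pos: "r \<in> Rseq \<Longrightarrow> 1 \<le> i \<Longrightarrow> 0 < r i"
  by (simp add: Rseq_def)

lemma Rseq_prod_pos: "r \<in> Rseq \<Longrightarrow> 0 < (\<Prod>i=1..p. r i)"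
  by (intro prod_pos) (auto simp: Rseq_pos)

lemma Rseq_eventually_ge: "r \<in> Rseq \<Longrightarrow> \<exists>N. \<forall>i\<ge>N. c \<le> r i"
  by (auto simp: Rseq_def filterlim_at_top eventually_sequentially)

text \<open>The quotient of the two sides stops increasing once \<open>r i \<ge> h\<close>. This is
  the easy half of Komatsu's lemma: a geometric bound implies a bound by every sequence in
  \<open>Rseq\<close>.\<close>

lemma Rseq_power_le_prod:
  assumes "r \<in> Rseq" "0 \<le> h"
  shows "\<exists>C\<ge>1. \<forall>p. h ^ p \<le> C * (\<Prod>i=1..p. r i)"
proof -
  obtain N where N: "\<And>i. N \<le> i \<Longrightarrow> h \<le> r i" using Rseq_eventually_ge[OF assms(1)] by blast
  let ?P = "\<lambda>p. \<Prod>i=1..p. r i"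
  have P: "0 < ?P p" for p using Rseq_prod_pos[OF assms(1)] .
  have "h ^ Suc p / ?P (Suc p) \<le> h ^ p / ?P p" if "N \<le> p" for p
  proof -
    have "h ^ Suc p / ?P (Suc p) = (h ^ p / ?P p) * (h / r (Suc p))" by simp
    also have "\<dots> \<le> (h ^ p / ?P p) * 1"
      using N[of "Suc p"] that Rseq_pos[OF assms(1), of "Suc p"] P[of p] assms(2)
      by (intro mult_left_mono) (auto simp: divide_le_eq_1 intro: divide_nonneg_pos)
    finally show ?thesis by simp
  qed
  then obtain C where "1 \<le> C" "\<And>p. h ^ p / ?P p \<le> C"
    using bounded_if_eventually_decreasing[of N "\<lambda>p. h ^ p / ?P p"] by blast
  then show ?thesis using P by (intro exI[of _ C]) (auto simp: divide_le_eq)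
qed

lemma Rseq_prod_max_le:
  assumes "r \<in> Rseq"
  shows "\<exists>C\<ge>1. \<forall>p. (\<Prod>i=1..p. max 1 (r i)) \<le> C * (\<Prod>i=1..p. r i)"
proof -
  obtain N where N: "\<And>i. N \<le> i \<Longrightarrow> 1 \<le> r i" using Rseq_eventually_ge[OF assms] by blast
  let ?P = "\<lambda>p. \<Prod>i=1..p. r i" and ?Q = "\<lambda>p. \<Prod>i=1..p. max 1 (r i)"
  have P: "0 < ?P p" for p using Rseq_prod_pos[OF assms] .
  have "?Q (Suc p) / ?P (Suc p) \<le> ?Q p / ?P p" if "N \<le> p" for p
    using N[of "Suc p"] that by (simp add: max_absorb2)
  then obtain C where "1 \<le> C" "\<And>p. ?Q p / ?P p \<le> C"
    using bounded_if_eventually_decreasing[of N "\<lambda>p. ?Q p / ?P p"] by blast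
  then show ?thesis using P by (intro exI[of _ C]) (auto simp: divide_le_eq)
qed

text \<open>Komatsu's lemma in the form needed for regular nets: a bound by every sequence in \<open>Rseq\<close>
  is a geometric bound. A counterexample \<open>(\<epsilon>\<^sub>n, x\<^sub>n)\<close> for every \<open>n\<close> violates the bound for
  \<open>h i = 1 + min {n. len x\<^sub>n \<ge> i or n \<ge> i}\<close>.\<close>

lemma Rseq_diagonal:
  fixes F :: "real \<Rightarrow> 'x \<Rightarrow> real" and len :: "'x \<Rightarrow> nat"
  assumes bound: "\<And>h. h \<in> Rseq \<Longrightarrow> \<exists>C. \<exists>e>0. \<forall>\<epsilon>. 0 < \<epsilon> \<longrightarrow> \<epsilon> < e \<longrightarrow>
      (\<forall>x\<in>X. F \<epsilon> x \<le> C * (\<Prod>i=1..len x. h i))"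
  shows "\<exists>N::nat. \<forall>\<epsilon>. 0 < \<epsilon> \<longrightarrow> \<epsilon> < 1 / real (N + 2) \<longrightarrow>
      (\<forall>x\<in>X. F \<epsilon> x \<le> real N * real (N + 1) ^ len x)"
proof (rule ccontr)
  assume "\<not> ?thesis"
  then have "\<forall>N. \<exists>\<epsilon> x. 0 < \<epsilon> \<and> \<epsilon> < 1 / real (N + 2) \<and> x \<in> X \<and> real N * real (N + 1) ^ len x < F \<epsilon> x"
    unfolding not_ex not_all not_imp not_le by (metis (no_types, lifting) not_le)
  then obtain \<epsilon> x where ex: "\<And>N. 0 < \<epsilon> N" "\<And>N. \<epsilon> N < 1 / real (N + 2)" "\<And>N. x N \<in> X"
    "\<And>N. real N * real (N + 1) ^ len (x N) < F (\<epsilon> N) (x N)" by metis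
  \<comment> \<open>The maximum with \<open>N\<close> ensures that every \<open>i\<close> is reached
    by some \<open>q N\<close>, so \<open>l i\<close> exists even if the lengths stay
    bounded.\<close>
  define q where "q N = max (len (x N)) N" for N
  define l where "l i = (LEAST N. i \<le> q N)" for i
  define h where "h i = real (Suc (l i))" for i
  have l: "i \<le> q (l i)" for i unfolding l_def by (rule LeastI[of _ i]) (simp add: q_def)
  have l_le: "l i \<le> N" if "i \<le> q N" for i N unfolding l_def using that by (rule Least_le)
  have "h \<in> Rseq"
    unfolding Rseq_def
  proof (intro CollectI conjI)
    show "mono_on {1..} h"
    proof (intro mono_onI)
      fix i j :: nat assume "i \<le> j"
      then show "h i \<le> h j" using l_le[OF order_trans[OF _ l]] by (simp add: h_def)
    qed
    show "filterlim h at_top sequentially"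
      unfolding filterlim_at_top eventually_sequentially
    proof
      fix Z :: real
      define K where "K = nat \<lceil>Z\<rceil>"
      \<comment> \<open>An index beyond all of \<open>q 0\<close>, ..., \<open>q (K - 1)\<close> is
        reached only by some \<open>N \<ge> K\<close>; the sum is a convenient common bound.\<close>
      have "Z \<le> h i" if i: "Suc (\<Sum>N<K. q N) \<le> i" for i
      proof -
        have "K \<le> l i"
        proof (rule ccontr)
          assume "\<not> K \<le> l i"
          then have "q (l i) \<le> (\<Sum>N<K. q N)" by (intro member_le_sum) auto
          then show False using l[of i] i by simp
        qed
        then show ?thesis unfolding h_def K_def by linarith
      qed
      then show "\<exists>N. \<forall>n\<ge>N. Z \<le> h n" by blast
    qed
  qed (simp add: h_def)
  from bound[OF this] obtain C e where Ce: "0 < e"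
    "\<And>\<epsilon> x. 0 < \<epsilon> \<Longrightarrow> \<epsilon> < e \<Longrightarrow> x \<in> X \<Longrightarrow> F \<epsilon> x \<le> C * (\<Prod>i=1..len x. h i)" by blast
  obtain N :: nat where N: "max (max C 0) (1 / e) < real N" using reals_Archimedean2 by blast
  have "1 / real (N + 2) < e" 
  proof -
    have "1 / e < real (N + 2)" using N by simp
    then show ?thesis using Ce(1) by (simp add: divide_less_eq mult.commute)
  qed
  then have "F (\<epsilon> N) (x N) \<le> C * (\<Prod>i=1..len (x N). h i)"
    using Ce(2) ex(1-3)[of N] by (meson less_trans)
  also have "\<dots> \<le> real N * (\<Prod>i=1..len (x N). h i)"
    using N by (intro mult_right_mono prod_nonneg) (auto simp: h_def)
  also have "\<dots> \<le> real N * (\<Prod>i=1..len (x N). real (N + 1))"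
  proof (intro mult_left_mono prod_mono conjI)
    fix i assume "i \<in> {1..len (x N)}"
    then show "h i \<le> real (N + 1)" using l_le[of i N] by (auto simp: h_def q_def le_max_iff_disj)
  qed (auto simp: h_def)
  also have "\<dots> = real N * real (N + 1) ^ len (x N)" by simp
  finally show False using ex(4)[of N] by simp
qed

subsection \<open>The two scales of growth rates\<close>

text \<open>The properties of the rates e^(M(k/\<epsilon>)) and e^(N_k(1/\<epsilon>)) on which the
  common argument rests. Monotonicity keeps a rate bounded away from \<epsilon> = 0; closure under
  products up to constants is the effect of (M.2).\<close>

definition gauge_family :: "(real \<Rightarrow> real) set \<Rightarrow> bool" where
  "gauge_family G \<longleftrightarrow>
     (\<forall>e\<in>G. \<forall>\<epsilon>>0. 1 \<le> e \<epsilon>) \<and> (\<forall>e\<in>G. \<forall>\<epsilon>>0. \<forall>\<epsilon>'\<ge>\<epsilon>. e \<epsilon>' \<le> e \<epsilon>) \<and>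
     (\<forall>e1\<in>G. \<forall>e2\<in>G. \<exists>e\<in>G. \<exists>B\<ge>1. \<forall>\<epsilon>>0. e1 \<epsilon> * e2 \<epsilon> \<le> B * e \<epsilon>)"

lemma gauge_family_mult:
  "\<lbrakk>gauge_family G; e1 \<in> G; e2 \<in> G\<rbrakk> \<Longrightarrow> \<exists>e\<in>G. \<exists>B\<ge>1. \<forall>\<epsilon>>0. e1 \<epsilon> * e2 \<epsilon> \<le> B * e \<epsilon>"
  and gauge_family_ge_1: "\<lbrakk>gauge_family G; e1 \<in> G; 0 < \<epsilon>\<rbrakk> \<Longrightarrow> 1 \<le> e1 \<epsilon>"
  and gauge_family_antimono: "\<lbrakk>gauge_family G; e1 \<in> G; 0 < \<epsilon>; \<epsilon> \<le> \<epsilon>'\<rbrakk> \<Longrightarrow> e1 \<epsilon>' \<le> e1 \<epsilon>"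
  by (simp_all add: gauge_family_def)

lemma gauge_family_power:
  assumes "gauge_family G" "e0 \<in> G"
  shows "\<exists>e\<in>G. \<exists>B\<ge>1. \<forall>\<epsilon>>0. e0 \<epsilon> ^ Suc n \<le> B * e \<epsilon>"
proof (induction n)
  case 0
  show ?case by (rule bexI[OF _ assms(2)], rule exI[of _ 1]) auto
next
  case (Suc n)
  then obtain e B where e: "e \<in> G" "1 \<le> B" "\<And>\<epsilon>. 0 < \<epsilon> \<Longrightarrow> e0 \<epsilon> ^ Suc n \<le> B * e \<epsilon>" by blast
  obtain e' B' where e': "e' \<in> G" "1 \<le> B'" "\<And>\<epsilon>. 0 < \<epsilon> \<Longrightarrow> e0 \<epsilon> * e \<epsilon> \<le> B' * e' \<epsilon>"
    using gauge_family_mult[OF assms e(1)] by blast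
  have "e0 \<epsilon> ^ Suc (Suc n) \<le> (B * B') * e' \<epsilon>" if "0 < \<epsilon>" for \<epsilon>
  proof -
    have "1 \<le> e0 \<epsilon>" using gauge_family_ge_1[OF assms that] .
    then have "e0 \<epsilon> * e0 \<epsilon> ^ Suc n \<le> e0 \<epsilon> * (B * e \<epsilon>)"
      using e(3)[OF that] by (intro mult_left_mono) auto
    also have "\<dots> = B * (e0 \<epsilon> * e \<epsilon>)" by simp
    also have "\<dots> \<le> B * (B' * e' \<epsilon>)" using e(2) e'(3)[OF that] by (intro mult_left_mono) auto
    finally show ?thesis by (simp add: mult_ac)
  qed
  moreover have "1 \<le> B * B'" using e(2) e'(2) by (rule mult_ge1_I)
  ultimately show ?case using e'(1) by blast
qed

lemma gauge_family_powers:
  assumes "gauge_family G" "e1 \<in> G" "e2 \<in> G"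
  shows "\<exists>e\<in>G. \<exists>B\<ge>1. \<forall>\<epsilon>>0. e1 \<epsilon> ^ Suc m * e2 \<epsilon> ^ Suc n \<le> B * e \<epsilon>"
proof -
  obtain e1' B1 where e1': "e1' \<in> G" "1 \<le> B1" "\<And>\<epsilon>. 0 < \<epsilon> \<Longrightarrow> e1 \<epsilon> ^ Suc m \<le> B1 * e1' \<epsilon>"
    using gauge_family_power[OF assms(1,2)] by meson
  obtain e2' B2 where e2': "e2' \<in> G" "1 \<le> B2" "\<And>\<epsilon>. 0 < \<epsilon> \<Longrightarrow> e2 \<epsilon> ^ Suc n \<le> B2 * e2' \<epsilon>"
    using gauge_family_power[OF assms(1,3)] by meson
  obtain e B where e: "e \<in> G" "1 \<le> B" "\<And>\<epsilon>. 0 < \<epsilon> \<Longrightarrow> e1' \<epsilon> * e2' \<epsilon> \<le> B * e \<epsilon>"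
    using gauge_family_mult[OF assms(1) e1'(1) e2'(1)] by blast
  have "e1 \<epsilon> ^ Suc m * e2 \<epsilon> ^ Suc n \<le> (B1 * B2 * B) * e \<epsilon>" if "0 < \<epsilon>" for \<epsilon>
  proof -
    have pos: "1 \<le> e1 \<epsilon>" "1 \<le> e2 \<epsilon>" "1 \<le> e1' \<epsilon>" "1 \<le> e2' \<epsilon>"
      using assms e1'(1) e2'(1) that by (auto intro: gauge_family_ge_1)
    have "e1 \<epsilon> ^ Suc m * e2 \<epsilon> ^ Suc n \<le> (B1 * e1' \<epsilon>) * (B2 * e2' \<epsilon>)"
      using pos e1'(2) by (intro mult_mono e1'(3) e2'(3) that mult_nonneg_nonneg zero_le_power) auto
    also have "\<dots> = (B1 * B2) * (e1' \<epsilon> * e2' \<epsilon>)" by simp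
    also have "\<dots> \<le> (B1 * B2) * (B * e \<epsilon>)"
      using e1'(2) e2'(2) e(3)[OF that] by (intro mult_left_mono) auto
    finally show ?thesis by (simp add: mult_ac)
  qed
  moreover have "1 \<le> B1 * B2 * B" using e(2) e1'(2) e2'(2) by (simp add: mult_ge1_I)
  ultimately show ?thesis using e(1) by blast
qed

context weight
begin

definition gauges_B :: "(real \<Rightarrow> real) set" where
  "gauges_B = {\<lambda>\<epsilon>. exp (assoc_fun M (k / \<epsilon>)) | k. 0 < k}"

definition gauges_R :: "(real \<Rightarrow> real) set" where
  "gauges_R = {\<lambda>\<epsilon>. exp (assoc_fun_seq M k (1 / \<epsilon>)) | k. k \<in> Rseq}"

lemma power_le_M:
  assumes "0 \<le> \<rho>"
  shows "\<exists>C\<ge>1. \<forall>p. \<rho> ^ p \<le> C * M p"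
proof -
  obtain a :: nat where a: "2 \<le> a" "\<And>D. 0 \<le> D \<Longrightarrow> \<exists>C. \<forall>n. fact n ^ Suc a * D ^ n \<le> C * M n ^ a"
    using fact_power_le_M by blast
  obtain C where C: "\<And>n. fact n ^ Suc a * (\<rho> ^ a) ^ n \<le> C * M n ^ a" using a(2)[of "\<rho> ^ a"] assms by auto
  have "\<rho> ^ n \<le> max 1 C * M n" for n
  proof -
    have "(\<rho> ^ n) ^ a = 1 * (\<rho> ^ a) ^ n" by (simp add: mult.commute flip: power_mult)
    also have "\<dots> \<le> fact n ^ Suc a * (\<rho> ^ a) ^ n"
      using assms by (intro mult_right_mono one_le_power) (auto simp: fact_ge_1)
    also have "\<dots> \<le> C * M n ^ a" by (rule C)
    also have "\<dots> \<le> max 1 C ^ a * M n ^ a"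
    proof (intro mult_right_mono)
      have "C \<le> max 1 C" by simp
      also have "\<dots> \<le> max 1 C ^ a" using a(1) by (intro self_le_power) auto
      finally show "C \<le> max 1 C ^ a" .
    qed simp
    finally have "(\<rho> ^ n) ^ a \<le> (max 1 C * M n) ^ a" by (simp add: power_mult_distrib)
    then show ?thesis using a(1) assms by (subst (asm) power_mono_iff) auto
  qed
  then show ?thesis by (intro exI[of _ "max 1 C"]) auto
qed

lemma good_weight_M: "good_weight M"
  using power_le_M by (auto simp: good_weight_def)

lemma seq_weight_pos: "r \<in> Rseq \<Longrightarrow> 0 < seq_weight M r p"
  unfolding seq_weight_def by (intro mult_pos_pos Rseq_prod_pos) auto

lemma good_weight_seq:
  assumes "r \<in> Rseq"
  shows "good_weight (seq_weight M r)"
  unfolding good_weight_def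
proof (intro conjI allI impI)
  fix \<rho> :: real assume "0 \<le> \<rho>"
  then obtain B where B: "1 \<le> B" "\<And>p. \<rho> ^ p \<le> B * M p" using power_le_M by blast
  obtain C where C: "1 \<le> C" "\<And>p. 1 ^ p \<le> C * (\<Prod>i=1..p. r i)" using Rseq_power_le_prod[OF assms, of 1] by auto
  have "\<rho> ^ p \<le> B * C * seq_weight M r p" for p
  proof -
    have "\<rho> ^ p \<le> (B * M p) * 1 ^ p" using B(2) by simp
    also have "\<dots> \<le> (B * M p) * (C * (\<Prod>i=1..p. r i))" using B(1) by (intro mult_left_mono C) auto
    finally show ?thesis by (simp add: seq_weight_def mult_ac)
  qed
  then show "\<exists>B. \<forall>p. \<rho> ^ p \<le> B * seq_weight M r p" by blast
qed (use seq_weight_pos[OF assms] in \<open>auto simp: seq_weight_def\<close>)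

lemma gauge_family_B: "gauge_family gauges_B"
  unfolding gauge_family_def
proof (intro conjI ballI allI impI)
  fix e1 e2 assume "e1 \<in> gauges_B" "e2 \<in> gauges_B"
  then obtain k1 k2 where k: "0 < k1" "0 < k2" and e: "e1 = (\<lambda>\<epsilon>. exp (assoc_fun M (k1 / \<epsilon>)))"
    "e2 = (\<lambda>\<epsilon>. exp (assoc_fun M (k2 / \<epsilon>)))" by (auto simp: gauges_B_def)
  \<comment> \<open>Splitting \<open>M (p + q)\<close> by (M.2) costs \<open>H ^ (p + q)\<close>,
    which is absorbed by enlarging the parameter by the factor \<open>H\<close>.\<close>
  define k where "k = H * max k1 k2"
  have kp: "0 < k" using k H by (simp add: k_def)
  have "e1 \<epsilon> * e2 \<epsilon> \<le> c0 * exp (assoc_fun M (k / \<epsilon>))" if \<epsilon>: "0 < \<epsilon>" for \<epsilon>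
    unfolding e
  proof (rule exp_assoc_fun_mult_le[OF good_weight_M good_weight_M good_weight_M])
    fix p q
    let ?m = "max k1 k2 / \<epsilon>"
    have "(k1 / \<epsilon>) ^ p * (k2 / \<epsilon>) ^ q * M (p + q) \<le> ?m ^ p * ?m ^ q * (c0 * H ^ (p + q) * (M p * M q))"
      using k \<epsilon> by (intro mult_mono power_mono divide_right_mono M2) auto
    also have "\<dots> = c0 * (k / \<epsilon>) ^ (p + q) * (M p * M q)"
    proof -
      have "k / \<epsilon> = H * ?m" by (simp add: k_def)
      then show ?thesis by (simp only: power_mult_distrib power_add mult_ac)
    qed
    finally show "(k1 / \<epsilon>) ^ p * (k2 / \<epsilon>) ^ q * M (p + q) \<le> c0 * (k / \<epsilon>) ^ (p + q) * (M p * M q)" .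
  qed (use k kp \<epsilon> c0 in auto)
  moreover have "(\<lambda>\<epsilon>. exp (assoc_fun M (k / \<epsilon>))) \<in> gauges_B" using kp by (auto simp: gauges_B_def)
  ultimately show "\<exists>e\<in>gauges_B. \<exists>B\<ge>1. \<forall>\<epsilon>>0. e1 \<epsilon> * e2 \<epsilon> \<le> B * e \<epsilon>"
    using c0 by (intro bexI exI[of _ c0]) auto
next
  fix e and \<epsilon> \<epsilon>' :: real assume "e \<in> gauges_B" "0 < \<epsilon>" "\<epsilon> \<le> \<epsilon>'"
  then obtain k where k: "0 < k" "e = (\<lambda>\<epsilon>. exp (assoc_fun M (k / \<epsilon>)))"
    by (auto simp: gauges_B_def)
  moreover have "k / \<epsilon>' \<le> k / \<epsilon>" using \<open>0 < \<epsilon>\<close> \<open>\<epsilon> \<le> \<epsilon>'\<close> k(1) by (intro frac_le) auto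
  ultimately show "e \<epsilon>' \<le> e \<epsilon>"
    using exp_assoc_fun_mono[OF good_weight_M, of "k / \<epsilon>'" "k / \<epsilon>"] \<open>0 < \<epsilon>\<close> \<open>\<epsilon> \<le> \<epsilon>'\<close> by simp
qed (use exp_assoc_fun_ge_1[OF good_weight_M] in \<open>auto simp: gauges_B_def simp del: one_le_exp_iff\<close>)

text \<open>In the Roumieu case the argument of the associated function is fixed at 1 / \<epsilon>,
  so the factor \<open>H ^ (p + q)\<close> of (M.2) must be absorbed by the sequence. With
  \<open>m\<close> the minimum of the two sequences, raised to at least 1, \<open>t\<close> lists
  every square root of a term of \<open>m\<close> twice. The first \<open>2 * p\<close> terms of
  \<open>t\<close> then have the same product as the first \<open>p\<close> terms of
  \<open>m\<close>, and \<open>t / H\<close> is the witness.\<close>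

lemma Rseq_sqrt:
  assumes k1: "k1 \<in> Rseq" and k2: "k2 \<in> Rseq"
  obtains k B where "k \<in> Rseq" "1 \<le> B"
    "\<And>p q. H ^ (p + q) * (\<Prod>i=1..p+q. k i) \<le> B * ((\<Prod>i=1..p. k1 i) * (\<Prod>i=1..q. k2 i))"
proof -
  define m where "m i = max 1 (min (k1 i) (k2 i))" for i
  define t where "t i = sqrt (m ((i + 1) div 2))" for i
  have m: "1 \<le> m i" for i by (simp add: m_def)
  have t: "1 \<le> t i" for i by (simp add: t_def m)
  have m_mono: "m i \<le> m j" if "1 \<le> i" "i \<le> j" for i j
  proof -
    have "k1 i \<le> k1 j" "k2 i \<le> k2 j"
      using that k1 k2 mono_onD[of "{1..}" k1 i j] mono_onD[of "{1..}" k2 i j] by (auto simp: Rseq_def)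
    then show ?thesis by (auto simp: m_def)
  qed
  have "(\<lambda>i. t i / H) \<in> Rseq"
    unfolding Rseq_def
  proof (intro CollectI conjI allI impI)
    show "0 < t i / H" for i using t[of i] H by simp
    show "mono_on {1..} (\<lambda>i. t i / H)"
    proof (intro mono_onI)
      fix i j :: nat assume "i \<in> {1..}" "i \<le> j"
      then have "m ((i + 1) div 2) \<le> m ((j + 1) div 2)" by (intro m_mono) (auto intro: div_le_mono)
      then show "t i / H \<le> t j / H" using H by (simp add: t_def divide_right_mono)
    qed
    show "filterlim (\<lambda>i. t i / H) at_top sequentially"
      unfolding filterlim_at_top eventually_sequentially
    proof
      fix Z :: real
      obtain N1 N2 where N: "\<And>i. N1 \<le> i \<Longrightarrow> (Z * H)\<^sup>2 \<le> k1 i" "\<And>i. N2 \<le> i \<Longrightarrow> (Z * H)\<^sup>2 \<le> k2 i"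
        using Rseq_eventually_ge[OF k1] Rseq_eventually_ge[OF k2] by blast
      have "Z \<le> t i / H" if "2 * (N1 + N2) \<le> i" for i
      proof -
        have "(Z * H)\<^sup>2 \<le> m ((i + 1) div 2)"
          unfolding m_def using N[of "(i + 1) div 2"] that by (intro max.coboundedI2) auto
        then have "Z * H \<le> t i" unfolding t_def by (rule real_le_rsqrt)
        then show ?thesis using H by (simp add: le_divide_eq)
      qed
      then show "\<exists>N. \<forall>n\<ge>N. Z \<le> t n / H" by blast
    qed
  qed
  moreover
  have t_even: "(\<Prod>i=1..2*p. t i) = (\<Prod>i=1..p. m i)" for p
  proof (induction p)
    case (Suc p)
    have "t (Suc (2 * p)) * t (Suc (Suc (2 * p))) = m (Suc p)"
      using m[of "Suc p"] by (simp add: t_def)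
    then show ?case using Suc by (simp add: mult.assoc)
  qed simp
  have prod_m_ge: "1 \<le> (\<Prod>i=1..p. m i)" for p by (intro prod_ge_1) (simp add: m)
  have t_mono: "(\<Prod>i=1..n. t i) \<le> (\<Prod>i=1..n'. t i)" if "n \<le> n'" for n n'
    by (rule prod_mono2) (use that t in \<open>auto intro: order_trans[OF _ t]\<close>)
  \<comment> \<open>\<open>p + q\<close> is at most twice the larger of \<open>p\<close> and
    \<open>q\<close>, so its product alone is enough; the other product is at least 1.\<close>
  have prod_t: "(\<Prod>i=1..p+q. t i) \<le> (\<Prod>i=1..p. m i) * (\<Prod>i=1..q. m i)" for p q
  proof (cases "q \<le> p")
    case True
    then have "(\<Prod>i=1..p+q. t i) \<le> (\<Prod>i=1..2*p. t i)" by (intro t_mono) simp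
    also have "\<dots> \<le> (\<Prod>i=1..p. m i) * (\<Prod>i=1..q. m i)"
      unfolding t_even using prod_m_ge[of p] prod_m_ge[of q] mult_left_mono[of 1 "\<Prod>i=1..q. m i" "\<Prod>i=1..p. m i"] by simp
    finally show ?thesis .
  next
    case False
    then have "(\<Prod>i=1..p+q. t i) \<le> (\<Prod>i=1..2*q. t i)" by (intro t_mono) simp
    also have "\<dots> \<le> (\<Prod>i=1..p. m i) * (\<Prod>i=1..q. m i)"
      unfolding t_even using prod_m_ge[of p] prod_m_ge[of q] mult_right_mono[of 1 "\<Prod>i=1..p. m i" "\<Prod>i=1..q. m i"] by simp
    finally show ?thesis .
  qed
  obtain C1 C2 where C: "1 \<le> C1" "1 \<le> C2"
    "\<And>p. (\<Prod>i=1..p. max 1 (k1 i)) \<le> C1 * (\<Prod>i=1..p. k1 i)"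
    "\<And>p. (\<Prod>i=1..p. max 1 (k2 i)) \<le> C2 * (\<Prod>i=1..p. k2 i)"
    using Rseq_prod_max_le[OF k1] Rseq_prod_max_le[OF k2] by blast
  have "H ^ (p + q) * (\<Prod>i=1..p+q. t i / H) \<le> C1 * C2 * ((\<Prod>i=1..p. k1 i) * (\<Prod>i=1..q. k2 i))" for p q
  proof -
    have "H ^ (p + q) * (\<Prod>i=1..p+q. t i / H) = (\<Prod>i=1..p+q. t i)"
      using H by (simp add: prod_dividef)
    also have "\<dots> \<le> (\<Prod>i=1..p. m i) * (\<Prod>i=1..q. m i)" by (rule prod_t)
    also have "\<dots> \<le> (C1 * (\<Prod>i=1..p. k1 i)) * (C2 * (\<Prod>i=1..q. k2 i))"
    proof (rule mult_mono)
      have "(\<Prod>i=1..p. m i) \<le> (\<Prod>i=1..p. max 1 (k1 i))"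
        by (intro prod_mono) (use m in \<open>auto simp: m_def\<close>)
      then show "(\<Prod>i=1..p. m i) \<le> C1 * (\<Prod>i=1..p. k1 i)" using C(3)[of p] by simp
      have "(\<Prod>i=1..q. m i) \<le> (\<Prod>i=1..q. max 1 (k2 i))"
        by (intro prod_mono) (use m in \<open>auto simp: m_def\<close>)
      then show "(\<Prod>i=1..q. m i) \<le> C2 * (\<Prod>i=1..q. k2 i)" using C(4)[of q] by simp
    qed (use C(1) Rseq_prod_pos[OF k1, of p] prod_m_ge[of q] in auto)
    finally show ?thesis by (simp add: mult_ac)
  qed
  moreover have "1 \<le> C1 * C2" using C(1,2) by (rule mult_ge1_I)
  ultimately show ?thesis using that by blast
qed

lemma gauge_family_R: "gauge_family gauges_R"
  unfolding gauge_family_def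
proof (intro conjI ballI allI impI)
  fix e1 e2 assume "e1 \<in> gauges_R" "e2 \<in> gauges_R"
  then obtain k1 k2 where k12: "k1 \<in> Rseq" "k2 \<in> Rseq" and e: "e1 = (\<lambda>\<epsilon>. exp (assoc_fun_seq M k1 (1 / \<epsilon>)))"
    "e2 = (\<lambda>\<epsilon>. exp (assoc_fun_seq M k2 (1 / \<epsilon>)))" by (auto simp: gauges_R_def)
  obtain k B where k: "k \<in> Rseq" "1 \<le> B"
    "\<And>p q. H ^ (p + q) * (\<Prod>i=1..p+q. k i) \<le> B * ((\<Prod>i=1..p. k1 i) * (\<Prod>i=1..q. k2 i))"
    using Rseq_sqrt[OF k12] by metis
  have "e1 \<epsilon> * e2 \<epsilon> \<le> (c0 * B) * exp (assoc_fun_seq M k (1 / \<epsilon>))" if \<epsilon>: "0 < \<epsilon>" for \<epsilon>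
    unfolding e assoc_fun_seq_def
  proof (rule exp_assoc_fun_mult_le[OF k12[THEN good_weight_seq] good_weight_seq[OF k(1)]])
    fix p q
    let ?r = "(1 / \<epsilon>) ^ p * (1 / \<epsilon>) ^ q"
    have "seq_weight M k (p + q) \<le> (c0 * H ^ (p + q) * (M p * M q)) * (\<Prod>i=1..p+q. k i)"
      unfolding seq_weight_def using Rseq_prod_pos[OF k(1), of "p + q"] by (intro mult_right_mono M2) auto
    also have "\<dots> = c0 * (M p * M q) * (H ^ (p + q) * (\<Prod>i=1..p+q. k i))" by simp
    also have "\<dots> \<le> c0 * (M p * M q) * (B * ((\<Prod>i=1..p. k1 i) * (\<Prod>i=1..q. k2 i)))"
      using c0 by (intro mult_left_mono k) auto
    also have "\<dots> = (c0 * B) * (seq_weight M k1 p * seq_weight M k2 q)" by (simp add: seq_weight_def)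
    finally have "?r * seq_weight M k (p + q) \<le> ?r * ((c0 * B) * (seq_weight M k1 p * seq_weight M k2 q))"
      using \<epsilon> by (intro mult_left_mono) auto
    then show "(1 / \<epsilon>) ^ p * (1 / \<epsilon>) ^ q * seq_weight M k (p + q)
        \<le> c0 * B * (1 / \<epsilon>) ^ (p + q) * (seq_weight M k1 p * seq_weight M k2 q)"
      by (simp add: power_add mult_ac)
  qed (use \<epsilon> c0 k in auto)
  moreover have "1 \<le> c0 * B" using c0 k(2) by (rule mult_ge1_I)
  moreover have "(\<lambda>\<epsilon>. exp (assoc_fun_seq M k (1 / \<epsilon>))) \<in> gauges_R" using k(1) by (auto simp: gauges_R_def)
  ultimately show "\<exists>e\<in>gauges_R. \<exists>B\<ge>1. \<forall>\<epsilon>>0. e1 \<epsilon> * e2 \<epsilon> \<le> B * e \<epsilon>"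
    by (intro bexI exI[of _ "c0 * B"]) auto
next
  fix e and \<epsilon> \<epsilon>' :: real assume "e \<in> gauges_R" "0 < \<epsilon>" "\<epsilon> \<le> \<epsilon>'"
  then obtain k where "k \<in> Rseq" "e = (\<lambda>\<epsilon>. exp (assoc_fun (seq_weight M k) (1 / \<epsilon>)))"
    by (auto simp: gauges_R_def assoc_fun_seq_def)
  moreover have "1 / \<epsilon>' \<le> 1 / \<epsilon>" using \<open>0 < \<epsilon>\<close> \<open>\<epsilon> \<le> \<epsilon>'\<close> by (intro frac_le) auto
  ultimately show "e \<epsilon>' \<le> e \<epsilon>"
    using exp_assoc_fun_mono[OF good_weight_seq, of k "1 / \<epsilon>'" "1 / \<epsilon>"] \<open>0 < \<epsilon>\<close> \<open>\<epsilon> \<le> \<epsilon>'\<close> by simp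
qed (use exp_assoc_fun_ge_1[OF good_weight_seq] in \<open>auto simp: gauges_R_def assoc_fun_seq_def simp del: one_le_exp_iff\<close>)

end

section \<open>Series and integrals of smooth functions\<close>

lemma smooth_on_Un: "smooth_on S u \<Longrightarrow> smooth_on T u \<Longrightarrow> smooth_on (S \<union> T) u"
  by (auto simp: smooth_on_def)

lemma norm_sum_scaleR_le:
  fixes h :: "real^'d::finite"
  assumes "\<And>i. norm (a i) \<le> b i"
  shows "norm (\<Sum>i\<in>UNIV. h $ i *\<^sub>R a i) \<le> (\<Sum>i\<in>UNIV. b i) * norm h"
proof -
  have "norm (\<Sum>i\<in>UNIV. h $ i *\<^sub>R a i) \<le> (\<Sum>i\<in>UNIV. norm h * b i)"
    by (rule sum_norm_le) (use assms in \<open>auto intro!: mult_mono component_le_norm_cart\<close>)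
  then show ?thesis by (simp add: sum_distrib_left [symmetric] mult.commute)
qed

text \<open>The majorants are uniform on \<open>S\<close>, so each series of derivatives may be
  differentiated term by term. In \<open>step\<close> the identity for one list yields the
  derivative of the corresponding partial of the sum, and hence the identity for the next longer
  list.\<close>

lemma partials_series_sums:
  fixes u :: "nat \<Rightarrow> real^'d::finite \<Rightarrow> complex"
  assumes S: "open S" and u: "\<And>n. smooth_on S (u n)"
    and b: "\<And>n is x. x \<in> S \<Longrightarrow> norm (partials is (u n) x) \<le> b is n" "\<And>is. summable (b is)"
  shows "x \<in> S \<Longrightarrow> (\<lambda>n. partials is (u n) x) sums partials is (\<lambda>x. \<Sum>n. u n x) x"
    and "smooth_on S (\<lambda>x. \<Sum>n. u n x)"
proof -
  let ?U = "\<lambda>x. \<Sum>n. u n x"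
  have summ: "summable (\<lambda>n. partials is (u n) x)" if "x \<in> S" for "is" x
    by (rule summable_comparison_test'[OF b(2)[of "is"], of 0]) (use b(1)[OF that] in auto)
  define G where "G is x = (\<Sum>n. partials is (u n) x)" for "is" x
  have step: "(partials is ?U has_derivative (\<lambda>h. \<Sum>i\<in>UNIV. h $ i *\<^sub>R G (i # is) x)) (at x)"
    if sums: "\<And>x. x \<in> S \<Longrightarrow> (\<lambda>n. partials is (u n) x) sums partials is ?U x" and x: "x \<in> S" for "is" x
  proof -
    obtain r where r: "0 < r" "ball x r \<subseteq> S" using S x open_contains_ball by blast
    let ?f' = "\<lambda>n y h. \<Sum>i\<in>UNIV. h $ i *\<^sub>R partials (i # is) (u n) y"
    let ?g' = "\<lambda>y h. \<Sum>i\<in>UNIV. h $ i *\<^sub>R G (i # is) y"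
    have "\<exists>g. \<forall>y\<in>ball x r. (\<lambda>n. partials is (u n) y) sums g y \<and> (g has_derivative ?g' y) (at y within ball x r)"
    proof (rule has_derivative_series)
      show "(partials is (u n) has_derivative ?f' n y) (at y within ball x r)" if "y \<in> ball x r" for n y
        unfolding partials_Cons
        by (rule has_derivative_at_withinI, rule has_derivative_partial,
            rule smooth_on_partials_diff[OF u]) (use that r in blast)
      show "\<forall>\<^sub>F n in sequentially. \<forall>y\<in>ball x r. \<forall>h. norm ((\<Sum>k<n. ?f' k y h) - ?g' y h) \<le> e * norm h"
        if e: "0 < e" for e
      proof -
        let ?c = "real CARD('d)"
        \<comment> \<open>The tails are made small in all coordinate directions at once; the
          division by the dimension is undone when the directions are summed.\<close>
        have "\<forall>\<^sub>F n in sequentially. \<forall>i. norm (\<Sum>k. b (i # is) (k + n)) < e / ?c"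
        proof (rule eventually_all_finite)
          fix i
          show "\<forall>\<^sub>F n in sequentially. norm (\<Sum>k. b (i # is) (k + n)) < e / ?c"
            unfolding eventually_sequentially using e by (intro suminf_exist_split b(2)) simp
        qed
        then show ?thesis
        proof eventually_elim
          case (elim n)
          show ?case
          proof (intro ballI allI)
            fix y h assume "y \<in> ball x r"
            then have y: "y \<in> S" using r by blast
            have "(\<Sum>k<n. ?f' k y h) - ?g' y h
                = (\<Sum>i\<in>UNIV. h $ i *\<^sub>R ((\<Sum>k<n. partials (i # is) (u k) y) - G (i # is) y))"
              by (subst sum.swap) (simp add: scaleR_diff_right sum_subtractf scaleR_sum_right)
            also have "norm \<dots> \<le> (\<Sum>i\<in>(UNIV :: 'd set). e / ?c) * norm h"
            proof (rule norm_sum_scaleR_le)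
              fix i
              let ?a = "\<lambda>k. partials (i # is) (u k) y"
              have "(\<Sum>k<n. ?a k) - G (i # is) y = - (\<Sum>k. ?a (k + n))"
                unfolding G_def using suminf_minus_initial_segment[OF summ[OF y, of "i # is"], of n] by simp
              then have "norm ((\<Sum>k<n. ?a k) - G (i # is) y) = norm (\<Sum>k. ?a (k + n))" by simp
              also have "\<dots> \<le> (\<Sum>k. b (i # is) (k + n))"
                by (rule norm_suminf_le) (use b y in \<open>auto simp: summable_iff_shift\<close>)
              also have "\<dots> \<le> e / ?c" using elim[rule_format, of i] by simp
              finally show "norm ((\<Sum>k<n. ?a k) - G (i # is) y) \<le> e / ?c" .
            qed
            finally show "norm ((\<Sum>k<n. ?f' k y h) - ?g' y h) \<le> e * norm h" by simp
          qed
        qed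
      qed
      show "(\<lambda>n. partials is (u n) x) sums partials is ?U x" by (rule sums[OF x])
    qed (use r in auto)
    then obtain g where g: "\<And>y. y \<in> ball x r \<Longrightarrow> (\<lambda>n. partials is (u n) y) sums g y"
      "\<And>y. y \<in> ball x r \<Longrightarrow> (g has_derivative ?g' y) (at y within ball x r)" by blast
    have "g y = partials is ?U y" if "y \<in> ball x r" for y
      using sums_unique2[OF g(1)[OF that] sums] that r by blast
    moreover have "(g has_derivative ?g' x) (at x)"
      using g(2)[of x] r by (simp add: at_within_open[of x "ball x r"])
    ultimately show ?thesis
      using r by (auto intro: has_derivative_transform_within_open[of g _ x UNIV "ball x r"])
  qed
  have sums: "(\<lambda>n. partials is (u n) x) sums partials is ?U x" if "x \<in> S" for "is" x
    using that
  proof (induction "is" arbitrary: x)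
    case Nil
    then show ?case using summ[of x "[]"] by (simp add: summable_sums)
  next
    case (Cons i "is")
    have "partials (i # is) ?U x = G (i # is) x"
      unfolding partials_Cons by (subst partial_eqI[OF step[OF Cons.IH Cons.prems]])
        (auto simp: axis_def if_distrib[of "\<lambda>c. c *\<^sub>R _"] cong: if_cong)
    then show ?case using summ[OF Cons.prems] by (simp add: G_def summable_sums)
  qed
  show "x \<in> S \<Longrightarrow> (\<lambda>n. partials is (u n) x) sums partials is ?U x" by (rule sums)
  show "smooth_on S ?U"
    unfolding smooth_on_def differentiable_def using step[OF sums] by blast
qed

section \<open>Functions supported in a compact set and pairings with them\<close>

definition supported_in :: "(real^'d) set \<Rightarrow> (real^'d) set \<Rightarrow> (real^'d \<Rightarrow> complex) \<Rightarrow> bool" where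
  "supported_in S K \<kappa> \<longleftrightarrow> smooth_on S \<kappa> \<and> (\<forall>x\<in>S - K. \<kappa> x = 0)"

lemma supported_in_partials_eq_0:
  assumes "open S" "closed K" "supported_in S K \<kappa>" "x \<in> S - K"
  shows "partials is \<kappa> x = 0"
  by (rule partials_eq_0[of "S - K"]) (use assms in \<open>auto simp: supported_in_def\<close>)

lemma supported_in_partials:
  "\<lbrakk>open S; closed K; supported_in S K \<kappa>\<rbrakk> \<Longrightarrow> supported_in S K (partials is \<kappa>)"
  using supported_in_partials_eq_0 smooth_on_partials unfolding supported_in_def by blast

lemma supported_in_mult:
  "\<lbrakk>open S; smooth_on S u; supported_in S K \<kappa>\<rbrakk> \<Longrightarrow> supported_in S K (\<lambda>x. u x * \<kappa> x)"
  by (auto simp: supported_in_def intro: smooth_on_mult)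

lemma supported_in_add:
  "\<lbrakk>open S; supported_in S K u; supported_in S K v\<rbrakk> \<Longrightarrow> supported_in S K (\<lambda>x. u x + v x)"
  by (auto simp: supported_in_def intro: smooth_on_add)

lemma supported_in_bounded_linear:
  "\<lbrakk>open S; bounded_linear L; supported_in S K u\<rbrakk> \<Longrightarrow> supported_in S K (\<lambda>x. L (u x))"
  by (auto simp: supported_in_def linear_0 bounded_linear.linear intro: smooth_on_bounded_linear)

abbreviation pairing :: "(real^'d::finite) set \<Rightarrow> (real^'d \<Rightarrow> complex) \<Rightarrow> (real^'d \<Rightarrow> complex) \<Rightarrow> complex" where
  "pairing S f \<kappa> \<equiv> LINT t:S|lborel. f t * \<kappa> t"

context
  fixes S K :: "(real^'d::finite) set"
  assumes K: "compact K" "K \<subseteq> S"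
begin

lemma set_integrable_supported:
  fixes f :: "real^'d \<Rightarrow> complex"
  assumes "continuous_on S f" "\<And>x. x \<in> S - K \<Longrightarrow> f x = 0"
  shows "set_integrable lborel S f" and "(LINT t:S|lborel. f t) = (LINT t:K|lborel. f t)"
proof -
  have eq: "indicator S x *\<^sub>R f x = indicator K x *\<^sub>R f x" for x
    using assms(2)[of x] K by (auto simp: indicator_def)
  have "integrable lborel (\<lambda>x. indicator K x *\<^sub>R f x)"
    using K assms(1) by (intro borel_integrable_compact) (auto intro: continuous_on_subset)
  then show "set_integrable lborel S f" by (simp add: set_integrable_def eq)
  show "(LINT t:S|lborel. f t) = (LINT t:K|lborel. f t)" by (simp add: set_lebesgue_integral_def eq)
qed

lemma set_integrable_pairing:
  assumes "continuous_on S f" "supported_in S K \<kappa>"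
  shows "set_integrable lborel S (\<lambda>t. f t * \<kappa> t)"
proof (rule set_integrable_supported(1))
  show "continuous_on S (\<lambda>t. f t * \<kappa> t)"
    using assms by (intro continuous_on_mult assms(1) smooth_on_continuous_on) (auto simp: supported_in_def)
qed (use assms in \<open>auto simp: supported_in_def\<close>)

lemma norm_set_integral_le:
  fixes f :: "real^'d \<Rightarrow> complex"
  assumes "\<And>x. x \<in> S - K \<Longrightarrow> f x = 0" "\<And>x. x \<in> K \<Longrightarrow> norm (f x) \<le> c" "0 \<le> c"
  shows "norm (LINT t:S|lborel. f t) \<le> c * measure lborel K"
proof -
  have Kb: "K \<in> sets lborel" using K by (simp add: borel_compact)
  have fin: "emeasure lborel K < \<infinity>" using K compact_imp_bounded emeasure_bounded_finite by blast
  have int: "integrable lborel (indicator K :: _ \<Rightarrow> real)" using Kb fin by (rule integrable_real_indicator)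
  have eq: "indicator S x *\<^sub>R f x = indicator K x *\<^sub>R f x" for x
    using assms(1)[of x] K by (auto simp: indicator_def)
  have "norm (LINT t:S|lborel. f t) \<le> (LINT x|lborel. norm (indicator K x *\<^sub>R f x))"
    unfolding set_lebesgue_integral_def eq by (rule integral_norm_bound)
  also have "\<dots> \<le> (LINT x|lborel. c * indicator K x)"
    by (rule integral_mono')
      (use assms integrable_mult_right[OF int, of c] in \<open>auto simp: indicator_def\<close>)
  also have "\<dots> = c * measure lborel K" using Kb by simp
  finally show ?thesis .
qed

lemma pairing_add:
  fixes f :: "real^'d \<Rightarrow> complex"
  assumes "continuous_on S f" "supported_in S K u" "supported_in S K v"
  shows "pairing S f (\<lambda>x. u x + v x) = pairing S f u + pairing S f v"
  using set_integrable_pairing[OF assms(1,2)] set_integrable_pairing[OF assms(1,3)]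
  by (simp add: distrib_left set_integral_add)

lemma pairing_diff_left:
  fixes f g :: "real^'d \<Rightarrow> complex"
  assumes "continuous_on S f" "continuous_on S g" "supported_in S K u"
  shows "pairing S (\<lambda>x. f x - g x) u = pairing S f u - pairing S g u"
  using set_integrable_pairing[OF assms(1,3)] set_integrable_pairing[OF assms(2,3)]
  by (simp add: left_diff_distrib set_integral_diff)

lemma norm_pairing_le:
  fixes f :: "real^'d \<Rightarrow> complex"
  assumes "continuous_on S f"
  shows "\<exists>B\<ge>1. \<forall>\<kappa> s. 0 \<le> s \<longrightarrow> (\<forall>x\<in>S. norm (\<kappa> x) \<le> s) \<longrightarrow> (\<forall>x\<in>S - K. \<kappa> x = 0)
    \<longrightarrow> norm (pairing S f \<kappa>) \<le> B * s"
proof -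
  have "bounded (f ` K)"
    using K assms by (meson compact_continuous_image compact_imp_bounded continuous_on_subset)
  then obtain b where b: "0 < b" "\<And>x. x \<in> K \<Longrightarrow> norm (f x) \<le> b"
    using bounded_pos by (metis image_eqI)
  have "norm (pairing S f \<kappa>) \<le> max 1 (b * measure lborel K) * s"
    if s: "0 \<le> s" "\<forall>x\<in>S. norm (\<kappa> x) \<le> s" "\<forall>x\<in>S - K. \<kappa> x = 0" for \<kappa> s
  proof -
    have "norm (pairing S f \<kappa>) \<le> (b * s) * measure lborel K"
    proof (rule norm_set_integral_le)
      fix x assume "x \<in> K"
      then have "norm (f x) * norm (\<kappa> x) \<le> b * s"
        using b(1) b(2)[of x] s(1) s(2) K by (intro mult_mono) auto
      then show "norm (f x * \<kappa> x) \<le> b * s" by (simp add: norm_mult)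
    qed (use s b in auto)
    also have "\<dots> = (b * measure lborel K) * s" by simp
    also have "\<dots> \<le> max 1 (b * measure lborel K) * s" using s by (intro mult_right_mono) auto
    finally show ?thesis .
  qed
  then show ?thesis by (intro exI[of _ "max 1 (b * measure lborel K)"]) auto
qed

end

section \<open>Integration by parts\<close>

lemma lborel_integral_translate:
  fixes W :: "'a::euclidean_space \<Rightarrow> 'b::{banach,second_countable_topology}"
  assumes "W \<in> borel_measurable borel"
  shows "(LINT x|lborel. W (x + c)) = (LINT x|lborel. W x)"
proof -
  have "(LINT x|lborel. W x) = (LINT x|distr lborel borel ((+) c). W x)" by (simp add: lborel_distr_plus)
  also have "\<dots> = (LINT x|lborel. W (c + x))" by (rule integral_distr) (use assms in auto)
  finally show ?thesis by (simp add: add.commute)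
qed

text \<open>The integral of a difference quotient vanishes by translation invariance.\<close>

lemma integral_partial_eq_0:
  fixes W :: "real^'d::finite \<Rightarrow> complex"
  assumes W: "smooth_on UNIV W" and K: "compact K" "\<And>x. x \<notin> K \<Longrightarrow> W x = 0"
  shows "(LINT x|lborel. partial i W x) = 0"
proof -
  define e where "e = (axis i 1 :: real^'d)"
  define q where "q n x = real (Suc n) *\<^sub>R (W (x + (1 / real (Suc n)) *\<^sub>R e) - W x)" for n x
  have ne: "norm e = 1" by (simp add: e_def norm_axis_1)
  have cont: "continuous_on UNIV W" using W by (rule smooth_on_continuous_on)
  have cont_p: "continuous_on UNIV (partial j W)" for j
    by (intro smooth_on_continuous_on smooth_on_partial W)
  have p0: "partial j W x = 0" if "x \<notin> K" for j x
    using partials_eq_0[of "- K" x W "[j]"] that K compact_imp_closed by (auto simp: partials_Cons)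
  have "\<exists>b. \<forall>x. norm (partial j W x) \<le> b" for j
  proof -
    have "bounded (partial j W ` K)"
      using K cont_p by (meson compact_continuous_image compact_imp_bounded continuous_on_subset top_greatest)
    then obtain b where b: "0 < b" "\<And>x. x \<in> K \<Longrightarrow> norm (partial j W x) \<le> b"
      using bounded_pos by (metis image_eqI)
    have "norm (partial j W x) \<le> b" for x by (cases "x \<in> K") (use b p0 in auto)
    then show ?thesis by blast
  qed
  then obtain b where b: "\<And>j x. norm (partial j W x) \<le> b j" by metis
  define L where "L = (\<Sum>j\<in>UNIV. b j)"
  have "0 \<le> b j" for j using b[of j] norm_ge_zero order_trans by blast
  then have L0: "0 \<le> L" unfolding L_def by (intro sum_nonneg)
  \<comment> \<open>A Lipschitz bound controls all difference quotients at once and so supplies the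
    dominating function.\<close>
  have Lip: "norm (W y - W x) \<le> L * norm (y - x)" for x y
  proof (rule differentiable_bound[of UNIV W "\<lambda>x h. \<Sum>j\<in>UNIV. h $ j *\<^sub>R partial j W x"])
    show "(W has_derivative (\<lambda>h. \<Sum>j\<in>UNIV. h $ j *\<^sub>R partial j W x)) (at x within UNIV)" for x
      by (intro has_derivative_partial smooth_on_diff[OF W] UNIV_I)
    show "onorm (\<lambda>h. \<Sum>j\<in>UNIV. h $ j *\<^sub>R partial j W x) \<le> L" for x
      unfolding L_def by (intro onorm_le norm_sum_scaleR_le b)
  qed auto
  obtain R where R: "\<And>x. x \<in> K \<Longrightarrow> norm x \<le> R" using K compact_imp_bounded bounded_iff by metis
  have W0: "W x = 0" if "R < norm x" for x using K(2) R that by force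
  have "(\<lambda>n. LINT x|lborel. q n x) \<longlonglongrightarrow> (LINT x|lborel. partial i W x)"
  \<comment> \<open>The steps \<open>1 / real (Suc n)\<close> are at most 1, so all difference
    quotients vanish outside the ball of radius \<open>R + 1\<close>.\<close>
  proof (rule integral_dominated_convergence[where w = "\<lambda>x. L * indicator (cball 0 (R + 1)) x"])
    show "partial i W \<in> borel_measurable lborel"
      using cont_p[of i] by (simp add: borel_measurable_continuous_onI)
    show "q n \<in> borel_measurable lborel" for n
    proof -
      have "continuous_on UNIV (q n)"
        unfolding q_def by (intro continuous_intros continuous_on_compose2[OF cont]) auto
      then show ?thesis by (simp add: borel_measurable_continuous_onI)
    qed
    show "integrable lborel (\<lambda>x::real^'d. L * indicator (cball 0 (R + 1)) x)"
      using emeasure_bounded_finite[of "cball (0::real^'d) (R + 1)"]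
      by (intro integrable_mult_right integrable_real_indicator) auto
    show "AE x in lborel. (\<lambda>n. q n x) \<longlonglongrightarrow> partial i W x"
    proof (rule AE_I2)
      fix x :: "real^'d"
      have "((\<lambda>s. W (x + s *\<^sub>R e)) has_vector_derivative partial i W x) (at 0)"
        unfolding e_def by (intro has_vector_derivative_partial_line smooth_on_diff[OF W] UNIV_I)
      then have "((\<lambda>s. (W (x + s *\<^sub>R e) - W x - s *\<^sub>R partial i W x) /\<^sub>R \<bar>s\<bar>) \<longlongrightarrow> 0) (at 0)"
        by (simp add: has_vector_derivative_def has_derivative_def)
      then have lim: "((\<lambda>s. norm ((W (x + s *\<^sub>R e) - W x - s *\<^sub>R partial i W x) /\<^sub>R \<bar>s\<bar>)) \<longlongrightarrow> 0) (at 0)"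
        by (rule tendsto_norm_zero)
      have eq: "norm ((W (x + s *\<^sub>R e) - W x - s *\<^sub>R partial i W x) /\<^sub>R \<bar>s\<bar>)
          = norm ((W (x + s *\<^sub>R e) - W x) /\<^sub>R s - partial i W x)" if "s \<noteq> 0" for s
      proof -
        have "norm ((W (x + s *\<^sub>R e) - W x - s *\<^sub>R partial i W x) /\<^sub>R \<bar>s\<bar>)
            = norm ((W (x + s *\<^sub>R e) - W x - s *\<^sub>R partial i W x) /\<^sub>R s)" by simp
        also have "\<dots> = norm ((W (x + s *\<^sub>R e) - W x) /\<^sub>R s - partial i W x)"
          using that by (subst scaleR_diff_right) simp
        finally show ?thesis .
      qed
      have "((\<lambda>s. norm ((W (x + s *\<^sub>R e) - W x) /\<^sub>R s - partial i W x)) \<longlongrightarrow> 0) (at 0)"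
        by (rule Lim_transform_eventually[OF lim]) (use eq in \<open>simp add: eventually_at_filter\<close>)
      then have "((\<lambda>s. (W (x + s *\<^sub>R e) - W x) /\<^sub>R s) \<longlongrightarrow> partial i W x) (at 0)"
        by (rule Lim_null[THEN iffD2, OF tendsto_norm_zero_cancel])
      moreover have "filterlim (\<lambda>n. 1 / real (Suc n)) (at 0) sequentially"
        unfolding filterlim_at using lim_inverse_n' LIMSEQ_Suc[OF lim_inverse_n'] by auto
      ultimately have "(\<lambda>n. (W (x + (1 / real (Suc n)) *\<^sub>R e) - W x) /\<^sub>R (1 / real (Suc n))) \<longlonglongrightarrow> partial i W x"
        by (rule filterlim_compose)
      then show "(\<lambda>n. q n x) \<longlonglongrightarrow> partial i W x" by (simp add: q_def)
    qed
    show "AE x in lborel. norm (q n x) \<le> L * indicator (cball 0 (R + 1)) x" for n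
    proof (rule AE_I2)
      fix x :: "real^'d"
      let ?y = "x + (1 / real (Suc n)) *\<^sub>R e"
      show "norm (q n x) \<le> L * indicator (cball 0 (R + 1)) x"
      proof (cases "norm x \<le> R + 1")
        case True
        have "norm (q n x) \<le> real (Suc n) * (L * norm (?y - x))"
          unfolding q_def norm_scaleR using Lip[of ?y x] by (intro mult_mono) auto
        also have "norm (?y - x) = 1 / real (Suc n)" using ne by simp
        finally show ?thesis using True by simp
      next
        case False
        have "norm x \<le> norm ?y + norm ((1 / real (Suc n)) *\<^sub>R e)"
          by (metis add_diff_cancel_right' norm_triangle_ineq4)
        moreover have "norm ((1 / real (Suc n)) *\<^sub>R e) \<le> 1" using ne by simp
        ultimately have "R < norm ?y" using False by linarith
        then have "W ?y = 0" "W x = 0" using False by (auto intro: W0)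
        then show ?thesis using L0 by (simp add: q_def)
      qed
    qed
  qed
  moreover have "(LINT x|lborel. q n x) = 0" for n
  proof -
    have int: "integrable lborel W"
    proof -
      have "W = (\<lambda>x. indicator K x *\<^sub>R W x)" using K by (auto simp: indicator_def fun_eq_iff)
      moreover have "integrable lborel (\<lambda>x. indicator K x *\<^sub>R W x)"
        using K cont by (intro borel_integrable_compact) (auto intro: continuous_on_subset)
      ultimately show ?thesis by simp
    qed
    have meas: "W \<in> borel_measurable borel" using cont by (rule borel_measurable_continuous_onI)
    have int': "integrable lborel (\<lambda>x. W (x + c))" for c
    proof -
      have "integrable (distr lborel borel ((+) c)) W" using int by (simp add: lborel_distr_plus)
      then have "integrable lborel (\<lambda>x. W (c + x))" by (subst (asm) integrable_distr_eq) (use meas in auto)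
      then show ?thesis by (simp add: add.commute)
    qed
    show ?thesis
      unfolding q_def using int int' lborel_integral_translate[OF meas] by simp
  qed
  ultimately show ?thesis by (simp add: LIMSEQ_const_iff)
qed

text \<open>Extended by 0 outside \<open>K\<close>, the product \<open>u * v\<close> is smooth on
  the whole space, being smooth on the open sets \<open>S\<close> and \<open>- K\<close> that cover
  it. The integral of its partial derivative therefore vanishes.\<close>

lemma pairing_partial:
  fixes u v :: "real^'d::finite \<Rightarrow> complex"
  assumes "open S" "compact K" "K \<subseteq> S" "smooth_on S u" "supported_in S K v"
  shows "pairing S (partial i u) v = - pairing S u (partial i v)"
proof -
  define w where "w x = u x * v x" for x
  define W where "W x = (if x \<in> K then w x else 0)" for x
  have w: "supported_in S K w" unfolding w_def by (intro supported_in_mult assms)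
  have cK: "closed K" using assms(2) compact_imp_closed by blast
  have WS: "W x = w x" if "x \<in> S" for x using that w by (auto simp: W_def supported_in_def)
  have "smooth_on (S \<union> - K) W"
  proof (rule smooth_on_Un)
    show "smooth_on S W"
      by (rule smooth_on_cong[OF assms(1) WS[symmetric]]) (use w in \<open>auto simp: supported_in_def\<close>)
    show "smooth_on (- K) W"
      by (rule smooth_on_cong[OF _ _ smooth_on_zero]) (use cK in \<open>auto simp: W_def\<close>)
  qed
  moreover have "S \<union> - K = UNIV" using assms(3) by auto
  ultimately have W: "smooth_on UNIV W" by simp
  have 0: "(LINT x|lborel. partial i W x) = 0"
    by (rule integral_partial_eq_0[OF W assms(2)]) (simp add: W_def)
  have *: "partial i W x = indicator S x *\<^sub>R partial i W x" for x
    using partials_eq_0[of "- K" x W "[i]"] cK assms(3)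
    by (auto simp: indicator_def partials_Cons W_def)
  have **: "indicator S x *\<^sub>R partial i W x = indicator S x *\<^sub>R (partial i u x * v x + u x * partial i v x)" for x
  proof (cases "x \<in> S")
    case True
    then have "partial i W x = partial i w x" using partial_cong[OF assms(1)] WS by blast
    also have "\<dots> = partial i u x * v x + u x * partial i v x"
      unfolding w_def using assms True by (intro partial_mult smooth_on_diff) (auto simp: supported_in_def)
    finally show ?thesis by simp
  qed simp
  have "(LINT t:S|lborel. partial i u t * v t + u t * partial i v t) = 0"
    unfolding set_lebesgue_integral_def **[symmetric] *[symmetric] by (rule 0)
  moreover have v': "supported_in S K (partial i v)"
    using supported_in_partials[OF assms(1) cK assms(5), of "[i]"] by (simp add: partials_Cons)
  have "set_integrable lborel S (\<lambda>t. f t * z t)" if "smooth_on S f" "supported_in S K z" for f z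
    by (rule set_integrable_pairing[OF assms(2,3) smooth_on_continuous_on[OF that(1)] that(2)])
  then have "(LINT t:S|lborel. partial i u t * v t + u t * partial i v t)
      = pairing S (partial i u) v + pairing S u (partial i v)"
    using assms v' by (intro set_integral_add) (auto intro: smooth_on_partial)
  ultimately show ?thesis by (simp add: eq_neg_iff_add_eq_0)
qed

text \<open>Taking norms discards the sign. The outermost derivative is moved first and becomes the
  innermost one, hence the reversed list.\<close>

lemma norm_pairing_partials:
  fixes u v :: "real^'d::finite \<Rightarrow> complex"
  assumes "open S" "compact K" "K \<subseteq> S" "smooth_on S u" "supported_in S K v"
  shows "norm (pairing S (partials is u) v) = norm (pairing S u (partials (rev is) v))"
  using assms(5)
proof (induction "is" arbitrary: v)
  case (Cons i "is")
  have cK: "closed K" using assms(2) compact_imp_closed by blast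
  have "norm (pairing S (partials (i # is) u) v) = norm (pairing S (partials is u) (partial i v))"
    unfolding partials_Cons
    by (subst pairing_partial[OF assms(1-3) smooth_on_partials[OF assms(4)] Cons.prems]) simp
  also have "\<dots> = norm (pairing S u (partials (rev is) (partial i v)))"
    using supported_in_partials[OF assms(1) cK Cons.prems, of "[i]"] by (intro Cons.IH) (simp add: partials_Cons)
  finally show ?case by (simp add: partials_append partials_Cons)
qed simp

section \<open>Uniform boundedness on spaces of test functions\<close>

definition partials_le :: "(real^'d) set \<Rightarrow> (nat \<Rightarrow> real) \<Rightarrow> (real^'d \<Rightarrow> complex) \<Rightarrow> real \<Rightarrow> bool" where
  "partials_le S w u P \<longleftrightarrow> (\<forall>x\<in>S. \<forall>is. norm (partials is u x) \<le> P * w (length is))"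

lemma partials_leD: "partials_le S w u P \<Longrightarrow> x \<in> S \<Longrightarrow> norm (partials is u x) \<le> P * w (length is)"
  by (simp add: partials_le_def)

text \<open>For decreasing weights this is a Frechet space of functions supported in
  \<open>K\<close>. In the Roumieu case \<open>w\<close> is constant in \<open>n\<close>, which
  leaves a Banach space.\<close>

definition test_space :: "(real^'d) set \<Rightarrow> (real^'d) set \<Rightarrow> (nat \<Rightarrow> nat \<Rightarrow> real) \<Rightarrow> (real^'d \<Rightarrow> complex) set" where
  "test_space S K w = {\<kappa>. supported_in S K \<kappa> \<and> (\<forall>n. \<exists>P. partials_le S (w n) \<kappa> P)}"

lemma partials_le_scale:
  fixes u :: "real^'d::finite \<Rightarrow> complex"
  assumes "open S" "smooth_on S u" "partials_le S w u P"
  shows "partials_le S w (\<lambda>x. c *\<^sub>R u x) (\<bar>c\<bar> * P)"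
  unfolding partials_le_def
proof (intro ballI allI)
  fix x "is" assume x: "x \<in> S"
  have "partials is (\<lambda>x. c *\<^sub>R u x) x = c *\<^sub>R partials is u x"
    by (rule partials_bounded_linear[OF assms(1) bounded_linear_scaleR_right assms(2) x])
  then show "norm (partials is (\<lambda>x. c *\<^sub>R u x) x) \<le> \<bar>c\<bar> * P * w (length is)"
    using mult_left_mono[OF partials_leD[OF assms(3) x], of "\<bar>c\<bar>"] by (simp add: mult.assoc)
qed

lemma test_space_scale:
  fixes u :: "real^'d::finite \<Rightarrow> complex"
  assumes "open S" "u \<in> test_space S K w"
  shows "(\<lambda>x. c *\<^sub>R u x) \<in> test_space S K w"
  using assms partials_le_scale[OF assms(1), of u _ _ c]
    supported_in_bounded_linear[OF assms(1) bounded_linear_scaleR_right, of K u c]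
  unfolding test_space_def supported_in_def by blast

lemma test_space_add:
  fixes u v :: "real^'d::finite \<Rightarrow> complex"
  assumes "open S" "u \<in> test_space S K w" "v \<in> test_space S K w"
  shows "(\<lambda>x. u x + v x) \<in> test_space S K w"
proof -
  have "\<exists>R. partials_le S (w n) (\<lambda>x. u x + v x) R" for n
  proof -
    obtain P Q where PQ: "partials_le S (w n) u P" "partials_le S (w n) v Q"
      using assms unfolding test_space_def by blast
    have "partials_le S (w n) (\<lambda>x. u x + v x) (P + Q)"
      unfolding partials_le_def
    proof (intro ballI allI)
      fix x "is" assume x: "x \<in> S"
      have "norm (partials is (\<lambda>x. u x + v x) x) \<le> P * w n (length is) + Q * w n (length is)"
        using assms x PQ by (subst partials_add[OF assms(1) _ _ x])
          (auto simp: test_space_def supported_in_def partials_le_def intro!: norm_triangle_mono)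
      then show "norm (partials is (\<lambda>x. u x + v x) x) \<le> (P + Q) * w n (length is)"
        by (simp add: distrib_right)
    qed
    then show ?thesis by blast
  qed
  then show ?thesis using assms by (auto simp: test_space_def intro: supported_in_add)
qed

text \<open>The form of completeness that the gliding hump needs. With respect to \<open>w n\<close>
  only the terms \<open>l < n\<close> lack a bound prescribed in advance; the later ones inherit
  \<open>(1/2) ^ l\<close> from the smaller weight \<open>w l\<close>.\<close>

lemma test_space_series:
  fixes u :: "nat \<Rightarrow> real^'d::finite \<Rightarrow> complex"
  assumes S: "open S" and w: "\<And>n m. 0 < w n m" "\<And>n n' m. n \<le> n' \<Longrightarrow> w n' m \<le> w n m"
    and u: "\<And>l. u l \<in> test_space S K w" "\<And>l. partials_le S (w l) (u l) ((1/2) ^ l)"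
  shows "(\<lambda>x. \<Sum>l. u l x) \<in> test_space S K w"
    and "x \<in> S \<Longrightarrow> summable (\<lambda>l. u l x)"
proof -
  have "\<forall>n l. \<exists>P. partials_le S (w n) (u l) P" using u(1) unfolding test_space_def by blast
  then obtain P where P: "\<And>n l. partials_le S (w n) (u l) (P n l)" by metis
  define Q where "Q n l = (if l < n then P n l else (1/2) ^ l)" for n l
  have Q: "partials_le S (w n) (u l) (Q n l)" for n l
    unfolding partials_le_def
  proof (intro ballI allI)
    fix x "is" assume x: "x \<in> S"
    show "norm (partials is (u l) x) \<le> Q n l * w n (length is)"
    proof (cases "l < n")
      case False
      have "norm (partials is (u l) x) \<le> (1/2) ^ l * w l (length is)"
        using u(2) x by (rule partials_leD)
      also have "\<dots> \<le> (1/2) ^ l * w n (length is)" using False by (intro mult_left_mono w) auto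
      finally show ?thesis using False by (simp add: Q_def)
    qed (use P x in \<open>auto simp: Q_def partials_le_def\<close>)
  qed
  have sQ: "summable (Q n)" for n
  proof (rule summable_comparison_test_ev[of "Q n" "\<lambda>l. (1/2) ^ l"])
    show "\<forall>\<^sub>F l in sequentially. norm (Q n l) \<le> (1/2) ^ l"
      unfolding eventually_sequentially by (intro exI[of _ n]) (auto simp: Q_def)
  qed (simp add: summable_geometric)
  have smooth: "smooth_on S (u l)" for l using u(1) by (auto simp: test_space_def supported_in_def)
  have sQw: "summable (\<lambda>l. Q n l * w n (length is))" for n "is" by (intro summable_mult2 sQ)
  have bnd: "norm (partials is (u l) x) \<le> Q 0 l * w 0 (length is)" if "x \<in> S" for l "is" x
    using Q that by (rule partials_leD)
  have series: "\<And>is x. x \<in> S \<Longrightarrow> (\<lambda>l. partials is (u l) x) sums partials is (\<lambda>x. \<Sum>l. u l x) x"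
    "smooth_on S (\<lambda>x. \<Sum>l. u l x)"
    by (rule partials_series_sums[OF S smooth, where b = "\<lambda>is l. Q 0 l * w 0 (length is)"]; use bnd sQw in blast)+
  have "partials_le S (w n) (\<lambda>x. \<Sum>l. u l x) (\<Sum>l. Q n l)" for n
    unfolding partials_le_def
  proof (intro ballI allI)
    fix x "is" assume x: "x \<in> S"
    have "partials is (\<lambda>x. \<Sum>l. u l x) x = (\<Sum>l. partials is (u l) x)"
      using series(1)[OF x] by (simp add: sums_iff)
    also have "norm \<dots> \<le> (\<Sum>l. Q n l * w n (length is))"
      by (rule norm_suminf_le[OF partials_leD[OF Q x] sQw])
    also have "\<dots> = (\<Sum>l. Q n l) * w n (length is)" by (rule suminf_mult2[OF sQ, symmetric])
    finally show "norm (partials is (\<lambda>x. \<Sum>l. u l x) x) \<le> (\<Sum>l. Q n l) * w n (length is)" .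
  qed
  moreover have "supported_in S K (\<lambda>x. \<Sum>l. u l x)"
    using series(2) u(1) by (auto simp: supported_in_def test_space_def)
  ultimately show "(\<lambda>x. \<Sum>l. u l x) \<in> test_space S K w" by (auto simp: test_space_def)
  show "x \<in> S \<Longrightarrow> summable (\<lambda>l. u l x)" using series(1)[of x "[]"] by (auto simp: sums_iff)
qed

text \<open>Gliding hump: if the conclusion fails, one finds \<open>u\<^sub>l\<close> and \<open>j\<^sub>l\<close> such that the pairing of \<open>g j\<^sub>l\<close> with
  \<open>u\<^sub>l\<close> dominates its pairings with the earlier terms, which are bounded in \<open>j\<close>, and with the later terms,
  which are chosen small relative to \<open>g j\<^sub>l\<close>.\<close>

lemma uniform_boundedness:
  fixes g :: "'i \<Rightarrow> real^'d::finite \<Rightarrow> complex" and c :: "'i \<Rightarrow> real"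
  assumes S: "open S" and K: "compact K" "K \<subseteq> S"
    and w: "\<And>n m. 0 < w n m" "\<And>n n' m. n \<le> n' \<Longrightarrow> w n' m \<le> w n m" "\<And>n. w n 0 = 1"
    and g: "\<And>i. i \<in> I \<Longrightarrow> continuous_on S (g i)" "\<And>i. i \<in> I \<Longrightarrow> 0 \<le> c i"
    and bounded: "\<And>\<kappa>. \<kappa> \<in> test_space S K w \<Longrightarrow> \<exists>C. \<forall>i\<in>I. c i * norm (pairing S (g i) \<kappa>) \<le> C"
  shows "\<exists>n C. \<forall>i\<in>I. \<forall>\<kappa>\<in>test_space S K w. \<forall>P\<ge>0. partials_le S (w n) \<kappa> P \<longrightarrow>
    c i * norm (pairing S (g i) \<kappa>) \<le> C * P"
proof (rule ccontr)
  let ?V = "test_space S K w"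
  define T where "T i \<kappa> = c i * norm (pairing S (g i) \<kappa>)" for i \<kappa>
  have V_supp: "supported_in S K \<kappa>" if "\<kappa> \<in> ?V" for \<kappa> using that by (simp add: test_space_def)
  have T_add: "T i (\<lambda>x. u x + v x) \<le> T i u + T i v" "T i u \<le> T i (\<lambda>x. u x + v x) + T i v"
    if i: "i \<in> I" and uv: "u \<in> ?V" "v \<in> ?V" for i u v
  proof -
    have eq: "pairing S (g i) (\<lambda>x. u x + v x) = pairing S (g i) u + pairing S (g i) v"
      by (rule pairing_add[OF K g(1)[OF i] V_supp[OF uv(1)] V_supp[OF uv(2)]])
    have "norm (pairing S (g i) u) \<le> norm (pairing S (g i) u + pairing S (g i) v) + norm (pairing S (g i) v)"
      using norm_triangle_ineq4[of "pairing S (g i) u + pairing S (g i) v" "pairing S (g i) v"] by simp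
    from mult_left_mono[OF this g(2)[OF i]] show "T i u \<le> T i (\<lambda>x. u x + v x) + T i v"
      unfolding T_def eq by (simp add: distrib_left)
    show "T i (\<lambda>x. u x + v x) \<le> T i u + T i v"
      using mult_left_mono[OF norm_triangle_ineq[of "pairing S (g i) u" "pairing S (g i) v"] g(2)[OF i]]
      unfolding T_def eq by (simp add: distrib_left)
  qed
  have T_scale: "T i (\<lambda>x. r *\<^sub>R u x) = r * T i u" if "0 \<le> r" for i r u
    using that by (simp add: T_def abs_mult)
  have "\<exists>B\<ge>1. \<forall>\<kappa> s. 0 \<le> s \<longrightarrow> \<kappa> \<in> ?V \<longrightarrow> (\<forall>x\<in>S. norm (\<kappa> x) \<le> s) \<longrightarrow> T i \<kappa> \<le> B * s" if i: "i \<in> I" for i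
  proof -
    obtain B where B: "1 \<le> B" "\<And>\<kappa> s. \<lbrakk>0 \<le> s; \<forall>x\<in>S. norm (\<kappa> x) \<le> s; \<forall>x\<in>S - K. \<kappa> x = 0\<rbrakk>
      \<Longrightarrow> norm (pairing S (g i) \<kappa>) \<le> B * s"
      using norm_pairing_le[OF K g(1)[OF i]] by blast
    have "T i \<kappa> \<le> max 1 (c i * B) * s" if "0 \<le> s" "\<kappa> \<in> ?V" "\<forall>x\<in>S. norm (\<kappa> x) \<le> s" for \<kappa> s
    proof -
      have "T i \<kappa> \<le> c i * (B * s)"
        unfolding T_def using that V_supp[OF that(2)] g(2)[OF i]
        by (intro mult_left_mono B) (auto simp: supported_in_def)
      also have "\<dots> \<le> max 1 (c i * B) * s" using that(1) by (simp flip: mult.assoc) (intro mult_right_mono; simp)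
      finally show ?thesis .
    qed
    then show ?thesis by (intro exI[of _ "max 1 (c i * B)"]) auto
  qed
  then obtain B where B: "\<And>i. i \<in> I \<Longrightarrow> 1 \<le> B i"
    "\<And>i \<kappa> s. \<lbrakk>i \<in> I; 0 \<le> s; \<kappa> \<in> ?V; \<And>x. x \<in> S \<Longrightarrow> norm (\<kappa> x) \<le> s\<rbrakk> \<Longrightarrow> T i \<kappa> \<le> B i * s"
    by metis
  \<comment> \<open>The hypothesis \<open>bounded\<close> as a function: \<open>A \<kappa>\<close>
    bounds the weighted pairings of \<open>\<kappa>\<close> for all indices.\<close>
  obtain A where A: "\<And>\<kappa> i. \<kappa> \<in> ?V \<Longrightarrow> i \<in> I \<Longrightarrow> T i \<kappa> \<le> A \<kappa>"
    using bounded unfolding T_def by metis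
  assume neg: "\<not> ?thesis"
  have hump: "\<exists>i\<in>I. \<exists>\<kappa>\<in>?V. partials_le S (w n) \<kappa> \<delta> \<and> C < T i \<kappa>" if \<delta>: "0 < \<delta>" for n \<delta> C
  proof -
    \<comment> \<open>The constant \<open>\<bar>C\<bar> / \<delta>\<close> is chosen so that
      rescaling the test function from bound \<open>P\<close> to bound \<open>\<delta>\<close>
      leaves the lower bound \<open>\<bar>C\<bar>\<close>.\<close>
    have "\<exists>i\<in>I. \<exists>\<kappa>\<in>?V. \<exists>P\<ge>0. partials_le S (w n) \<kappa> P \<and> \<bar>C\<bar> / \<delta> * P < T i \<kappa>"
      using neg unfolding T_def not_ex not_all ball_simps bex_simps by (meson not_le)
    then obtain i \<kappa> P where i: "i \<in> I" "\<kappa> \<in> ?V" "0 \<le> P" "partials_le S (w n) \<kappa> P" "\<bar>C\<bar> / \<delta> * P < T i \<kappa>"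
      by blast
    have "P \<noteq> 0"
    proof
      assume "P = 0"
      then have "norm (\<kappa> x) \<le> 0" if "x \<in> S" for x using partials_leD[OF i(4) that, of "[]"] by simp
      then have "T i \<kappa> \<le> B i * 0" using i by (intro B(2)) auto
      then show False using i(5) \<open>P = 0\<close> by simp
    qed
    then have P: "0 < P" using i(3) by simp
    let ?\<kappa> = "\<lambda>x. (\<delta> / P) *\<^sub>R \<kappa> x"
    have "?\<kappa> \<in> ?V" using i(2) by (rule test_space_scale[OF S])
    moreover have "partials_le S (w n) ?\<kappa> \<delta>"
      using partials_le_scale[OF S _ i(4), of "\<delta> / P"] V_supp[OF i(2)] P \<delta> by (simp add: supported_in_def)
    moreover have "C < T i ?\<kappa>"
    proof -
      have "\<bar>C\<bar> < \<delta> / P * T i \<kappa>" using i(5) P \<delta> by (simp add: field_simps)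
      then show ?thesis using T_scale[of "\<delta> / P" i \<kappa>] P \<delta> by simp
    qed
    ultimately show ?thesis using i(1) by blast
  qed
  \<comment> \<open>A state consists of the sum \<open>U\<close> of the humps so far, a number
    \<open>\<beta>\<close> above the constants \<open>B\<close> of all indices used so far, and the
    last hump with its index. The last two are meaningless in the initial state.\<close>
  define ok where "ok n s \<longleftrightarrow> fst s \<in> ?V \<and> 1 \<le> fst (snd s) \<and> (n = 0 \<longrightarrow> fst s = (\<lambda>x. 0))" for n :: nat and s :: "(real^'d \<Rightarrow> complex) \<times> real \<times> (real^'d \<Rightarrow> complex) \<times> 'i"
  \<comment> \<open>Division by \<open>\<beta>\<close> makes the new hump small relative to every
    earlier index; its own pairing exceeds the bound \<open>A U\<close> for the earlier sum by more
    than \<open>n + 1\<close>.\<close>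
  define next_ok where "next_ok n s s' \<longleftrightarrow> (case s of (U, \<beta>, _, _) \<Rightarrow> case s' of (U', \<beta>', \<kappa>, i) \<Rightarrow>
      i \<in> I \<and> \<kappa> \<in> ?V \<and> partials_le S (w n) \<kappa> ((1/2) ^ n / \<beta>) \<and> real n + 1 + A U < T i \<kappa> \<and>
      U' = (\<lambda>x. U x + \<kappa> x) \<and> \<beta>' = max \<beta> (B i))" for n and s s' :: "(real^'d \<Rightarrow> complex) \<times> real \<times> (real^'d \<Rightarrow> complex) \<times> 'i"
  have zero_V: "(\<lambda>x. 0) \<in> ?V"
    by (auto simp: test_space_def supported_in_def smooth_on_zero partials_le_def partials_zero intro!: exI[of _ 0])
  have "\<exists>f. \<forall>n. ok n (f n) \<and> next_ok n (f n) (f (Suc n))"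
  proof (rule dependent_nat_choice)
    show "\<exists>s. ok 0 s" using zero_V by (auto simp: ok_def intro!: exI[of _ "(\<lambda>x. 0, 1, undefined)"])
    fix s n assume s: "ok n s"
    obtain U \<beta> \<kappa>0 i0 where s_eq: "s = (U, \<beta>, \<kappa>0, i0)" by (cases s)
    have U: "U \<in> ?V" "1 \<le> \<beta>" using s by (auto simp: ok_def s_eq)
    obtain i \<kappa> where i: "i \<in> I" "\<kappa> \<in> ?V" "partials_le S (w n) \<kappa> ((1/2) ^ n / \<beta>)" "real n + 1 + A U < T i \<kappa>"
      using hump[of "(1/2) ^ n / \<beta>" n "real n + 1 + A U"] U(2) by auto
    have "ok (Suc n) ((\<lambda>x. U x + \<kappa> x), max \<beta> (B i), \<kappa>, i)"
      using U i test_space_add[OF S U(1) i(2)] by (auto simp: ok_def)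
    moreover have "next_ok n s ((\<lambda>x. U x + \<kappa> x), max \<beta> (B i), \<kappa>, i)" using i by (simp add: next_ok_def s_eq)
    ultimately show "\<exists>s'. ok (Suc n) s' \<and> next_ok n s s'" by blast
  qed
  then obtain f where f: "\<And>n. ok n (f n)" "\<And>n. next_ok n (f n) (f (Suc n))" by blast
  define U where "U n = fst (f n)" for n
  define \<beta> where "\<beta> n = fst (snd (f n))" for n
  define \<kappa> where "\<kappa> n = fst (snd (snd (f (Suc n))))" for n
  define j where "j n = snd (snd (snd (f (Suc n))))" for n
  have U: "U n \<in> ?V" "1 \<le> \<beta> n" for n using f(1)[of n] by (auto simp: ok_def U_def \<beta>_def)
  have j: "j n \<in> I" "\<kappa> n \<in> ?V" "partials_le S (w n) (\<kappa> n) ((1/2) ^ n / \<beta> n)"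
    "real n + 1 + A (U n) < T (j n) (\<kappa> n)" "U (Suc n) = (\<lambda>x. U n x + \<kappa> n x)" "\<beta> (Suc n) = max (\<beta> n) (B (j n))" for n
    using f(2)[of n] by (auto simp: next_ok_def U_def \<beta>_def \<kappa>_def j_def split: prod.splits)
  have \<beta>_mono: "\<beta> n \<le> \<beta> m" if "n \<le> m" for n m
    by (rule lift_Suc_mono_le[of \<beta>]) (use j(6) that in auto)
  have small: "partials_le S (w l) (\<kappa> l) ((1/2) ^ l)" for l
    unfolding partials_le_def
  proof (intro ballI allI)
    fix x "is" assume x: "x \<in> S"
    have "norm (partials is (\<kappa> l) x) \<le> ((1/2) ^ l / \<beta> l) * w l (length is)" using j(3) x by (rule partials_leD)
    also have "\<dots> \<le> (1/2) ^ l * w l (length is)"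
      using U(2)[of l] w(1)[of l "length is"] by (intro mult_right_mono) (auto simp: divide_le_eq)
    finally show "norm (partials is (\<kappa> l) x) \<le> (1/2) ^ l * w l (length is)" .
  qed
  define \<sigma> where "\<sigma> x = (\<Sum>l. \<kappa> l x)" for x
  have \<sigma>: "\<sigma> \<in> ?V" "\<And>x. x \<in> S \<Longrightarrow> summable (\<lambda>l. \<kappa> l x)"
    using test_space_series[where u = \<kappa>, OF S w(1,2) j(2) small] unfolding \<sigma>_def by blast+
  have "real n \<le> A \<sigma>" for n
  proof -
    \<comment> \<open>\<open>R\<close> is the sum of the humps after the n-th. They were chosen
      after \<open>B (j n)\<close> had entered \<open>\<beta>\<close>, so their weighted pairing at
      index \<open>j n\<close> is at most 1.\<close>
    define R where "R x = \<sigma> x + (-1) *\<^sub>R U (Suc n) x" for x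
    have U_sum: "U m x = (\<Sum>l<m. \<kappa> l x)" for m x
    proof (induction m)
      case 0
      then show ?case using f(1)[of 0] by (simp add: ok_def U_def)
    qed (simp add: j(5))
    have B1: "1 \<le> B (j n)" using B(1) j(1) by blast
    have R_V: "R \<in> ?V" unfolding R_def by (intro test_space_add test_space_scale S \<sigma>(1) U(1))
    have R_le: "norm (R x) \<le> (1/2) ^ n / B (j n)" if x: "x \<in> S" for x
    proof -
      have "R x = (\<Sum>l. \<kappa> (l + Suc n) x)"
        unfolding R_def \<sigma>_def U_sum using suminf_minus_initial_segment[OF \<sigma>(2)[OF x], of "Suc n"] by simp
      also have "norm \<dots> \<le> (\<Sum>l. (1/2) ^ l * ((1/2) ^ Suc n / B (j n)))"
      proof (rule norm_suminf_le)
        fix l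
        have "norm (\<kappa> (l + Suc n) x) \<le> (1/2) ^ (l + Suc n) / \<beta> (l + Suc n)"
          using partials_leD[OF j(3)[of "l + Suc n"] x, of "[]"] by (simp add: w(3))
        also have "\<dots> \<le> (1/2) ^ (l + Suc n) / B (j n)"
        proof (rule divide_left_mono)
          show "B (j n) \<le> \<beta> (l + Suc n)" using \<beta>_mono[of "Suc n" "l + Suc n"] j(6)[of n] by simp
          show "0 < \<beta> (l + Suc n) * B (j n)" using B1 U(2)[of "l + Suc n"] by simp
        qed simp
        finally show "norm (\<kappa> (l + Suc n) x) \<le> (1/2) ^ l * ((1/2) ^ Suc n / B (j n))"
          by (simp add: power_add)
      qed (intro summable_mult2 summable_geometric, simp)
      also have "\<dots> = (\<Sum>l. (1/2) ^ l) * ((1/2) ^ Suc n / B (j n))"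
        by (rule suminf_mult2[symmetric]) (simp add: summable_geometric)
      also have "\<dots> = (1/2) ^ n / B (j n)" by (subst suminf_geometric) auto
      finally show ?thesis .
    qed
    have "T (j n) R \<le> B (j n) * ((1/2) ^ n / B (j n))"
      by (rule B(2)[OF j(1) _ R_V R_le]) (use B1 in auto)
    also have "\<dots> \<le> 1" using B1 by (simp add: power_le_one)
    finally have TR: "T (j n) R \<le> 1" .
    \<comment> \<open>Writing \<open>\<sigma>\<close> as hump plus \<open>U n\<close> plus
      \<open>R\<close>, the hump exceeds what the other two can cancel by more than
      \<open>n\<close>, which forces \<open>A \<sigma>\<close> above \<open>n\<close>.\<close>
    have "T (j n) (\<kappa> n) \<le> T (j n) (\<lambda>x. \<kappa> n x + (U n x + R x)) + T (j n) (\<lambda>x. U n x + R x)"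
      by (intro T_add(2) j test_space_add S U R_V)
    also have "(\<lambda>x. \<kappa> n x + (U n x + R x)) = \<sigma>" by (simp add: fun_eq_iff R_def j(5))
    also have "T (j n) (\<lambda>x. U n x + R x) \<le> T (j n) (U n) + T (j n) R"
      by (intro T_add(1) j U R_V)
    finally show ?thesis
      using j(4)[of n] TR A[OF U(1)[of n] j(1)[of n]] A[OF \<sigma>(1) j(1)[of n]] by simp
  qed
  then show False using reals_Archimedean2 by (meson not_le)
qed

section \<open>From the pairings to the supremum\<close>

text \<open>If \<open>v\<close> is Lipschitz with constant \<open>L\<close>, then \<open>\<bar>v\<bar> \<ge> \<bar>v y\<bar> / 2\<close> on the ball of radius \<open>\<bar>v y\<bar> / (2 L)\<close>
  about \<open>y\<close>, which bounds the weighted \<open>L\<^sup>2\<close> norm of \<open>v\<close> from below.\<close>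

lemma norm_power_le_weighted_L2:
  fixes v :: "real^'d::finite \<Rightarrow> complex" and \<theta> :: "real^'d \<Rightarrow> real"
  assumes K: "compact K" "K \<subseteq> S" and v: "continuous_on S v"
    and psi: "supported_in S K (\<lambda>x. cnj (v x) * complex_of_real (\<theta> x))"
    and \<theta>: "\<And>x. 0 \<le> \<theta> x" "\<And>x. norm (x - y) \<le> \<rho> \<Longrightarrow> \<delta> \<le> \<theta> x" "0 < \<delta>"
    and ball: "cball y \<rho> \<subseteq> S"
    and Lip: "\<And>x. x \<in> cball y \<rho> \<Longrightarrow> norm (v x - v y) \<le> L * norm (x - y)" "0 < L" "norm (v y) \<le> 2 * L * \<rho>"
  shows "norm (v y) ^ (CARD('d) + 2)
    \<le> 4 * 2 ^ CARD('d) / (\<delta> * unit_ball_vol CARD('d)) * L ^ CARD('d) *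
      norm (pairing S v (\<lambda>x. cnj (v x) * complex_of_real (\<theta> x)))"
proof -
  let ?d = "CARD('d)"
  define t where "t = norm (v y)"
  define s where "s = t / (2 * L)"
  define p where "p x = (norm (v x))\<^sup>2 * \<theta> x" for x
  have s: "0 \<le> s" "s \<le> \<rho>" using Lip(2,3) by (simp_all add: s_def t_def divide_le_eq mult_ac)
  have p0: "0 \<le> p x" for x by (simp add: p_def \<theta>)
  have eq: "v x * (cnj (v x) * complex_of_real (\<theta> x)) = complex_of_real (p x)" for x
    by (simp only: p_def of_real_mult complex_norm_square mult.assoc)
  have int: "integrable lborel (\<lambda>x. indicator S x * p x)"
    using set_integrable_pairing[OF K v psi]
    unfolding eq set_integrable_def scaleR_conv_of_real of_real_mult[symmetric] complex_of_real_integrable_eq .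
  have pair: "pairing S v (\<lambda>x. cnj (v x) * complex_of_real (\<theta> x)) = of_real (LINT x|lborel. indicator S x * p x)"
    unfolding eq set_lebesgue_integral_def scaleR_conv_of_real of_real_mult[symmetric] integral_complex_of_real ..
  have fin: "emeasure lborel (cball y s) < \<infinity>" using emeasure_bounded_finite[of "cball y s"] by simp
  have intb: "integrable lborel (indicator (cball y s) :: _ \<Rightarrow> real)" by (rule integrable_real_indicator) (use fin in auto)
  have "(t / 2)\<^sup>2 * \<delta> * (unit_ball_vol ?d * s ^ ?d) = (LINT x|lborel. ((t / 2)\<^sup>2 * \<delta>) * indicator (cball y s) x)"
    using content_cball[OF s(1), of y] by simp
  also have "\<dots> \<le> (LINT x|lborel. indicator S x * p x)"
  proof (rule integral_mono)
    fix x
    show "((t / 2)\<^sup>2 * \<delta>) * indicator (cball y s) x \<le> indicator S x * p x"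
    proof (cases "x \<in> cball y s")
      case True
      then have x: "norm (x - y) \<le> s" by (simp add: dist_norm norm_minus_commute)
      then have xb: "x \<in> cball y \<rho>" using s(2) by (simp add: dist_norm norm_minus_commute)
      have "norm (v x - v y) \<le> L * norm (x - y)" by (rule Lip(1)[OF xb])
      also have "\<dots> \<le> L * s" using x Lip(2) by (intro mult_left_mono) auto
      also have "\<dots> = t / 2" using Lip(2) by (simp add: s_def)
      finally have "t / 2 \<le> norm (v x)"
        using norm_triangle_ineq2[of "v y" "v x"] by (simp add: t_def norm_minus_commute)
      then have "(t / 2)\<^sup>2 * \<delta> \<le> (norm (v x))\<^sup>2 * \<theta> x"
        using x s(2) \<theta> by (intro mult_mono power_mono) (auto simp: t_def)
      then show ?thesis using True xb ball by (auto simp: p_def)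
    qed (use p0 in auto)
  qed (use int intb in auto)
  finally have 1: "(t / 2)\<^sup>2 * \<delta> * (unit_ball_vol ?d * s ^ ?d) \<le> norm (pairing S v (\<lambda>x. cnj (v x) * complex_of_real (\<theta> x)))"
    unfolding pair using p0 by (simp add: integral_nonneg_AE)
  \<comment> \<open>With \<open>s = t / (2 * L)\<close> the square of \<open>t\<close> and the
    volume factor \<open>s ^ ?d\<close> combine; this is the origin of the exponent d + 2 and of
    \<open>L ^ ?d\<close>.\<close>
  have 2: "(t / 2)\<^sup>2 * \<delta> * (unit_ball_vol ?d * s ^ ?d)
      = t ^ (?d + 2) * (\<delta> * unit_ball_vol ?d) / (4 * 2 ^ ?d * L ^ ?d)"
    by (simp add: s_def power_divide power_mult_distrib power_add power2_eq_square, simp add: mult_ac)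
  have 3: "T \<le> e / c * Y" if "T * c / e \<le> Y" "0 < c" "0 < e" for T c e Y :: real
    using that by (simp add: field_simps)
  have "0 < \<delta> * unit_ball_vol ?d" "0 < 4 * 2 ^ ?d * L ^ ?d" using \<theta>(3) Lip(2) by simp_all
  from 3[OF 1[unfolded 2] this] show ?thesis by (simp only: t_def times_divide_eq_left)
qed

lemma norm_diff_le_partials:
  fixes v :: "real^'d::finite \<Rightarrow> complex"
  assumes "convex K" "K \<subseteq> S" "smooth_on S v" "\<And>x i. x \<in> K \<Longrightarrow> norm (partial i v x) \<le> b"
    and "x \<in> K" "y \<in> K"
  shows "norm (v x - v y) \<le> real CARD('d) * b * norm (x - y)"
proof (rule differentiable_bound[of K v "\<lambda>x h. \<Sum>j\<in>UNIV. h $ j *\<^sub>R partial j v x"])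
  show "(v has_derivative (\<lambda>h. \<Sum>j\<in>UNIV. h $ j *\<^sub>R partial j v x)) (at x within K)" if "x \<in> K" for x
    by (rule has_derivative_at_withinI, rule has_derivative_partial, rule smooth_on_diff[OF assms(3)])
      (use that assms(2) in blast)
  show "onorm (\<lambda>h. \<Sum>j\<in>UNIV. h $ j *\<^sub>R partial j v x) \<le> real CARD('d) * b" if "x \<in> K" for x
  proof (rule onorm_le)
    fix h
    show "norm (\<Sum>j\<in>UNIV. h $ j *\<^sub>R partial j v x) \<le> real CARD('d) * b * norm h"
      using norm_sum_scaleR_le[of "\<lambda>j. partial j v x" "\<lambda>_. b" h] assms(4)[OF that] by simp
  qed
qed (use assms in auto)

context weight
begin

text \<open>The dual test function carries \<open>n\<close> derivatives inside and \<open>n\<close>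
  outside a product, and \<open>m\<close> more when its seminorm is taken. (M.2), used twice,
  separates the three groups.\<close>

lemma M_add_double_le: "M (m + 2 * n) \<le> c0\<^sup>2 * H ^ (m + 4 * n) * (M m * (M n)\<^sup>2)"
proof -
  have "M (m + 2 * n) \<le> c0 * H ^ (m + 2 * n) * (M m * M (n + n))" using M2[of m "2 * n"] by (simp add: mult_2)
  also have "\<dots> \<le> c0 * H ^ (m + 2 * n) * (M m * (c0 * H ^ (n + n) * (M n * M n)))"
    using c0 H by (intro mult_left_mono M2) auto
  also have "\<dots> = c0\<^sup>2 * (H ^ (m + 2 * n) * H ^ (n + n)) * (M m * (M n)\<^sup>2)"
    by (simp add: power2_eq_square mult_ac)
  also have "H ^ (m + 2 * n) * H ^ (n + n) = H ^ (m + 4 * n)"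
    unfolding power_add[symmetric] by (rule arg_cong[of _ _ "(^) H"]) simp
  finally show ?thesis .
qed

text \<open>The bound separates \<open>M m\<close>, the weight of the seminorm, from
  \<open>(M n)\<^sup>2\<close>, which later balances the square in the weighted L^2 norm. The
  constants \<open>a\<close> and \<open>b\<close> add up by the product rule, and (M.2) contributes
  the powers of \<open>H\<close>.\<close>

lemma dual_test_function_bound:
  fixes u \<theta> :: "real^'d::finite \<Rightarrow> complex" and js :: "'d list"
  assumes S: "open S" "closed K" "smooth_on S u" and \<theta>: "supported_in S K \<theta>"
    and u: "partials_le K (\<lambda>m. a ^ m * M m) u A" and \<theta>_le: "partials_le K (\<lambda>m. b ^ m * M m) \<theta> B"
    and pos: "0 \<le> a" "0 \<le> b" "0 \<le> A" "0 \<le> B"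
  defines "n \<equiv> length js" and "\<kappa> \<equiv> partials (rev js) (\<lambda>x. cnj (partials js u x) * \<theta> x)"
  shows "supported_in S K \<kappa>"
    and "partials_le S (\<lambda>m. (H * (a + b)) ^ m * M m) \<kappa> (c0\<^sup>2 * A * B * (H\<^sup>2 * (a + b)) ^ (2 * n) * (M n)\<^sup>2)"
      (is "partials_le S ?w \<kappa> ?P")
proof -
  have smooth: "smooth_on S (\<lambda>x. cnj (partials js u x))"
    by (intro smooth_on_bounded_linear[OF S(1) bounded_linear_cnj] smooth_on_partials S(3))
  have supp: "supported_in S K (\<lambda>x. cnj (partials js u x) * \<theta> x)"
    by (intro supported_in_mult S smooth \<theta>)
  then show \<kappa>: "supported_in S K \<kappa>" unfolding \<kappa>_def by (intro supported_in_partials S)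
  have P0: "0 \<le> ?P" using pos by simp
  show "partials_le S ?w \<kappa> ?P"
    unfolding partials_le_def
  proof (intro ballI allI)
    fix x "is" assume x: "x \<in> S"
    show "norm (partials is \<kappa> x) \<le> ?P * ?w (length is)"
    proof (cases "x \<in> K")
      case False
      then have "partials is \<kappa> x = 0" using supported_in_partials_eq_0[OF S(1,2) \<kappa>] x by simp
      moreover have "0 \<le> ?w (length is)" using pos H by simp
      ultimately show ?thesis using P0 by simp
    next
      case True
      define m where "m = length is"
      have "norm (partials (is @ rev js) (\<lambda>x. cnj (partials js u x) * \<theta> x) x)
          \<le> (A * B * a ^ n) * (a + b) ^ length (is @ rev js) * M (length (is @ rev js) + n)"
      \<comment> \<open>The product estimate is used with the shifted sequence
        \<open>\<lambda>l. M (l + n)\<close>, since the first factor has already been differentiated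
        \<open>n\<close> times.\<close>
      proof (rule norm_partials_mult_le[OF S(1) smooth _ x])
        show "smooth_on S \<theta>" using \<theta> by (simp add: supported_in_def)
        fix ks ls :: "'d list"
        have "partials ks (\<lambda>x. cnj (partials js u x)) x = cnj (partials (ks @ js) u x)"
          unfolding partials_append
          by (rule partials_bounded_linear[OF S(1) bounded_linear_cnj smooth_on_partials[OF S(3)] x])
        then have "norm (partials ks (\<lambda>x. cnj (partials js u x)) x) \<le> A * (a ^ (length ks + n) * M (length ks + n))"
          using partials_leD[OF u True, of "ks @ js"] by (simp add: n_def)
        then have "norm (partials ks (\<lambda>x. cnj (partials js u x)) x) * norm (partials ls \<theta> x)
            \<le> (A * (a ^ (length ks + n) * M (length ks + n))) * (B * (b ^ length ls * M (length ls)))"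
          using pos by (intro mult_mono partials_leD[OF \<theta>_le True]) auto
        also have "\<dots> = A * B * a ^ n * a ^ length ks * b ^ length ls * (M (length ks + n) * M (length ls))"
          by (simp add: power_add mult_ac)
        also have "\<dots> \<le> A * B * a ^ n * a ^ length ks * b ^ length ls * M (length ks + n + length ls)"
          using pos by (intro mult_left_mono M_mult_le) auto
        finally show "norm (partials ks (\<lambda>x. cnj (partials js u x)) x) * norm (partials ls \<theta> x)
            \<le> A * B * a ^ n * a ^ length ks * b ^ length ls * M (length ks + length ls + n)"
          by (simp add: add_ac)
      qed
      also have "\<dots> = (A * B * a ^ n) * (a + b) ^ (m + n) * M (m + 2 * n)"
        by (simp add: m_def n_def mult_2 add_ac)
      also have "\<dots> \<le> (A * B * (a + b) ^ n) * (a + b) ^ (m + n) * (c0\<^sup>2 * H ^ (m + 4 * n) * (M m * (M n)\<^sup>2))"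
        using pos by (intro mult_mono M_add_double_le mult_left_mono power_mono) auto
      also have "\<dots> = (c0\<^sup>2 * A * B * (M n)\<^sup>2 * M m) * ((a + b) ^ n * (a + b) ^ (m + n) * H ^ (m + 4 * n))"
        by (simp add: mult_ac)
      also have "(a + b) ^ n * (a + b) ^ (m + n) * H ^ (m + 4 * n) = (H\<^sup>2 * (a + b)) ^ (2 * n) * (H * (a + b)) ^ m"
      proof -
        have e: "4 * n = n + n + (n + n)" "2 * n = n + n" by simp_all
        show ?thesis unfolding power_mult_distrib power2_eq_square e power_add by (simp only: mult_ac)
      qed
      finally show ?thesis by (simp add: partials_append m_def \<kappa>_def mult_ac)
    qed
  qed
qed

text \<open>\<open>C2\<close> precedes \<open>u\<close>, \<open>E0\<close>, \<open>G\<close>,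
  \<open>js\<close> and \<open>y\<close>, which stand for the net at \<epsilon>, its growth rate,
  the decay rate of the pairings, the derivative and the point. The constants \<open>a'\<close>,
  \<open>b'\<close> for each \<open>n\<close> place the test function in \<open>test_space\<close>;
  its size is governed by the fixed pair \<open>a\<close>, \<open>b\<close>. The Lipschitz constant
  \<open>L\<close> and the bound \<open>P\<close> are both proportional to \<open>E0\<close>, whence
  \<open>E0 ^ (d + 1)\<close>.\<close>

lemma local_decay:
  fixes x0 :: "real^'d::finite"
  assumes S: "open S" and r: "0 < r" "cball x0 (2 * r) \<subseteq> S"
    and ab: "0 < a" "0 < b" and A0: "0 \<le> A0" and C: "0 \<le> C"
  defines "d \<equiv> CARD('d)" and "h \<equiv> H\<^sup>2 * (a + b)"
  shows "\<exists>C2\<ge>0. \<forall>u E0 G js. \<forall>y\<in>cball x0 r. smooth_on S u \<longrightarrow> 1 \<le> E0 \<longrightarrow> 0 < G \<longrightarrow>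
    partials_le (cball x0 (2 * r)) (\<lambda>m. a ^ m * M m) u (A0 * E0) \<longrightarrow>
    (\<forall>n. \<exists>a'>0. \<exists>b'>0. \<exists>A. (\<forall>m. (H * (a' + b')) ^ m * M m \<le> w n m) \<and>
      partials_le (cball x0 (2 * r)) (\<lambda>m. a' ^ m * M m) u A) \<longrightarrow>
    (\<forall>\<kappa>\<in>test_space S (cball x0 (2 * r)) w. \<forall>P\<ge>0.
      partials_le S (\<lambda>m. (H * (a + b)) ^ m * M m) \<kappa> P \<longrightarrow> norm (pairing S u \<kappa>) \<le> C * P / G) \<longrightarrow>
    norm (partials js u y) ^ (d + 2) \<le> C2 * (h ^ length js * M (length js)) ^ (d + 2) * (E0 ^ (d + 1) / G)"
proof -
  let ?K = "cball x0 (2 * r)"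
  have d: "0 < d" by (simp add: d_def)
  \<comment> \<open>A cube of half side \<open>r / d\<close> lies in the ball of radius
    \<open>r\<close>, by comparison with the l1 norm.\<close>
  define \<rho> where "\<rho> = r / d"
  have \<rho>: "0 < \<rho>" using r d by (simp add: \<rho>_def)
  obtain \<theta> :: "real^'d \<Rightarrow> real^'d \<Rightarrow> real" and \<delta> where \<theta>:
    "\<And>y S. smooth_on S (\<lambda>x. complex_of_real (\<theta> y x))" "\<And>y x. 0 \<le> \<theta> y x"
    "\<And>y x i. \<rho> \<le> \<bar>x $ i - y $ i\<bar> \<Longrightarrow> \<theta> y x = 0"
    "0 < \<delta>" "\<And>y x. (\<And>i. \<bar>x $ i - y $ i\<bar> \<le> \<rho> / 2) \<Longrightarrow> \<delta> \<le> \<theta> y x"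
    "\<And>h. 0 < h \<Longrightarrow> \<exists>C\<ge>1. \<forall>y x is.
       norm (partials is (\<lambda>x. complex_of_real (\<theta> y x)) x) \<le> C * h ^ length is * M (length is)"
    using bump_functions[OF \<rho>] by blast
  have \<theta>_le: "\<exists>B\<ge>1. \<forall>y. partials_le ?K (\<lambda>m. b ^ m * M m) (\<lambda>x. complex_of_real (\<theta> y x)) B" if b: "0 < b" for b
  proof -
    obtain B where "1 \<le> B" "\<And>y x is.
       norm (partials is (\<lambda>x. complex_of_real (\<theta> y x)) x) \<le> B * b ^ length is * M (length is)"
      using \<theta>(6)[OF b] by blast
    then show ?thesis by (intro exI[of _ B]) (auto simp: partials_le_def mult.assoc)
  qed
  obtain B where B: "1 \<le> B" "\<And>y. partials_le ?K (\<lambda>m. b ^ m * M m) (\<lambda>x. complex_of_real (\<theta> y x)) B"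
    using \<theta>_le[OF ab(2)] by blast
  have \<theta>_0: "\<theta> y x = 0" if "r < norm (x - y)" for x y
  proof -
    have "\<exists>i. \<rho> \<le> \<bar>x $ i - y $ i\<bar>"
    proof (rule ccontr)
      assume "\<not> ?thesis"
      then have "\<bar>(x - y) $ i\<bar> \<le> \<rho>" for i by (simp add: not_le less_imp_le)
      then have "(\<Sum>i\<in>UNIV. \<bar>(x - y) $ i\<bar>) \<le> (\<Sum>i\<in>(UNIV :: 'd set). \<rho>)" by (intro sum_mono)
      also have "\<dots> = r" using d by (simp add: \<rho>_def d_def)
      finally show False using norm_le_l1_cart[of "x - y"] that by linarith
    qed
    then show ?thesis using \<theta>(3) by blast
  qed
  have sub: "cball y r \<subseteq> ?K" if "y \<in> cball x0 r" for y
  proof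
    fix x assume "x \<in> cball y r"
    then show "x \<in> ?K" using that dist_triangle[of x0 x y] by simp
  qed
  have supp: "supported_in S ?K (\<lambda>x. complex_of_real (\<theta> y x))" if "y \<in> cball x0 r" for y
    unfolding supported_in_def
  proof (intro conjI \<theta> ballI)
    fix x assume "x \<in> S - ?K"
    then have "x \<notin> cball y r" using sub[OF that] by blast
    then show "complex_of_real (\<theta> y x) = 0" using \<theta>_0[of x y] by (simp add: dist_norm norm_minus_commute)
  qed
  \<comment> \<open>Up to the factor \<open>E0 * (h ^ n * M n)\<close>, the first summand is a
    Lipschitz constant of the derivative \<open>v\<close>; the second ensures
    \<open>norm (v y) \<le> 2 * L * (\<rho> / 2)\<close>, the third positivity.\<close>
  define L0 where "L0 = real d * A0 * (c0 * H * a * M 1) + A0 / \<rho> + 1"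
  have "0 \<le> c0 * H * a * M 1" using c0 H ab by simp
  then have L0: "0 < L0" "real d * A0 * (c0 * H * a * M 1) \<le> L0" "A0 / \<rho> \<le> L0"
    using A0 \<rho> by (auto simp: L0_def add_nonneg_pos)
  define C1 where "C1 = 4 * 2 ^ d / (\<delta> * unit_ball_vol d)"
  have C1: "0 \<le> C1" using \<theta>(4) by (simp add: C1_def)
  have ah: "a * H \<le> h" "a \<le> h" "0 < h"
  proof -
    have "a \<le> a * H" using ab H by simp
    moreover have "a * H \<le> (a + b) * (H * H)"
      using ab H by (intro mult_mono) (auto simp: mult_le_cancel_left1)
    moreover have "h = (a + b) * (H * H)" by (simp add: h_def power2_eq_square mult_ac)
    ultimately show "a * H \<le> h" "a \<le> h" "0 < h" using ab by linarith+
  qed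
  show ?thesis
  proof (intro exI[of _ "C1 * L0 ^ d * (C * c0\<^sup>2 * A0 * B)"] conjI allI ballI impI)
    show "0 \<le> C1 * L0 ^ d * (C * c0\<^sup>2 * A0 * B)" using C1 L0 C A0 B by simp
    fix u E0 G y and js :: "'d list"
    assume y: "y \<in> cball x0 r" and u: "smooth_on S u" and E0: "1 \<le> E0" and G: "0 < G"
      and reg: "partials_le ?K (\<lambda>m. a ^ m * M m) u (A0 * E0)"
      and all: "\<forall>n. \<exists>a'>0. \<exists>b'>0. \<exists>A. (\<forall>m. (H * (a' + b')) ^ m * M m \<le> w n m) \<and> partials_le ?K (\<lambda>m. a' ^ m * M m) u A"
      and dual: "\<forall>\<kappa>\<in>test_space S ?K w. \<forall>P\<ge>0.
        partials_le S (\<lambda>m. (H * (a + b)) ^ m * M m) \<kappa> P \<longrightarrow> norm (pairing S u \<kappa>) \<le> C * P / G"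
    define n where "n = length js"
    define v where "v = partials js u"
    define \<psi> where "\<psi> x = cnj (v x) * complex_of_real (\<theta> y x)" for x
    define P where "P = c0\<^sup>2 * (A0 * E0) * B * h ^ (2 * n) * (M n)\<^sup>2"
    have v: "smooth_on S v" unfolding v_def by (rule smooth_on_partials[OF u])
    have yK: "y \<in> ?K" using y r by simp
    have \<psi>: "supported_in S ?K \<psi>"
      unfolding \<psi>_def
      by (intro supported_in_mult S supp[OF y] smooth_on_bounded_linear[OF S bounded_linear_cnj] v)
    \<comment> \<open>Each weight \<open>w k\<close> is checked with its own \<open>a'\<close> and
      \<open>b'\<close>; this is possible because the bump functions obey geometric bounds with
      every constant.\<close>
    have \<kappa>_V: "partials (rev js) \<psi> \<in> test_space S ?K w"
      unfolding test_space_def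
    proof (intro CollectI conjI allI)
      show "supported_in S ?K (partials (rev js) \<psi>)" by (intro supported_in_partials S \<psi>) simp
      fix k
      obtain a' b' A where a': "0 < a'" "0 < b'" "\<And>m. (H * (a' + b')) ^ m * M m \<le> w k m"
        "partials_le ?K (\<lambda>m. a' ^ m * M m) u A" using all by blast
      have A: "0 \<le> A"
      proof -
        have "norm (u y) \<le> A" using partials_leD[OF a'(4) yK, of "[]"] by simp
        then show ?thesis using norm_ge_zero[of "u y"] by linarith
      qed
      obtain B' where B': "1 \<le> B'" "partials_le ?K (\<lambda>m. b' ^ m * M m) (\<lambda>x. complex_of_real (\<theta> y x)) B'"
        using \<theta>_le[OF a'(2)] by blast
      let ?P = "c0\<^sup>2 * A * B' * (H\<^sup>2 * (a' + b')) ^ (2 * length js) * (M (length js))\<^sup>2"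
      have "partials_le S (\<lambda>m. (H * (a' + b')) ^ m * M m) (partials (rev js) \<psi>) ?P"
        unfolding \<psi>_def v_def
        by (rule dual_test_function_bound(2)[OF S _ u supp[OF y] a'(4) B'(2)]) (use a' A B' in auto)
      moreover have "0 \<le> ?P" using A B'(1) a' by simp
      ultimately have "partials_le S (w k) (partials (rev js) \<psi>) ?P"
        unfolding partials_le_def by (meson a'(3) mult_left_mono order_trans)
      then show "\<exists>P. partials_le S (w k) (partials (rev js) \<psi>) P" by blast
    qed
    have "partials_le S (\<lambda>m. (H * (a + b)) ^ m * M m) (partials (rev js) \<psi>) P"
      unfolding \<psi>_def v_def P_def h_def n_def
      by (rule dual_test_function_bound(2)[OF S _ u supp[OF y] reg B(2)]) (use ab A0 E0 B in auto)
    moreover have "0 \<le> P" using A0 E0 B ah by (simp add: P_def)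
    ultimately have "norm (pairing S u (partials (rev js) \<psi>)) \<le> C * P / G" using dual \<kappa>_V by blast
    moreover have "norm (pairing S v \<psi>) = norm (pairing S u (partials (rev js) \<psi>))"
      unfolding v_def by (rule norm_pairing_partials[OF S compact_cball r(2) u \<psi>])
    ultimately have pair: "norm (pairing S v \<psi>) \<le> C * P / G" by simp
    define L where "L = L0 * E0 * (h ^ n * M n)"
    have hM: "0 < h ^ n * M n" using ah by simp
    have L: "0 < L" using L0 E0 hM by (simp add: L_def)
    have Lip: "norm (v x - v y) \<le> L * norm (x - y)" if "x \<in> ?K" for x
    proof -
      have "norm (partial i v z) \<le> A0 * E0 * (c0 * H * a * M 1) * (h ^ n * M n)" if "z \<in> ?K" for z i
      proof -
        have "norm (partial i v z) \<le> A0 * E0 * (a ^ Suc n * M (n + 1))"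
          using partials_leD[OF reg that, of "i # js"] by (simp add: v_def partials_Cons n_def)
        also have "\<dots> \<le> A0 * E0 * (a ^ Suc n * (c0 * H ^ (n + 1) * (M n * M 1)))"
          using A0 E0 ab by (intro mult_left_mono M2) auto
        also have "\<dots> = A0 * E0 * (c0 * H * a * M 1) * ((a * H) ^ n * M n)"
          by (simp add: power_mult_distrib mult_ac)
        also have "\<dots> \<le> A0 * E0 * (c0 * H * a * M 1) * (h ^ n * M n)"
          using A0 E0 ab c0 H ah by (intro mult_left_mono mult_right_mono power_mono) auto
        finally show ?thesis .
      qed
      then have "norm (v x - v y) \<le> real CARD('d) * (A0 * E0 * (c0 * H * a * M 1) * (h ^ n * M n)) * norm (x - y)"
        by (intro norm_diff_le_partials[OF _ r(2) v _ that yK]) auto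
      also have "\<dots> = (real d * A0 * (c0 * H * a * M 1)) * (E0 * (h ^ n * M n) * norm (x - y))"
        by (simp add: d_def mult_ac)
      also have "\<dots> \<le> L0 * (E0 * (h ^ n * M n) * norm (x - y))"
        using L0 E0 hM by (intro mult_right_mono) auto
      finally show ?thesis by (simp add: L_def mult_ac)
    qed
    have "norm (v y) \<le> A0 * E0 * (a ^ n * M n)"
      using partials_leD[OF reg yK, of js] by (simp add: v_def n_def)
    also have "\<dots> \<le> A0 * E0 * (h ^ n * M n)"
      using A0 E0 ah ab by (intro mult_left_mono mult_right_mono power_mono) auto
    also have "\<dots> = (A0 / \<rho>) * (E0 * (h ^ n * M n) * \<rho>)" using \<rho> by simp
    also have "\<dots> \<le> L0 * (E0 * (h ^ n * M n) * \<rho>)" using L0 E0 hM \<rho> by (intro mult_right_mono) auto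
    finally have vy: "norm (v y) \<le> 2 * L * (\<rho> / 2)" by (simp add: L_def mult_ac)
    have \<rho>r: "\<rho> \<le> r" using r d by (simp add: \<rho>_def divide_le_eq)
    have "cball y (\<rho> / 2) \<subseteq> cball y r" using \<rho>r r \<rho> by (intro subset_cball) simp
    then have ballK: "cball y (\<rho> / 2) \<subseteq> ?K" using sub[OF y] by blast
    have "norm (v y) ^ (d + 2) \<le> C1 * L ^ d * norm (pairing S v \<psi>)"
      unfolding d_def C1_def \<psi>_def
    proof (rule norm_power_le_weighted_L2[OF compact_cball r(2)])
      show "continuous_on S v" using v by (rule smooth_on_continuous_on)
      show "supported_in S ?K (\<lambda>x. cnj (v x) * complex_of_real (\<theta> y x))" using \<psi> unfolding \<psi>_def .
      show "\<delta> \<le> \<theta> y x" if "norm (x - y) \<le> \<rho> / 2" for x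
      proof (rule \<theta>(5))
        show "\<bar>x $ i - y $ i\<bar> \<le> \<rho> / 2" for i
          using component_le_norm_cart[of "x - y" i] that by simp
      qed
      show "cball y (\<rho> / 2) \<subseteq> S" using ballK r(2) by blast
      show "norm (v x - v y) \<le> L * norm (x - y)" if "x \<in> cball y (\<rho> / 2)" for x
        using that ballK Lip by blast
    qed (use \<theta> L vy in auto)
    also have "\<dots> \<le> C1 * L ^ d * (C * P / G)" using C1 L pair by (intro mult_left_mono) auto
    \<comment> \<open>\<open>L ^ d\<close> contributes the power d of \<open>h ^ n * M n\<close>,
      and \<open>P\<close> contributes its square.\<close>
    also have "\<dots> = C1 * L0 ^ d * (C * c0\<^sup>2 * A0 * B) * (h ^ n * M n) ^ (d + 2) * (E0 ^ (d + 1) / G)"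
      by (simp add: L_def P_def power_mult_distrib power_add power2_eq_square mult_ac power_mult)
    finally show "norm (partials js u y) ^ (d + 2)
      \<le> C1 * L0 ^ d * (C * c0\<^sup>2 * A0 * B) * (h ^ length js * M (length js)) ^ (d + 2) * (E0 ^ (d + 1) / G)"
      by (simp add: v_def n_def)
  qed
qed

end

abbreviation decays_on :: "(real^'d::finite) set \<Rightarrow> (nat \<Rightarrow> real) \<Rightarrow> (real \<Rightarrow> real) \<Rightarrow> 'd net \<Rightarrow> bool" where
  "decays_on B w e g \<equiv> \<exists>C. \<exists>\<epsilon>3>0. \<forall>\<epsilon>. 0 < \<epsilon> \<longrightarrow> \<epsilon> < \<epsilon>3 \<longrightarrow>
     (\<forall>y\<in>B. \<forall>js. norm (partials js (g \<epsilon>) y) \<le> C * w (length js) / e \<epsilon>)"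

text \<open>The order of choices is decisive. The rate \<open>e0\<close> serves all
  \<open>n\<close>, so \<open>e\<close> can be fixed first; \<open>uniform_boundedness\<close> for
  \<open>e\<close> produces some \<open>n\<close>, and only then are \<open>a\<close>,
  \<open>b\<close> and \<open>A\<close> chosen for it. \<open>Ct\<close> compares the resulting
  geometric factor with the target weight \<open>wt\<close>.\<close>

lemma (in weight) decay_of_regular:
  fixes x0 :: "real^'d::finite" and g :: "'d net"
  assumes S: "open S" and r: "0 < r" "cball x0 (2 * r) \<subseteq> S"
    and G: "gauge_family G" "e0 \<in> G" "et \<in> G"
    and w: "\<And>n m. 0 < w n m" "\<And>n n' m. n \<le> n' \<Longrightarrow> w n' m \<le> w n m" "\<And>n. w n 0 = 1"
    and g: "0 < \<epsilon>1" "\<And>\<epsilon>. \<lbrakk>0 < \<epsilon>; \<epsilon> < \<epsilon>1\<rbrakk> \<Longrightarrow> smooth_on S (g \<epsilon>)"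
    and bounds: "\<And>\<epsilon> n. \<lbrakk>0 < \<epsilon>; \<epsilon> < \<epsilon>1\<rbrakk> \<Longrightarrow>
      \<exists>a>0. \<exists>b>0. \<exists>A. (\<forall>m. (H * (a + b)) ^ m * M m \<le> w n m) \<and>
        partials_le (cball x0 (2 * r)) (\<lambda>m. a ^ m * M m) (g \<epsilon>) A"
    and regular: "\<And>n. \<exists>a>0. \<exists>b>0. \<exists>A\<ge>0. \<exists>\<epsilon>2>0. (\<forall>m. (H * (a + b)) ^ m * M m \<le> w n m) \<and>
        (\<forall>m. (H\<^sup>2 * (a + b)) ^ m * M m \<le> Ct * wt m) \<and>
        (\<forall>\<epsilon>. 0 < \<epsilon> \<longrightarrow> \<epsilon> < \<epsilon>2 \<longrightarrow> partials_le (cball x0 (2 * r)) (\<lambda>m. a ^ m * M m) (g \<epsilon>) (A * e0 \<epsilon>))"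
    and weak: "\<And>e \<kappa>. \<lbrakk>e \<in> G; \<kappa> \<in> test_space S (cball x0 (2 * r)) w\<rbrakk> \<Longrightarrow>
      \<exists>C. \<forall>\<epsilon>. 0 < \<epsilon> \<longrightarrow> \<epsilon> < \<epsilon>1 \<longrightarrow> norm (pairing S (g \<epsilon>) \<kappa>) * e \<epsilon> \<le> C"
  shows "decays_on (cball x0 r) wt et g"
proof -
  let ?K = "cball x0 (2 * r)" and ?d = "CARD('d)"
  \<comment> \<open>\<open>local_decay\<close> loses \<open>e0\<close> to the power d + 1, and the
    target rate \<open>et\<close> has to survive a root of order d + 2.\<close>
  obtain e B where e: "e \<in> G" "1 \<le> B" "\<And>\<epsilon>. 0 < \<epsilon> \<Longrightarrow> et \<epsilon> ^ (?d + 2) * e0 \<epsilon> ^ (?d + 1) \<le> B * e \<epsilon>"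
    using gauge_family_powers[OF G(1,3,2), of "?d + 1" ?d] by auto
  have e_pos: "1 \<le> e \<epsilon>" "1 \<le> e0 \<epsilon>" "1 \<le> et \<epsilon>" if "0 < \<epsilon>" for \<epsilon>
    using that G e(1) by (auto intro: gauge_family_ge_1)
  have "\<exists>n C. \<forall>\<epsilon>\<in>{0<..<\<epsilon>1}. \<forall>\<kappa>\<in>test_space S ?K w. \<forall>P\<ge>0. partials_le S (w n) \<kappa> P \<longrightarrow>
    e \<epsilon> * norm (pairing S (g \<epsilon>) \<kappa>) \<le> C * P"
  proof (rule uniform_boundedness[where w = w, OF S compact_cball r(2) w])
    show "continuous_on S (g \<epsilon>)" if "\<epsilon> \<in> {0<..<\<epsilon>1}" for \<epsilon>
      using that by (intro smooth_on_continuous_on g) auto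
    show "0 \<le> e \<epsilon>" if "\<epsilon> \<in> {0<..<\<epsilon>1}" for \<epsilon> using e_pos(1)[of \<epsilon>] that by auto
    show "\<exists>C. \<forall>\<epsilon>\<in>{0<..<\<epsilon>1}. e \<epsilon> * norm (pairing S (g \<epsilon>) \<kappa>) \<le> C" if \<kappa>: "\<kappa> \<in> test_space S ?K w" for \<kappa>
    proof -
      obtain C where "\<And>\<epsilon>. \<lbrakk>0 < \<epsilon>; \<epsilon> < \<epsilon>1\<rbrakk> \<Longrightarrow> norm (pairing S (g \<epsilon>) \<kappa>) * e \<epsilon> \<le> C"
        using weak[OF e(1) \<kappa>] by blast
      then have "\<forall>\<epsilon>\<in>{0<..<\<epsilon>1}. e \<epsilon> * norm (pairing S (g \<epsilon>) \<kappa>) \<le> C" by (simp add: mult.commute[of "e _"])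
      then show ?thesis by blast
    qed
  qed
  then obtain n C0 where "\<forall>\<epsilon>\<in>{0<..<\<epsilon>1}. \<forall>\<kappa>\<in>test_space S ?K w. \<forall>P\<ge>0. partials_le S (w n) \<kappa> P \<longrightarrow>
    e \<epsilon> * norm (pairing S (g \<epsilon>) \<kappa>) \<le> C0 * P" by blast
  then have C0: "e \<epsilon> * norm (pairing S (g \<epsilon>) \<kappa>) \<le> C0 * P"
    if "0 < \<epsilon>" "\<epsilon> < \<epsilon>1" "\<kappa> \<in> test_space S ?K w" "0 \<le> P" "partials_le S (w n) \<kappa> P" for \<epsilon> \<kappa> P
    using that by auto
  define C where "C = \<bar>C0\<bar>"
  obtain a b A \<epsilon>2 where ab: "0 < a" "0 < b" and A: "0 \<le> A" and \<epsilon>2: "0 < \<epsilon>2"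
    and aw: "\<And>m. (H * (a + b)) ^ m * M m \<le> w n m" and at: "\<And>m. (H\<^sup>2 * (a + b)) ^ m * M m \<le> Ct * wt m"
    and reg: "\<And>\<epsilon>. 0 < \<epsilon> \<Longrightarrow> \<epsilon> < \<epsilon>2 \<Longrightarrow> partials_le ?K (\<lambda>m. a ^ m * M m) (g \<epsilon>) (A * e0 \<epsilon>)"
    using regular[of n] by blast
  define h where "h = H\<^sup>2 * (a + b)"
  have "0 \<le> C" by (simp add: C_def)
  from local_decay[OF S r ab A this, of w, folded h_def] obtain C2 where C2: "0 \<le> C2"
    "\<And>u E0 Q js y. \<lbrakk>y \<in> cball x0 r; smooth_on S u; 1 \<le> E0; 0 < Q;
      partials_le ?K (\<lambda>m. a ^ m * M m) u (A * E0);
      \<forall>n. \<exists>a'>0. \<exists>b'>0. \<exists>A. (\<forall>m. (H * (a' + b')) ^ m * M m \<le> w n m) \<and> partials_le ?K (\<lambda>m. a' ^ m * M m) u A;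
      \<forall>\<kappa>\<in>test_space S ?K w. \<forall>P\<ge>0. partials_le S (\<lambda>m. (H * (a + b)) ^ m * M m) \<kappa> P \<longrightarrow>
        norm (pairing S u \<kappa>) \<le> C * P / Q\<rbrakk>
      \<Longrightarrow> norm (partials js u y) ^ (?d + 2) \<le> C2 * (h ^ length js * M (length js)) ^ (?d + 2) * (E0 ^ (?d + 1) / Q)"
    by blast
  \<comment> \<open>As \<open>C3 \<ge> 1\<close>, the constant \<open>C2 * B\<close> is at most
    \<open>C3 ^ (?d + 2)\<close>, and the comparison of powers reduces to one of bases.\<close>
  define C3 where "C3 = max 1 (C2 * B)"
  have "norm (partials js (g \<epsilon>) y) \<le> C3 * Ct * wt (length js) / et \<epsilon>"
    if \<epsilon>: "0 < \<epsilon>" "\<epsilon> < min \<epsilon>1 \<epsilon>2" and y: "y \<in> cball x0 r" for \<epsilon> y js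
  proof -
    note pos = e_pos[OF \<epsilon>(1)]
    define t where "t = norm (partials js (g \<epsilon>) y)"
    define hM where "hM = h ^ length js * M (length js)"
    have hM: "0 < hM" using ab H by (simp add: hM_def h_def)
    have "t ^ (?d + 2) \<le> C2 * hM ^ (?d + 2) * (e0 \<epsilon> ^ (?d + 1) / e \<epsilon>)"
      unfolding t_def hM_def
    proof (rule C2(2)[OF y])
      show "\<forall>\<kappa>\<in>test_space S ?K w. \<forall>P\<ge>0. partials_le S (\<lambda>m. (H * (a + b)) ^ m * M m) \<kappa> P \<longrightarrow>
        norm (pairing S (g \<epsilon>) \<kappa>) \<le> C * P / e \<epsilon>"
      proof (intro ballI allI impI)
        fix \<kappa> P assume \<kappa>: "\<kappa> \<in> test_space S ?K w" and P: "0 \<le> P"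
          and le: "partials_le S (\<lambda>m. (H * (a + b)) ^ m * M m) \<kappa> P"
        have "partials_le S (w n) \<kappa> P"
          using le aw P unfolding partials_le_def by (meson mult_left_mono order_trans)
        then have "e \<epsilon> * norm (pairing S (g \<epsilon>) \<kappa>) \<le> C0 * P" using C0 \<kappa> P \<epsilon> by simp
        also have "\<dots> \<le> C * P" using P by (intro mult_right_mono) (auto simp: C_def)
        finally show "norm (pairing S (g \<epsilon>) \<kappa>) \<le> C * P / e \<epsilon>"
          using pos by (simp add: le_divide_eq mult.commute)
      qed
      show "\<forall>n. \<exists>a'>0. \<exists>b'>0. \<exists>A. (\<forall>m. (H * (a' + b')) ^ m * M m \<le> w n m) \<and>
          partials_le ?K (\<lambda>m. a' ^ m * M m) (g \<epsilon>) A"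
        by (intro allI bounds) (use \<epsilon> in auto)
    qed (use \<epsilon> pos in \<open>auto intro: g reg\<close>)
    then have "et \<epsilon> ^ (?d + 2) * t ^ (?d + 2) \<le> et \<epsilon> ^ (?d + 2) * (C2 * hM ^ (?d + 2) * (e0 \<epsilon> ^ (?d + 1) / e \<epsilon>))"
      using pos by (intro mult_left_mono) auto
    also have "\<dots> = C2 * hM ^ (?d + 2) * ((et \<epsilon> ^ (?d + 2) * e0 \<epsilon> ^ (?d + 1)) / e \<epsilon>)" by simp
    also have "\<dots> \<le> C2 * hM ^ (?d + 2) * B"
      using e(3)[OF \<epsilon>(1)] pos C2(1) hM by (intro mult_left_mono) (auto simp: divide_le_eq)
    also have "\<dots> = (C2 * B) * hM ^ (?d + 2)" by simp
    also have "\<dots> \<le> C3 ^ (?d + 2) * hM ^ (?d + 2)"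
    proof (intro mult_right_mono)
      have "C2 * B \<le> C3" by (simp add: C3_def)
      also have "\<dots> \<le> C3 ^ (?d + 2)" by (intro self_le_power) (auto simp: C3_def)
      finally show "C2 * B \<le> C3 ^ (?d + 2)" .
    qed (use hM in auto)
    finally have "(et \<epsilon> * t) ^ (?d + 2) \<le> (C3 * hM) ^ (?d + 2)" by (simp only: power_mult_distrib)
    then have "et \<epsilon> * t \<le> C3 * hM"
      using hM pos by (subst (asm) power_mono_iff) (auto simp: t_def C3_def)
    also have "\<dots> \<le> C3 * (Ct * wt (length js))"
      unfolding hM_def h_def by (intro mult_left_mono at) (simp add: C3_def)
    finally show ?thesis using pos by (simp add: t_def le_divide_eq mult_ac)
  qed
  then show ?thesis using g(1) \<epsilon>2 by (intro exI[of _ "C3 * Ct"] exI[of _ "min \<epsilon>1 \<epsilon>2"]) auto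
qed

section \<open>Negligible nets\<close>

text \<open>The Beurling and the Roumieu case are instances of one pattern: \<open>W\<close> is the set of weights of the
  seminorms and \<open>G\<close> the set of growth rates.\<close>

definition E_gen :: "(nat \<Rightarrow> real) set \<Rightarrow> (real^'d::finite) set \<Rightarrow> (real^'d \<Rightarrow> complex) set" where
  "E_gen W S = {u. smooth_on S u \<and> (\<forall>K\<in>cpts S. \<forall>w\<in>W. ultra_norm w K u < \<infinity>)}"

definition negligible_gen :: "(nat \<Rightarrow> real) set \<Rightarrow> (real \<Rightarrow> real) set \<Rightarrow> (real^'d::finite) set \<Rightarrow> 'd net set" where
  "negligible_gen W G S = {g. (\<forall>\<epsilon>\<in>{0<..<1}. g \<epsilon> \<in> E_gen W S) \<and>
     (\<forall>K\<in>cpts S. \<forall>w\<in>W. \<forall>e\<in>G. bigO_net (\<lambda>\<epsilon>. ultra_norm w K (g \<epsilon>)) (\<lambda>\<epsilon>. 1 / e \<epsilon>))}"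

definition decay_gen :: "(real \<Rightarrow> real) set \<Rightarrow> (real^'d::finite) set \<Rightarrow> (real^'d \<Rightarrow> complex) set \<Rightarrow> 'd net \<Rightarrow> bool" where
  "decay_gen G S T f \<longleftrightarrow> (\<exists>\<epsilon>0\<in>{0<..<1}. \<forall>e\<in>G. \<forall>\<kappa>\<in>T. \<exists>C>0. \<forall>\<epsilon>\<in>{0<..<\<epsilon>0}.
     norm (pairing S (f \<epsilon>) \<kappa>) * e \<epsilon> < C)"

text \<open>Regularity is given on regular compact sets, so balls must be recognized as such.
  Segments serve as curves by convexity, and the length of an inscribed polygon telescopes, giving
  the constant 1.\<close>

lemma cpts_cball:
  fixes x0 :: "'a::real_normed_vector"
  assumes "compact (cball x0 r)" "0 \<le> r" "cball x0 r \<subseteq> S"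
  shows "cball x0 r \<in> cpts S"
proof -
  let ?K = "cball x0 r"
  have comp: "components ?K = {?K}"
    using assms(2) by (simp add: components_eq_sing_iff convex_connected)
  have "\<exists>g. path g \<and> path_image g \<subseteq> ?K \<and> pathstart g = x \<and> pathfinish g = y \<and> curve_length_le g (1 * norm (x - y))"
    if xy: "x \<in> ?K" "y \<in> ?K" for x y
  proof (intro exI conjI)
    show "path_image (linepath x y) \<subseteq> ?K"
      using xy convex_cball by (simp add: closed_segment_subset)
    show "curve_length_le (linepath x y) (1 * norm (x - y))"
      unfolding curve_length_le_def
    proof (intro allI impI)
      fix ts :: "real list" assume ts: "sorted ts \<and> set ts \<subseteq> {0..1}"
      have "dist (linepath x y s) (linepath x y t) = (t - s) * norm (x - y)" if "s \<le> t" for s t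
      proof -
        have "linepath x y s - linepath x y t = (t - s) *\<^sub>R (x - y)"
          by (simp add: linepath_def algebra_simps)
        then show ?thesis using that by (simp add: dist_norm)
      qed
      then have "(\<Sum>i<length ts - 1. dist (linepath x y (ts ! i)) (linepath x y (ts ! Suc i)))
          = (\<Sum>i<length ts - 1. (ts ! Suc i - ts ! i) * norm (x - y))"
        using ts by (intro sum.cong) (auto simp: sorted_iff_nth_Suc)
      also have "\<dots> = (ts ! (length ts - 1) - ts ! 0) * norm (x - y)"
        by (simp add: sum_distrib_right[symmetric] sum_lessThan_telescope)
      also have "\<dots> \<le> 1 * norm (x - y)"
      proof (intro mult_right_mono)
        show "ts ! (length ts - 1) - ts ! 0 \<le> 1"
        \<comment> \<open>For the empty list \<open>length ts - 1\<close> is 0, so the difference is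
          that of one unspecified entry with itself.\<close>
        proof (cases "ts = []")
          case False
          then have "ts ! (length ts - 1) \<in> set ts" "ts ! 0 \<in> set ts" by (intro nth_mem; simp)+
          then have "ts ! (length ts - 1) \<in> {0..1}" "ts ! 0 \<in> {0..1}" using ts by blast+
          then show ?thesis by simp
        qed simp
      qed simp
      finally show "(\<Sum>i<length ts - 1. dist (linepath x y (ts ! i)) (linepath x y (ts ! Suc i))) \<le> 1 * norm (x - y)" .
    qed
  qed auto
  then show ?thesis
    using assms(1,3) comp unfolding cpts_def regular_compact_def
    by (intro CollectI conjI exI[of _ 1]) auto
qed

lemma cptsD: "K \<in> cpts S \<Longrightarrow> compact K" "K \<in> cpts S \<Longrightarrow> K \<subseteq> S"
  by (auto simp: cpts_def regular_compact_def)

lemma partials_diff: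
  fixes u v :: "real^'d::finite \<Rightarrow> complex"
  assumes "open S" "smooth_on S u" "smooth_on S v" "x \<in> S"
  shows "partials is (\<lambda>x. u x - v x) x = partials is u x - partials is v x"
  using partials_add[OF assms(1,2) smooth_on_bounded_linear[OF assms(1) bounded_linear_minus[OF bounded_linear_ident] assms(3)] assms(4), of "is"]
    partials_bounded_linear[OF assms(1) bounded_linear_minus[OF bounded_linear_ident] assms(3,4), of "is"] by simp

lemma smooth_on_diff_fun:
  fixes u v :: "real^'d::finite \<Rightarrow> complex"
  shows "\<lbrakk>open S; smooth_on S u; smooth_on S v\<rbrakk> \<Longrightarrow> smooth_on S (\<lambda>x. u x - v x)"
  using smooth_on_add[of S u "\<lambda>x. - v x"] smooth_on_bounded_linear[OF _ bounded_linear_minus[OF bounded_linear_ident], of S v] by simp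

lemma ultra_norm_diff_le:
  fixes u v :: "real^'d::finite \<Rightarrow> complex"
  assumes "open S" "smooth_on S u" "smooth_on S v" "K \<subseteq> S" "\<And>n. 0 < w n"
  shows "ultra_norm w K (\<lambda>x. u x - v x) \<le> ultra_norm w K u + ultra_norm w K v"
  unfolding ultra_norm_def
proof (intro SUP_least)
  fix x and \<alpha> :: "'d \<Rightarrow> nat" assume x: "x \<in> K"
  let ?n = "multi_abs \<alpha>"
  have "multi_deriv \<alpha> (\<lambda>x. u x - v x) x = multi_deriv \<alpha> u x - multi_deriv \<alpha> v x"
    unfolding multi_deriv_def using x assms by (intro partials_diff[of S]) auto
  then have "norm (multi_deriv \<alpha> (\<lambda>x. u x - v x) x) / w ?n
      \<le> norm (multi_deriv \<alpha> u x) / w ?n + norm (multi_deriv \<alpha> v x) / w ?n"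
    using norm_triangle_ineq4[of "multi_deriv \<alpha> u x" "multi_deriv \<alpha> v x"] assms(5)[of ?n]
    by (simp add: divide_right_mono flip: add_divide_distrib)
  then have "ennreal (norm (multi_deriv \<alpha> (\<lambda>x. u x - v x) x) / w ?n)
      \<le> ennreal (norm (multi_deriv \<alpha> u x) / w ?n + norm (multi_deriv \<alpha> v x) / w ?n)"
    by (rule ennreal_leI)
  also have "\<dots> = ennreal (norm (multi_deriv \<alpha> u x) / w ?n) + ennreal (norm (multi_deriv \<alpha> v x) / w ?n)"
    using less_imp_le[OF assms(5)[of ?n]] by (intro ennreal_plus) auto
  also have "\<dots> \<le> (SUP x\<in>K. SUP \<alpha>. ennreal (norm (multi_deriv \<alpha> u x) / w (multi_abs \<alpha>)))
      + (SUP x\<in>K. SUP \<alpha>. ennreal (norm (multi_deriv \<alpha> v x) / w (multi_abs \<alpha>)))"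
    by (intro add_mono SUP_upper2[OF x] SUP_upper2[OF UNIV_I[where x = \<alpha>]] order_refl)
  finally show "ennreal (norm (multi_deriv \<alpha> (\<lambda>x. u x - v x) x) / w ?n)
      \<le> (SUP x\<in>K. SUP \<alpha>. ennreal (norm (multi_deriv \<alpha> u x) / w (multi_abs \<alpha>)))
      + (SUP x\<in>K. SUP \<alpha>. ennreal (norm (multi_deriv \<alpha> v x) / w (multi_abs \<alpha>)))" .
qed

lemma ultra_norm_zero: "ultra_norm w K (\<lambda>x. 0) = 0"
proof (rule antisym)
  show "ultra_norm w K (\<lambda>x. 0) \<le> 0"
    unfolding ultra_norm_def by (intro SUP_least) (simp add: multi_deriv_def partials_zero)
qed simp

lemma bigO_net_diff:
  assumes "bigO_net a c" "bigO_net b c" "\<And>\<epsilon>. \<lbrakk>0 < \<epsilon>; \<epsilon> < 1\<rbrakk> \<Longrightarrow> f \<epsilon> \<le> a \<epsilon> + b \<epsilon>"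
    "\<And>\<epsilon>. \<lbrakk>0 < \<epsilon>; \<epsilon> < 1\<rbrakk> \<Longrightarrow> 0 \<le> c \<epsilon>"
  shows "bigO_net f c"
proof -
  obtain C1 e1 where 1: "0 < C1" "0 < e1" "e1 < 1" "\<And>\<epsilon>. \<lbrakk>0 < \<epsilon>; \<epsilon> < e1\<rbrakk> \<Longrightarrow> a \<epsilon> \<le> ennreal (C1 * c \<epsilon>)"
    using assms(1) unfolding bigO_net_def by auto
  obtain C2 e2 where 2: "0 < C2" "0 < e2" "e2 < 1" "\<And>\<epsilon>. \<lbrakk>0 < \<epsilon>; \<epsilon> < e2\<rbrakk> \<Longrightarrow> b \<epsilon> \<le> ennreal (C2 * c \<epsilon>)"
    using assms(2) unfolding bigO_net_def by auto
  have "f \<epsilon> \<le> ennreal ((C1 + C2) * c \<epsilon>)" if "0 < \<epsilon>" "\<epsilon> < min e1 e2" for \<epsilon>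
  proof -
    have "f \<epsilon> \<le> ennreal (C1 * c \<epsilon>) + ennreal (C2 * c \<epsilon>)"
      using assms(3)[of \<epsilon>] 1 2 that by (intro order_trans[OF assms(3) add_mono]) auto
    also have "\<dots> = ennreal ((C1 + C2) * c \<epsilon>)"
      using 1 2 that assms(4)[of \<epsilon>] by (subst ennreal_plus[symmetric]) (auto simp: distrib_right)
    finally show ?thesis .
  qed
  then show ?thesis
    unfolding bigO_net_def using 1 2 by (intro exI[of _ "C1 + C2"] conjI bexI[of _ "min e1 e2"]) auto
qed

lemma E_gen_diff:
  assumes "open S" "\<And>w n. w \<in> W \<Longrightarrow> 0 < w n" "u \<in> E_gen W S" "v \<in> E_gen W S"
  shows "(\<lambda>x. u x - v x) \<in> E_gen W S"
  unfolding E_gen_def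
proof (intro CollectI conjI ballI)
  show "smooth_on S (\<lambda>x. u x - v x)" using assms by (intro smooth_on_diff_fun) (auto simp: E_gen_def)
  fix K w assume K: "K \<in> cpts S" "w \<in> W"
  have "ultra_norm w K (\<lambda>x. u x - v x) \<le> ultra_norm w K u + ultra_norm w K v"
    by (rule ultra_norm_diff_le) (use assms K cptsD(2)[OF K(1)] in \<open>auto simp: E_gen_def\<close>)
  also have "\<dots> < \<infinity>" using assms K by (auto simp: E_gen_def)
  finally show "ultra_norm w K (\<lambda>x. u x - v x) < \<infinity>" .
qed

lemma negligible_gen_diff:
  assumes "open S" "\<And>w n. w \<in> W \<Longrightarrow> 0 < w n" "gauge_family G"
    and "f \<in> negligible_gen W G S" "g \<in> negligible_gen W G S"
  shows "(\<lambda>\<epsilon> x. f \<epsilon> x - g \<epsilon> x) \<in> negligible_gen W G S"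
  unfolding negligible_gen_def
proof (intro CollectI conjI ballI)
  show "(\<lambda>x. f \<epsilon> x - g \<epsilon> x) \<in> E_gen W S" if "\<epsilon> \<in> {0<..<1}" for \<epsilon>
    using that assms by (intro E_gen_diff) (auto simp: negligible_gen_def)
  fix K w e assume K: "K \<in> cpts S" "w \<in> W" "e \<in> G"
  show "bigO_net (\<lambda>\<epsilon>. ultra_norm w K (\<lambda>x. f \<epsilon> x - g \<epsilon> x)) (\<lambda>\<epsilon>. 1 / e \<epsilon>)"
  proof (rule bigO_net_diff)
    show "bigO_net (\<lambda>\<epsilon>. ultra_norm w K (f \<epsilon>)) (\<lambda>\<epsilon>. 1 / e \<epsilon>)" "bigO_net (\<lambda>\<epsilon>. ultra_norm w K (g \<epsilon>)) (\<lambda>\<epsilon>. 1 / e \<epsilon>)"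
      using assms K by (auto simp: negligible_gen_def)
    fix \<epsilon> :: real assume \<epsilon>: "0 < \<epsilon>" "\<epsilon> < 1"
    show "0 \<le> 1 / e \<epsilon>" using gauge_family_ge_1[OF assms(3) K(3) \<epsilon>(1)] by simp
    show "ultra_norm w K (\<lambda>x. f \<epsilon> x - g \<epsilon> x) \<le> ultra_norm w K (f \<epsilon>) + ultra_norm w K (g \<epsilon>)"
      by (rule ultra_norm_diff_le)
        (use assms K \<epsilon> cptsD(2)[OF K(1)] in \<open>auto simp: negligible_gen_def E_gen_def\<close>)
  qed
qed

lemma bigO_net_zero: "bigO_net (\<lambda>\<epsilon>. 0) b"
  unfolding bigO_net_def by (rule exI[of _ 1], intro conjI bexI[of _ "1/2"]) auto

lemma negligible_gen_zero:
  "(\<lambda>\<epsilon> x. 0) \<in> negligible_gen W G S"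
  by (auto simp: negligible_gen_def E_gen_def smooth_on_zero ultra_norm_zero bigO_net_zero)

lemma bigO_net_ultra_norm_iff:
  assumes S: "open S" and f: "\<And>\<epsilon>. \<lbrakk>0 < \<epsilon>; \<epsilon> < 1\<rbrakk> \<Longrightarrow> smooth_on S (f \<epsilon>)" and K: "K \<subseteq> S"
    and w: "\<And>n. 0 < w n" and b: "\<And>\<epsilon>. 0 < \<epsilon> \<Longrightarrow> 0 \<le> b \<epsilon>"
  shows "bigO_net (\<lambda>\<epsilon>. ultra_norm w K (f \<epsilon>)) b \<longleftrightarrow>
    (\<exists>C. \<exists>\<epsilon>0>0. \<forall>\<epsilon>. 0 < \<epsilon> \<longrightarrow> \<epsilon> < \<epsilon>0 \<longrightarrow> partials_le K w (f \<epsilon>) (C * b \<epsilon>))" (is "?l \<longleftrightarrow> ?r")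
proof
  assume ?l
  then obtain C \<epsilon>0 where *: "0 < C" "0 < \<epsilon>0" "\<epsilon>0 < 1"
    "\<And>\<epsilon>. \<lbrakk>0 < \<epsilon>; \<epsilon> < \<epsilon>0\<rbrakk> \<Longrightarrow> ultra_norm w K (f \<epsilon>) \<le> ennreal (C * b \<epsilon>)"
    unfolding bigO_net_def by auto
  have "partials_le K w (f \<epsilon>) (C * b \<epsilon>)" if "0 < \<epsilon>" "\<epsilon> < \<epsilon>0" for \<epsilon>
    using *(4)[OF that] ultra_norm_le_iff[OF S f K w, of \<epsilon> "C * b \<epsilon>"] that *(1,3) b[of \<epsilon>]
    by (simp add: partials_le_def)
  then show ?r using *(2) by blast
next
  assume ?r
  then obtain C \<epsilon>0 where *: "0 < \<epsilon>0" "\<And>\<epsilon>. \<lbrakk>0 < \<epsilon>; \<epsilon> < \<epsilon>0\<rbrakk> \<Longrightarrow> partials_le K w (f \<epsilon>) (C * b \<epsilon>)" by blast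
  define C' where "C' = max C 1"
  have "ultra_norm w K (f \<epsilon>) \<le> ennreal (C' * b \<epsilon>)" if \<epsilon>: "0 < \<epsilon>" "\<epsilon> < min \<epsilon>0 (1/2)" for \<epsilon>
  proof (subst ultra_norm_le_iff[OF S f K w])
    show "\<forall>x\<in>K. \<forall>is. norm (partials is (f \<epsilon>) x) \<le> C' * b \<epsilon> * w (length is)"
    proof (intro ballI allI)
      fix x "is" assume "x \<in> K"
      then have "norm (partials is (f \<epsilon>) x) \<le> C * b \<epsilon> * w (length is)"
        using *(2)[of \<epsilon>] \<epsilon> by (auto simp: partials_le_def)
      also have "\<dots> \<le> C' * b \<epsilon> * w (length is)"
        using b[OF \<epsilon>(1)] w[of "length is"] by (intro mult_right_mono) (auto simp: C'_def)
      finally show "norm (partials is (f \<epsilon>) x) \<le> C' * b \<epsilon> * w (length is)" .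
    qed
  qed (use \<epsilon> b in \<open>auto simp: C'_def\<close>)
  then show ?l unfolding bigO_net_def
    using *(1) by (intro exI[of _ C'] conjI bexI[of _ "min \<epsilon>0 (1/2)"]) (auto simp: C'_def)
qed

lemma ultra_norm_finite_iff:
  assumes "open S" "smooth_on S u" "K \<subseteq> S" "\<And>n. 0 < w n"
  shows "ultra_norm w K u < \<infinity> \<longleftrightarrow> (\<exists>P. partials_le K w u P)"
proof
  assume "ultra_norm w K u < \<infinity>"
  then obtain C where "0 \<le> C" "ultra_norm w K u = ennreal C" by (metis ennreal_cases infinity_ennreal_def order_less_irrefl)
  then have "ultra_norm w K u \<le> ennreal C" "0 \<le> C" by simp_all
  then show "\<exists>P. partials_le K w u P"
    unfolding partials_le_def using ultra_norm_le_iff[OF assms(1-3), of w C] assms(4) by auto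
next
  assume "\<exists>P. partials_le K w u P"
  then obtain P where P: "partials_le K w u P" by blast
  have "ultra_norm w K u \<le> ennreal \<bar>P\<bar>"
  proof (subst ultra_norm_le_iff[OF assms])
    show "\<forall>x\<in>K. \<forall>is. norm (partials is u x) \<le> \<bar>P\<bar> * w (length is)"
    proof (intro ballI allI)
      fix x "is" assume "x \<in> K"
      then have "norm (partials is u x) \<le> P * w (length is)" using P by (auto simp: partials_le_def)
      also have "\<dots> \<le> \<bar>P\<bar> * w (length is)" using assms(4)[of "length is"] by (intro mult_right_mono) auto
      finally show "norm (partials is u x) \<le> \<bar>P\<bar> * w (length is)" .
    qed
  qed simp
  also have "\<dots> < \<infinity>" by simp
  finally show "ultra_norm w K u < \<infinity>" .
qed

lemma decay_gen_subset: "decay_gen G S T f \<Longrightarrow> T' \<subseteq> T \<Longrightarrow> decay_gen G S T' f"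
  unfolding decay_gen_def by (meson subsetD)

text \<open>The threshold must not depend on the rate. The single rate \<open>e0\<close> yields one
  below which the net is bounded on \<open>K\<close>. A given rate \<open>e\<close> yields decay
  below its own \<open>\<epsilon>1\<close>; from there up to the common threshold the net is bounded
  and \<open>e \<epsilon> \<le> e \<epsilon>1\<close>. Boundedness on \<open>K\<close> is where the
  common compact support enters.\<close>

lemma negligible_gen_decay:
  fixes f :: "'d::finite net"
  assumes S: "open S" and W: "w \<in> W" "\<And>n. 0 < w n" and G: "gauge_family G" "e0 \<in> G"
    and f: "f \<in> negligible_gen W G S" and K: "K \<in> cpts S" and T: "\<And>\<kappa>. \<kappa> \<in> T \<Longrightarrow> supported_in S K \<kappa>"
  shows "decay_gen G S T f"
proof -
  note K' = cptsD[OF K]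
  have smooth: "smooth_on S (f \<epsilon>)" if "0 < \<epsilon>" "\<epsilon> < 1" for \<epsilon>
    using f that by (auto simp: negligible_gen_def E_gen_def)
  have bound: "\<exists>C. \<exists>\<epsilon>0>0. \<forall>\<epsilon>. 0 < \<epsilon> \<longrightarrow> \<epsilon> < \<epsilon>0 \<longrightarrow> (\<forall>x\<in>K. norm (f \<epsilon> x) \<le> C / e \<epsilon>)" if e: "e \<in> G" for e
  proof -
    have big: "bigO_net (\<lambda>\<epsilon>. ultra_norm w K (f \<epsilon>)) (\<lambda>\<epsilon>. 1 / e \<epsilon>)"
      using f K W(1) e by (simp add: negligible_gen_def)
    have pos: "0 \<le> 1 / e \<epsilon>" if "0 < \<epsilon>" for \<epsilon> using gauge_family_ge_1[OF G(1) e that] by simp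
    obtain C \<epsilon>0 where *: "0 < \<epsilon>0"
      "\<And>\<epsilon>. \<lbrakk>0 < \<epsilon>; \<epsilon> < \<epsilon>0\<rbrakk> \<Longrightarrow> partials_le K w (f \<epsilon>) (C * (1 / e \<epsilon>))"
      using iffD1[OF bigO_net_ultra_norm_iff[where b = "\<lambda>\<epsilon>. 1 / e \<epsilon>", OF S smooth K'(2) W(2) pos] big] by blast
    have "norm (f \<epsilon> x) \<le> (C * w 0) / e \<epsilon>" if "0 < \<epsilon>" "\<epsilon> < \<epsilon>0" "x \<in> K" for \<epsilon> x
      using partials_leD[OF *(2)[OF that(1,2)] that(3), of "[]"] by simp
    then show ?thesis using *(1) by blast
  qed
  have pair: "norm (pairing S (f \<epsilon>) \<kappa>) \<le> c * (b * measure lborel K)"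
    if "\<kappa> \<in> T" "\<And>x. x \<in> K \<Longrightarrow> norm (f \<epsilon> x) \<le> c" "\<And>x. x \<in> K \<Longrightarrow> norm (\<kappa> x) \<le> b" "0 \<le> c" "0 \<le> b" for \<epsilon> \<kappa> b c
  proof -
    have "norm (pairing S (f \<epsilon>) \<kappa>) \<le> (c * b) * measure lborel K"
    proof (rule norm_set_integral_le[OF K'])
      show "f \<epsilon> x * \<kappa> x = 0" if "x \<in> S - K" for x using T[OF \<open>\<kappa> \<in> T\<close>] that by (simp add: supported_in_def)
      show "norm (f \<epsilon> x * \<kappa> x) \<le> c * b" if "x \<in> K" for x
        unfolding norm_mult using \<open>0 \<le> c\<close> by (intro mult_mono \<open>\<And>x. x \<in> K \<Longrightarrow> norm (f \<epsilon> x) \<le> c\<close>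
            \<open>\<And>x. x \<in> K \<Longrightarrow> norm (\<kappa> x) \<le> b\<close> that) auto
    qed (use that in auto)
    then show ?thesis by (simp add: mult.assoc)
  qed
  obtain C0 \<epsilon>0 where C0: "0 < \<epsilon>0" "\<And>\<epsilon> x. \<lbrakk>0 < \<epsilon>; \<epsilon> < \<epsilon>0; x \<in> K\<rbrakk> \<Longrightarrow> norm (f \<epsilon> x) \<le> C0 / e0 \<epsilon>"
    using bound[OF G(2)] by blast
  have C0': "norm (f \<epsilon> x) \<le> \<bar>C0\<bar>" if "0 < \<epsilon>" "\<epsilon> < \<epsilon>0" "x \<in> K" for \<epsilon> x
  proof -
    have e0: "1 \<le> e0 \<epsilon>" by (rule gauge_family_ge_1[OF G that(1)])
    have "C0 / e0 \<epsilon> \<le> \<bar>C0\<bar> / 1" using e0 by (intro frac_le) auto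
    then show ?thesis using C0(2)[OF that] by simp
  qed
  define \<delta> where "\<delta> = min \<epsilon>0 (1/2)"
  have "\<exists>C>0. \<forall>\<epsilon>\<in>{0<..<\<delta>}. norm (pairing S (f \<epsilon>) \<kappa>) * e \<epsilon> < C" if e: "e \<in> G" and \<kappa>: "\<kappa> \<in> T" for e \<kappa>
  proof -
    have "bounded (\<kappa> ` K)"
      using T[OF \<kappa>] K' by (meson compact_continuous_image compact_imp_bounded continuous_on_subset
          smooth_on_continuous_on supported_in_def)
    then obtain b where b: "0 < b" "\<And>x. x \<in> K \<Longrightarrow> norm (\<kappa> x) \<le> b"
      using bounded_pos by (metis image_eqI)
    obtain C1 \<epsilon>1 where C1: "0 < \<epsilon>1" "\<And>\<epsilon> x. \<lbrakk>0 < \<epsilon>; \<epsilon> < \<epsilon>1; x \<in> K\<rbrakk> \<Longrightarrow> norm (f \<epsilon> x) \<le> C1 / e \<epsilon>"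
      using bound[OF e] by blast
    let ?m = "b * measure lborel K"
    have m0: "0 \<le> ?m" using b by simp
    \<comment> \<open>One summand for \<epsilon> below \<open>\<epsilon>1\<close>, one for the
      remaining \<epsilon>; the summand 1 gives strict inequality.\<close>
    define C where "C = \<bar>C1\<bar> * ?m + \<bar>C0\<bar> * ?m * e \<epsilon>1 + 1"
    have e1: "1 \<le> e \<epsilon>1" by (rule gauge_family_ge_1[OF G(1) e C1(1)])
    have "norm (pairing S (f \<epsilon>) \<kappa>) * e \<epsilon> < C" if \<epsilon>: "0 < \<epsilon>" "\<epsilon> < \<delta>" for \<epsilon>
    proof (cases "\<epsilon> < \<epsilon>1")
      case True
      have e\<epsilon>: "1 \<le> e \<epsilon>" by (rule gauge_family_ge_1[OF G(1) e \<epsilon>(1)])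
      have "norm (f \<epsilon> x) \<le> \<bar>C1\<bar> / e \<epsilon>" if "x \<in> K" for x
      proof -
        have "C1 / e \<epsilon> \<le> \<bar>C1\<bar> / e \<epsilon>" using e\<epsilon> by (intro divide_right_mono) auto
        then show ?thesis using C1(2)[OF \<epsilon>(1) True that] by simp
      qed
      then have "norm (pairing S (f \<epsilon>) \<kappa>) \<le> \<bar>C1\<bar> / e \<epsilon> * ?m"
        using b e\<epsilon> by (intro pair[OF \<kappa>]) auto
      then have "norm (pairing S (f \<epsilon>) \<kappa>) * e \<epsilon> \<le> (\<bar>C1\<bar> / e \<epsilon> * ?m) * e \<epsilon>"
        using e\<epsilon> by (intro mult_right_mono) auto
      also have "\<dots> = \<bar>C1\<bar> * ?m" using e\<epsilon> by simp
      also have "\<dots> < C" using m0 e1 by (simp add: C_def add_nonneg_pos)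
      finally show ?thesis .
    next
      case False
      have "norm (pairing S (f \<epsilon>) \<kappa>) \<le> \<bar>C0\<bar> * ?m"
        using b \<epsilon> by (intro pair[OF \<kappa>] C0') (auto simp: \<delta>_def)
      moreover have "e \<epsilon> \<le> e \<epsilon>1" using False by (intro gauge_family_antimono[OF G(1) e C1(1)]) simp
      ultimately have "norm (pairing S (f \<epsilon>) \<kappa>) * e \<epsilon> \<le> (\<bar>C0\<bar> * ?m) * e \<epsilon>1"
        using gauge_family_ge_1[OF G(1) e \<epsilon>(1)] m0 by (intro mult_mono) auto
      also have "\<dots> < C" using m0 by (simp add: C_def add_nonneg_pos)
      finally show ?thesis .
    qed
    moreover have "0 < C" using m0 e1 by (simp add: C_def add_nonneg_pos)
    ultimately show ?thesis by (intro exI[of _ C]) auto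
  qed
  then show ?thesis
    unfolding decay_gen_def using C0(1) by (intro bexI[of _ \<delta>]) (auto simp: \<delta>_def)
qed

text \<open>The local estimate halves the radius, so \<open>K\<close> is covered by balls whose
  doubles still lie in \<open>S\<close>; finitely many of them suffice.\<close>

lemma negligible_gen_local:
  fixes g :: "'d::finite net"
  assumes S: "open S" and W: "\<And>w n. w \<in> W \<Longrightarrow> 0 < w n" and G: "gauge_family G"
    and g: "\<And>\<epsilon>. \<lbrakk>0 < \<epsilon>; \<epsilon> < 1\<rbrakk> \<Longrightarrow> g \<epsilon> \<in> E_gen W S"
    and local: "\<And>x0 r w e. \<lbrakk>0 < r; cball x0 (2 * r) \<subseteq> S; w \<in> W; e \<in> G\<rbrakk> \<Longrightarrow>
      decays_on (cball x0 r) w e g"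
  shows "g \<in> negligible_gen W G S"
  unfolding negligible_gen_def
proof (intro CollectI conjI ballI)
  show "g \<epsilon> \<in> E_gen W S" if "\<epsilon> \<in> {0<..<1}" for \<epsilon> using g that by auto
  fix K w e assume K: "K \<in> cpts S" and w: "w \<in> W" and e: "e \<in> G"
  note K' = cptsD[OF K]
  have "\<exists>r>0. cball x (2 * r) \<subseteq> S" if "x \<in> K" for x
  proof -
    have "x \<in> S" by (rule subsetD[OF K'(2) that])
    then obtain r where "0 < r" "cball x r \<subseteq> S" using S[unfolded open_contains_cball] by meson
    then show ?thesis by (intro exI[of _ "r / 2"]) auto
  qed
  then obtain r where r: "\<And>x. x \<in> K \<Longrightarrow> 0 < r x" "\<And>x. x \<in> K \<Longrightarrow> cball x (2 * r x) \<subseteq> S" by metis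
  have "\<forall>x\<in>K. decays_on (cball x (r x)) w e g"
  proof
    fix x assume "x \<in> K"
    then show "decays_on (cball x (r x)) w e g"
      by (intro local r w e)
  qed
  then obtain C \<epsilon>3 where C: "\<And>x. x \<in> K \<Longrightarrow> 0 < \<epsilon>3 x"
    "\<And>x \<epsilon> y js. \<lbrakk>x \<in> K; 0 < \<epsilon>; \<epsilon> < \<epsilon>3 x; y \<in> cball x (r x)\<rbrakk> \<Longrightarrow>
      norm (partials js (g \<epsilon>) y) \<le> C x * w (length js) / e \<epsilon>" by metis
  obtain D where D: "D \<subseteq> K" "finite D" "K \<subseteq> (\<Union>x\<in>D. ball x (r x))"
    by (rule compactE_image[OF K'(1), of K "\<lambda>x. ball x (r x)"]) (use r(1) in \<open>auto simp: centre_in_ball\<close>)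
  define \<delta> where "\<delta> = Min (insert 1 (\<epsilon>3 ` D))"
  define C' where "C' = (\<Sum>x\<in>D. \<bar>C x\<bar>)"
  have "0 < \<delta>" unfolding \<delta>_def using D C(1) by (subst Min_gr_iff) auto
  moreover have "\<delta> \<le> \<epsilon>3 x" if "x \<in> D" for x unfolding \<delta>_def using D(2) that by (intro Min_le) auto
  ultimately have \<delta>: "0 < \<delta>" "\<And>x. x \<in> D \<Longrightarrow> \<delta> \<le> \<epsilon>3 x" by blast+
  have "partials_le K w (g \<epsilon>) (C' * (1 / e \<epsilon>))" if \<epsilon>: "0 < \<epsilon>" "\<epsilon> < \<delta>" for \<epsilon>
    unfolding partials_le_def
  proof (intro ballI allI)
    fix y js assume "y \<in> K"
    from subsetD[OF D(3) this] obtain x where x': "x \<in> D" "y \<in> ball x (r x)" by (rule UN_E)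
    then have x: "x \<in> D" "y \<in> cball x (r x)" by simp_all
    have "norm (partials js (g \<epsilon>) y) \<le> C x * w (length js) / e \<epsilon>"
      using x D(1) \<epsilon> \<delta>(2)[OF x(1)] by (intro C(2)) auto
    also have "\<dots> \<le> C' * w (length js) / e \<epsilon>"
    proof (intro divide_right_mono mult_right_mono)
      have "\<bar>C x\<bar> \<le> C'" unfolding C'_def using D(2) x(1) by (intro member_le_sum) auto
      then show "C x \<le> C'" by simp
    qed (use less_imp_le[OF W[OF w]] gauge_family_ge_1[OF G e \<epsilon>(1)] in auto)
    finally show "norm (partials js (g \<epsilon>) y) \<le> C' * (1 / e \<epsilon>) * w (length js)" by simp
  qed
  moreover have "smooth_on S (g \<epsilon>)" if "0 < \<epsilon>" "\<epsilon> < 1" for \<epsilon> using g[OF that] by (simp add: E_gen_def)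
  moreover have "0 \<le> 1 / e \<epsilon>" if "0 < \<epsilon>" for \<epsilon> using gauge_family_ge_1[OF G e that] by simp
  ultimately show "bigO_net (\<lambda>\<epsilon>. ultra_norm w K (g \<epsilon>)) (\<lambda>\<epsilon>. 1 / e \<epsilon>)"
    using \<delta>(1) by (subst bigO_net_ultra_norm_iff[OF S _ K'(2) W[OF w]]) blast+
qed

section \<open>Vanishing of classes in the quotient\<close>

lemma quot_rel_class_eq_zero_iff:
  assumes "\<And>f g. f \<in> N \<Longrightarrow> g \<in> N \<Longrightarrow> (\<lambda>\<epsilon> x. f \<epsilon> x - g \<epsilon> x) \<in> N" "(\<lambda>\<epsilon> x. 0) \<in> N"
    and "(\<lambda>\<epsilon> x. 0) \<in> E" "f \<in> E"
  shows "quot_rel E N `` {f} = quot_rel E N `` {\<lambda>\<epsilon> x. 0} \<longleftrightarrow> f \<in> N"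
proof
  assume eq: "quot_rel E N `` {f} = quot_rel E N `` {\<lambda>\<epsilon> x. 0}"
  have "f \<in> quot_rel E N `` {f}" using assms by (simp add: quot_rel_def)
  then have "(\<lambda>\<epsilon> x. 0 - f \<epsilon> x) \<in> N" unfolding eq by (simp add: quot_rel_def)
  from assms(1)[OF assms(2) this] show "f \<in> N" by simp
next
  assume f: "f \<in> N"
  have "(\<lambda>\<epsilon> x. f \<epsilon> x - g \<epsilon> x) \<in> N \<longleftrightarrow> (\<lambda>\<epsilon> x. 0 - g \<epsilon> x) \<in> N" for g
  proof
    assume "(\<lambda>\<epsilon> x. f \<epsilon> x - g \<epsilon> x) \<in> N"
    from assms(1)[OF this f] show "(\<lambda>\<epsilon> x. 0 - g \<epsilon> x) \<in> N" by simp
  next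
    assume g: "(\<lambda>\<epsilon> x. 0 - g \<epsilon> x) \<in> N"
    from assms(1)[OF assms(2) f] have "(\<lambda>\<epsilon> x. - f \<epsilon> x) \<in> N" by simp
    from assms(1)[OF g this] show "(\<lambda>\<epsilon> x. f \<epsilon> x - g \<epsilon> x) \<in> N" by simp
  qed
  then show "quot_rel E N `` {f} = quot_rel E N `` {\<lambda>\<epsilon> x. 0}"
    using assms(3,4) by (auto simp: quot_rel_def)
qed

text \<open>Decay is given for an arbitrary representative \<open>fe\<close>, while the local
  estimate needs the regular one, \<open>g\<close>. Their difference is negligible, so its pairings
  decay as well and the decay passes to \<open>g\<close>; negligibility of \<open>g\<close> then
  passes back to \<open>fe\<close>.\<close>

lemma class_eq_zero_iff_decay:
  fixes fe g :: "'d::finite net"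
  assumes S: "open S" and W: "w0 \<in> W" "\<And>w n. w \<in> W \<Longrightarrow> 0 < w n" and G: "gauge_family G" "e0 \<in> G"
    and E: "\<And>f \<epsilon>. \<lbrakk>f \<in> E; 0 < \<epsilon>; \<epsilon> < 1\<rbrakk> \<Longrightarrow> f \<epsilon> \<in> E_gen W S" "(\<lambda>\<epsilon> x. 0) \<in> E"
    and fe: "fe \<in> E" and g: "g \<in> E"
    and eq: "quot_rel E (negligible_gen W G S) `` {fe} = quot_rel E (negligible_gen W G S) `` {g}"
    and T: "\<And>K \<kappa>. \<lbrakk>K \<in> cpts S; \<kappa> \<in> T K\<rbrakk> \<Longrightarrow> supported_in S K \<kappa>"
    and local: "\<And>x0 r w e. \<lbrakk>0 < r; cball x0 (2 * r) \<subseteq> S; w \<in> W; e \<in> G; decay_gen G S (T (cball x0 (2 * r))) g\<rbrakk> \<Longrightarrow>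
      decays_on (cball x0 r) w e g"
  shows "quot_rel E (negligible_gen W G S) `` {fe} = quot_rel E (negligible_gen W G S) `` {\<lambda>\<epsilon> x. 0}
    \<longleftrightarrow> (\<forall>K\<in>cpts S. decay_gen G S (T K) fe)"
proof -
  let ?N = "negligible_gen W G S"
  have N_diff: "(\<lambda>\<epsilon> x. f \<epsilon> x - h \<epsilon> x) \<in> ?N" if "f \<in> ?N" "h \<in> ?N" for f h
    by (rule negligible_gen_diff[OF S _ G(1) that]) (rule W(2))
  note N_decay = negligible_gen_decay[OF S W(1) W(2)[OF W(1)] G]
  have "fe \<in> ?N \<longleftrightarrow> (\<forall>K\<in>cpts S. decay_gen G S (T K) fe)"
  proof
    assume "fe \<in> ?N"
    then show "\<forall>K\<in>cpts S. decay_gen G S (T K) fe" using N_decay T by blast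
  next
    assume fe_decay: "\<forall>K\<in>cpts S. decay_gen G S (T K) fe"
    define k where "k \<epsilon> x = g \<epsilon> x - fe \<epsilon> x" for \<epsilon> x
    have "fe \<in> quot_rel E ?N `` {fe}"
      using fe negligible_gen_zero[of W G S] by (simp add: quot_rel_def)
    then have k: "k \<in> ?N" unfolding eq k_def by (simp add: quot_rel_def)
    have g_decay: "decay_gen G S (T K) g" if K: "K \<in> cpts S" for K
    proof -
      obtain \<epsilon>0 where \<epsilon>0: "0 < \<epsilon>0" "\<epsilon>0 < 1" "\<And>e \<kappa>. \<lbrakk>e \<in> G; \<kappa> \<in> T K\<rbrakk> \<Longrightarrow>
          \<exists>C>0. \<forall>\<epsilon>\<in>{0<..<\<epsilon>0}. norm (pairing S (fe \<epsilon>) \<kappa>) * e \<epsilon> < C"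
        using fe_decay K unfolding decay_gen_def by fastforce
      have "decay_gen G S (T K) k" using N_decay[OF k K] T[OF K] by blast
      then obtain \<epsilon>1 where \<epsilon>1: "0 < \<epsilon>1" "\<epsilon>1 < 1" "\<And>e \<kappa>. \<lbrakk>e \<in> G; \<kappa> \<in> T K\<rbrakk> \<Longrightarrow>
          \<exists>C>0. \<forall>\<epsilon>\<in>{0<..<\<epsilon>1}. norm (pairing S (k \<epsilon>) \<kappa>) * e \<epsilon> < C"
        unfolding decay_gen_def by fastforce
      have "\<exists>C>0. \<forall>\<epsilon>\<in>{0<..<min \<epsilon>0 \<epsilon>1}. norm (pairing S (g \<epsilon>) \<kappa>) * e \<epsilon> < C" if e: "e \<in> G" and \<kappa>: "\<kappa> \<in> T K" for e \<kappa>
      proof -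
        obtain C0 C1 where C: "0 < C0" "0 < C1"
          "\<And>\<epsilon>. \<lbrakk>0 < \<epsilon>; \<epsilon> < \<epsilon>0\<rbrakk> \<Longrightarrow> norm (pairing S (fe \<epsilon>) \<kappa>) * e \<epsilon> < C0"
          "\<And>\<epsilon>. \<lbrakk>0 < \<epsilon>; \<epsilon> < \<epsilon>1\<rbrakk> \<Longrightarrow> norm (pairing S (k \<epsilon>) \<kappa>) * e \<epsilon> < C1"
          using \<epsilon>0(3)[OF e \<kappa>] \<epsilon>1(3)[OF e \<kappa>] by fastforce
        have "norm (pairing S (g \<epsilon>) \<kappa>) * e \<epsilon> < C0 + C1" if \<epsilon>: "0 < \<epsilon>" "\<epsilon> < min \<epsilon>0 \<epsilon>1" for \<epsilon>
        proof -
          have cont: "continuous_on S (f \<epsilon>)" if "f \<in> E" for f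
            using E(1)[OF that \<epsilon>(1)] \<epsilon> \<epsilon>0(2) by (auto simp: E_gen_def intro: smooth_on_continuous_on)
          have "pairing S (k \<epsilon>) \<kappa> = pairing S (g \<epsilon>) \<kappa> - pairing S (fe \<epsilon>) \<kappa>"
            unfolding k_def by (rule pairing_diff_left[OF cptsD[OF K] cont[OF g] cont[OF fe] T[OF K \<kappa>]])
          then have "norm (pairing S (g \<epsilon>) \<kappa>) \<le> norm (pairing S (fe \<epsilon>) \<kappa>) + norm (pairing S (k \<epsilon>) \<kappa>)"
            using norm_triangle_ineq[of "pairing S (fe \<epsilon>) \<kappa>" "pairing S (k \<epsilon>) \<kappa>"] by simp
          then have "norm (pairing S (g \<epsilon>) \<kappa>) * e \<epsilon> \<le> norm (pairing S (fe \<epsilon>) \<kappa>) * e \<epsilon> + norm (pairing S (k \<epsilon>) \<kappa>) * e \<epsilon>"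
            unfolding distrib_right[symmetric]
            using gauge_family_ge_1[OF G(1) e \<epsilon>(1)] by (intro mult_right_mono) auto
          then show ?thesis using C(3)[of \<epsilon>] C(4)[of \<epsilon>] \<epsilon> by simp
        qed
        then show ?thesis using C(1,2) by (intro exI[of _ "C0 + C1"]) auto
      qed
      then show ?thesis
        unfolding decay_gen_def using \<epsilon>0(1,2) \<epsilon>1(1,2) by (intro bexI[of _ "min \<epsilon>0 \<epsilon>1"]) auto
    qed
    have "g \<in> ?N"
    proof (rule negligible_gen_local[OF S _ G(1)])
      show "0 < w n" if "w \<in> W" for w n by (rule W(2)[OF that])
      fix x0 :: "real^'d" and r :: real and w e
      assume *: "0 < r" "cball x0 (2 * r) \<subseteq> S" "w \<in> W" "e \<in> G"
      have "cball x0 (2 * r) \<in> cpts S" using * by (intro cpts_cball) auto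
      then show "decays_on (cball x0 r) w e g"
        using * g_decay by (intro local) auto
    qed (use E(1)[OF g] in auto)
    from N_diff[OF this k] show "fe \<in> ?N" by (simp add: k_def)
  qed
  then show ?thesis
    using quot_rel_class_eq_zero_iff[of ?N E fe] N_diff negligible_gen_zero[of W G S] E(2) fe by blast
qed

lemma supported_in_if_supp_subset:
  assumes "smooth_on S \<kappa>" "supp S \<kappa> \<subseteq> K"
  shows "supported_in S K \<kappa>"
proof -
  have "\<kappa> x = 0" if "x \<in> S" "x \<notin> K" for x
    using assms(2) that closure_subset[of "support_on S \<kappa>"] by (auto simp: in_support_on)
  then show ?thesis using assms(1) by (simp add: supported_in_def)
qed

lemma supp_subset_if_supported_in:
  fixes \<kappa> :: "real^'d::finite \<Rightarrow> complex"
  assumes "supported_in S K \<kappa>" "compact K"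
  shows "supp S \<kappa> \<subseteq> K" "compact (supp S \<kappa>)"
proof -
  have "support_on S \<kappa> \<subseteq> K" using assms(1) by (auto simp: supported_in_def in_support_on)
  then show "supp S \<kappa> \<subseteq> K" using assms(2) by (intro closure_minimal compact_imp_closed)
  then show "compact (supp S \<kappa>)" using assms(2) compact_Int_closed[OF assms(2) closed_closure, of "support_on S \<kappa>"]
    by (simp add: inf_absorb2)
qed

lemma test_space_E_gen:
  fixes \<kappa> :: "real^'d::finite \<Rightarrow> complex"
  assumes S: "open S" and \<kappa>: "\<kappa> \<in> test_space S K w" and W: "\<And>v n. v \<in> W \<Longrightarrow> 0 < v n"
    and w: "\<And>v. v \<in> W \<Longrightarrow> \<exists>n C. \<forall>m. w n m \<le> C * v m" and w0: "\<And>n m. 0 < w n m"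
  shows "\<kappa> \<in> E_gen W S"
  unfolding E_gen_def
proof (intro CollectI conjI ballI)
  show smooth: "smooth_on S \<kappa>" using \<kappa> by (simp add: test_space_def supported_in_def)
  fix K' v assume K': "K' \<in> cpts S" and v: "v \<in> W"
  obtain n C where C: "\<And>m. w n m \<le> C * v m" using w[OF v] by blast
  obtain P where P: "partials_le S (w n) \<kappa> P" using \<kappa> by (auto simp: test_space_def)
  have "partials_le K' v \<kappa> (\<bar>P\<bar> * C)"
    unfolding partials_le_def
  proof (intro ballI allI)
    fix x "is" assume "x \<in> K'"
    then have "norm (partials is \<kappa> x) \<le> P * w n (length is)"
      using cptsD(2)[OF K'] by (intro partials_leD[OF P]) auto
    also have "\<dots> \<le> \<bar>P\<bar> * w n (length is)" using w0[of n "length is"] by (intro mult_right_mono) auto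
    also have "\<dots> \<le> \<bar>P\<bar> * (C * v (length is))" by (intro mult_left_mono C) simp
    finally show "norm (partials is \<kappa> x) \<le> \<bar>P\<bar> * C * v (length is)" by simp
  qed
  then show "ultra_norm v K' \<kappa> < \<infinity>"
    using ultra_norm_finite_iff[where w = v, OF S smooth cptsD(2)[OF K'] W[OF v]] by blast
qed

section \<open>The Beurling and the Roumieu case\<close>

context weight
begin

definition weights_B :: "(nat \<Rightarrow> real) set" where
  "weights_B = {\<lambda>p. h ^ p * M p | h. 0 < h}"

definition weights_R :: "(nat \<Rightarrow> real) set" where
  "weights_R = {seq_weight M r | r. r \<in> Rseq}"

lemma weights_B_pos: "w \<in> weights_B \<Longrightarrow> 0 < w n"
  by (auto simp: weights_B_def)

lemma weights_R_pos: "w \<in> weights_R \<Longrightarrow> 0 < w n"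
  by (auto simp: weights_R_def seq_weight_pos)

lemma E_B_eq: "E_B M S = E_gen weights_B S"
  by (auto simp: E_B_def E_gen_def norm_B_def weights_B_def)

lemma E_R_eq: "E_R M S = E_gen weights_R S"
  by (auto simp: E_R_def E_gen_def norm_R_def weights_R_def)

lemma weak_decay_B_eq: "weak_decay_B M S T f \<longleftrightarrow> decay_gen gauges_B S T f"
proof -
  have "(\<forall>h>0. P (\<lambda>\<epsilon>. exp (assoc_fun M (h / \<epsilon>)))) \<longleftrightarrow> (\<forall>e\<in>gauges_B. P e)" for P
    by (auto simp: gauges_B_def)
  from this[of "\<lambda>e. \<forall>\<kappa>\<in>T. \<exists>C>0. \<forall>\<epsilon>\<in>{0<..<_}. norm (pairing S (f \<epsilon>) \<kappa>) * e \<epsilon> < C"]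
  show ?thesis unfolding weak_decay_B_def decay_gen_def by simp
qed

lemma weak_decay_R_eq: "weak_decay_R M S T f \<longleftrightarrow> decay_gen gauges_R S T f"
proof -
  have "(\<forall>h\<in>Rseq. P (\<lambda>\<epsilon>. exp (assoc_fun_seq M h (1 / \<epsilon>)))) \<longleftrightarrow> (\<forall>e\<in>gauges_R. P e)" for P
    by (auto simp: gauges_R_def)
  from this[of "\<lambda>e. \<forall>\<kappa>\<in>T. \<exists>C>0. \<forall>\<epsilon>\<in>{0<..<_}. norm (pairing S (f \<epsilon>) \<kappa>) * e \<epsilon> < C"]
  show ?thesis unfolding weak_decay_R_def decay_gen_def by simp
qed

lemma bigO_net_mono:
  assumes "bigO_net a b" "\<And>\<epsilon>. \<lbrakk>0 < \<epsilon>; \<epsilon> < 1\<rbrakk> \<Longrightarrow> b \<epsilon> \<le> b' \<epsilon>"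
  shows "bigO_net a b'"
proof -
  obtain C e where C: "0 < C" "0 < e" "e < 1" "\<And>\<epsilon>. \<lbrakk>0 < \<epsilon>; \<epsilon> < e\<rbrakk> \<Longrightarrow> a \<epsilon> \<le> ennreal (C * b \<epsilon>)"
    using assms(1) unfolding bigO_net_def by auto
  have "a \<epsilon> \<le> ennreal (C * b' \<epsilon>)" if "0 < \<epsilon>" "\<epsilon> < e" for \<epsilon>
    using C(4)[OF that] by (rule order_trans) (use C that assms(2)[of \<epsilon>] in \<open>auto intro!: ennreal_leI mult_left_mono\<close>)
  then show ?thesis unfolding bigO_net_def using C by (intro exI[of _ C] conjI bexI[of _ e]) auto
qed

text \<open>The definition admits \<open>k = 0\<close>, which \<open>gauges_B\<close> excludes; that
  case follows from \<open>k = 1\<close> by monotonicity of the associated function.\<close>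

lemma negligible_B_eq: "negligible_B M S = negligible_gen weights_B gauges_B S"
proof -
  have zero: "bigO_net a (\<lambda>\<epsilon>. exp (- assoc_fun M (0 / \<epsilon>)))" if "bigO_net a (\<lambda>\<epsilon>. exp (- assoc_fun M (1 / \<epsilon>)))" for a
    using that
  proof (rule bigO_net_mono)
    fix \<epsilon> :: real assume "0 < \<epsilon>"
    then show "exp (- assoc_fun M (1 / \<epsilon>)) \<le> exp (- assoc_fun M (0 / \<epsilon>))"
      using exp_assoc_fun_mono[OF good_weight_M, of 0 "1 / \<epsilon>"] by simp
  qed
  have gauges: "(\<forall>k\<ge>0. bigO_net a (\<lambda>\<epsilon>. exp (- assoc_fun M (k / \<epsilon>)))) \<longleftrightarrow> (\<forall>e\<in>gauges_B. bigO_net a (\<lambda>\<epsilon>. 1 / e \<epsilon>))" (is "?l \<longleftrightarrow> ?r") for a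
  proof
    show "?l \<Longrightarrow> ?r" by (auto simp: gauges_B_def exp_minus inverse_eq_divide)
    assume r: ?r
    have pos: "bigO_net a (\<lambda>\<epsilon>. exp (- assoc_fun M (k / \<epsilon>)))" if "0 < k" for k
      using r that by (auto simp: gauges_B_def exp_minus inverse_eq_divide)
    show ?l
    proof (intro allI impI)
      fix k :: real assume "0 \<le> k"
      then show "bigO_net a (\<lambda>\<epsilon>. exp (- assoc_fun M (k / \<epsilon>)))"
        using pos zero[OF pos[of 1]] by (cases "k = 0") auto
    qed
  qed
  have weights: "(\<forall>w\<in>weights_B. P w) \<longleftrightarrow> (\<forall>h>0. P (\<lambda>p. h ^ p * M p))" for P
    by (auto simp: weights_B_def)
  show ?thesis
    unfolding negligible_B_def negligible_gen_def E_B_eq norm_B_def weights gauges ..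
qed

lemma negligible_R_eq: "negligible_R M S = negligible_gen weights_R gauges_R S"
proof -
  have weights: "(\<forall>w\<in>weights_R. P w) \<longleftrightarrow> (\<forall>r\<in>Rseq. P (seq_weight M r))" for P
    by (auto simp: weights_R_def)
  have gauges: "(\<forall>e\<in>gauges_R. P e) \<longleftrightarrow> (\<forall>k\<in>Rseq. P (\<lambda>\<epsilon>. exp (assoc_fun_seq M k (1 / \<epsilon>))))" for P
    by (auto simp: gauges_R_def)
  show ?thesis
    unfolding negligible_R_def negligible_gen_def E_R_eq norm_R_def weights gauges exp_minus inverse_eq_divide ..
qed

lemma decay_B:
  fixes x0 :: "real^'d::finite" and g :: "'d net"
  assumes S: "open S" and r: "0 < r" "cball x0 (2 * r) \<subseteq> S"
    and g: "\<And>\<epsilon>. \<lbrakk>0 < \<epsilon>; \<epsilon> < 1\<rbrakk> \<Longrightarrow> g \<epsilon> \<in> E_B M S"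
    and regular: "\<exists>k>0. \<forall>h>0.
        bigO_net (\<lambda>\<epsilon>. norm_B M (cball x0 (2 * r)) h (g \<epsilon>)) (\<lambda>\<epsilon>. exp (assoc_fun M (k / \<epsilon>)))"
    and wt: "wt \<in> weights_B" and et: "et \<in> gauges_B"
    and decay: "decay_gen gauges_B S {\<kappa>\<in>D_B M S. supp S \<kappa> \<subseteq> cball x0 (2 * r)} g"
  shows "decays_on (cball x0 r) wt et g"
proof -
  let ?K = "cball x0 (2 * r)"
  have K: "?K \<in> cpts S" using r by (intro cpts_cball) auto
  obtain k where k: "0 < k" "\<And>h. 0 < h \<Longrightarrow>
      bigO_net (\<lambda>\<epsilon>. norm_B M ?K h (g \<epsilon>)) (\<lambda>\<epsilon>. exp (assoc_fun M (k / \<epsilon>)))"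
    using regular by blast
  obtain ht where ht: "0 < ht" "wt = (\<lambda>p. ht ^ p * M p)" using wt by (auto simp: weights_B_def)
  define e0 where "e0 = (\<lambda>\<epsilon>. exp (assoc_fun M (k / \<epsilon>)))"
  have e0: "e0 \<in> gauges_B" using k(1) by (auto simp: e0_def gauges_B_def)
  \<comment> \<open>The constants \<open>1 / real (Suc n)\<close> get below every
    \<open>h > 0\<close>, so these countably many weights describe the Beurling test space.\<close>
  define w where "w n m = (1 / real (Suc n)) ^ m * M m" for n m
  have w_pos: "0 < w n m" for n m by (simp add: w_def)
  obtain \<epsilon>0 where \<epsilon>0: "0 < \<epsilon>0" "\<epsilon>0 < 1" "\<And>e \<kappa>. \<lbrakk>e \<in> gauges_B; \<kappa> \<in> D_B M S; supp S \<kappa> \<subseteq> ?K\<rbrakk> \<Longrightarrow>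
      \<exists>C>0. \<forall>\<epsilon>\<in>{0<..<\<epsilon>0}. norm (pairing S (g \<epsilon>) \<kappa>) * e \<epsilon> < C"
    using decay unfolding decay_gen_def by fastforce
  have smooth: "smooth_on S (g \<epsilon>)" if "0 < \<epsilon>" "\<epsilon> < 1" for \<epsilon> using g[OF that] by (simp add: E_B_def)
  have finite_norm: "\<exists>A. partials_le ?K (\<lambda>m. a ^ m * M m) (g \<epsilon>) A" if "0 < a" "0 < \<epsilon>" "\<epsilon> < 1" for a \<epsilon>
    using g[OF that(2,3)] K that(1)
    by (subst ultra_norm_finite_iff[OF S smooth[OF that(2,3)] r(2), symmetric]) (auto simp: E_B_def norm_B_def)
  \<comment> \<open>One value for \<open>a\<close> and \<open>b\<close> meets both needs: the factor
    \<open>H\<close> of the test function weights and the factor \<open>H\<^sup>2\<close> of the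
    target weight.\<close>
  have scale: "\<exists>a>0. H * (a + a) \<le> h \<and> H\<^sup>2 * (a + a) \<le> h" if "0 < h" for h
  proof (intro exI[of _ "h / (2 * H\<^sup>2)"] conjI)
    have H0: "0 < H" using H by simp
    show "0 < h / (2 * H\<^sup>2)" using that H0 by simp
    show "H\<^sup>2 * (h / (2 * H\<^sup>2) + h / (2 * H\<^sup>2)) \<le> h" using H0 by simp
    have "H * (h / (2 * H\<^sup>2) + h / (2 * H\<^sup>2)) = h / H" using H0 by (simp add: power2_eq_square)
    also have "\<dots> \<le> h / 1" using H that by (intro divide_left_mono) auto
    finally show "H * (h / (2 * H\<^sup>2) + h / (2 * H\<^sup>2)) \<le> h" by simp
  qed
  have le_weight: "x ^ m * M m \<le> y ^ m * M m" if "0 \<le> x" "x \<le> y" for x y m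
    using that by (intro mult_right_mono power_mono) auto
  show ?thesis
  proof (rule decay_of_regular[where w = w and ?\<epsilon>1.0 = \<epsilon>0 and Ct = 1, OF S r gauge_family_B e0 et w_pos])
    show "w n' m \<le> w n m" if "n \<le> n'" for n n' m
      unfolding w_def using that by (intro le_weight frac_le) auto
    show "w n 0 = 1" for n by (simp add: w_def)
    show "smooth_on S (g \<epsilon>)" if "0 < \<epsilon>" "\<epsilon> < \<epsilon>0" for \<epsilon> using that \<epsilon>0(2) by (intro smooth) auto
    show "\<exists>a>0. \<exists>b>0. \<exists>A. (\<forall>m. (H * (a + b)) ^ m * M m \<le> w n m) \<and> partials_le ?K (\<lambda>m. a ^ m * M m) (g \<epsilon>) A"
      if "0 < \<epsilon>" "\<epsilon> < \<epsilon>0" for \<epsilon> n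
    proof -
      obtain a where a: "0 < a" "H * (a + a) \<le> 1 / real (Suc n)" using scale[of "1 / real (Suc n)"] by auto
      have "(H * (a + a)) ^ m * M m \<le> w n m" for m
        unfolding w_def using a H by (intro le_weight) auto
      then show ?thesis using a(1) finite_norm[OF a(1) that(1)] that \<epsilon>0(2) by (meson less_trans)
    qed
    show "\<exists>a>0. \<exists>b>0. \<exists>A\<ge>0. \<exists>\<epsilon>2>0. (\<forall>m. (H * (a + b)) ^ m * M m \<le> w n m) \<and>
        (\<forall>m. (H\<^sup>2 * (a + b)) ^ m * M m \<le> 1 * wt m) \<and>
        (\<forall>\<epsilon>. 0 < \<epsilon> \<longrightarrow> \<epsilon> < \<epsilon>2 \<longrightarrow> partials_le ?K (\<lambda>m. a ^ m * M m) (g \<epsilon>) (A * e0 \<epsilon>))" for n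
    proof -
      \<comment> \<open>The entry \<open>1 / real (Suc n)\<close> serves the weight
        \<open>w n\<close>, the entry \<open>ht\<close> the target; regularity admits every
        \<open>a > 0\<close> with the same rate \<open>e0\<close>.\<close>
      obtain a where a: "0 < a" "H * (a + a) \<le> min ht (1 / real (Suc n))" "H\<^sup>2 * (a + a) \<le> min ht (1 / real (Suc n))"
        using scale[of "min ht (1 / real (Suc n))"] ht(1) by auto
      have 1: "(H * (a + a)) ^ m * M m \<le> w n m" for m
        unfolding w_def using a H by (intro le_weight) auto
      have 2: "(H\<^sup>2 * (a + a)) ^ m * M m \<le> 1 * wt m" for m
        unfolding ht(2) mult_1 using a by (intro le_weight) auto
      have big: "bigO_net (\<lambda>\<epsilon>. ultra_norm (\<lambda>m. a ^ m * M m) ?K (g \<epsilon>)) e0"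
        using k(2)[OF a(1)] by (simp add: norm_B_def e0_def)
      have "\<exists>C. \<exists>\<epsilon>2>0. \<forall>\<epsilon>. 0 < \<epsilon> \<longrightarrow> \<epsilon> < \<epsilon>2 \<longrightarrow> partials_le ?K (\<lambda>m. a ^ m * M m) (g \<epsilon>) (C * e0 \<epsilon>)"
        using big by (subst (asm) bigO_net_ultra_norm_iff[OF S smooth r(2)]) (use a(1) in \<open>auto simp: e0_def\<close>)
      then obtain C \<epsilon>2 where C: "0 < \<epsilon>2"
        "\<And>\<epsilon>. 0 < \<epsilon> \<Longrightarrow> \<epsilon> < \<epsilon>2 \<Longrightarrow> partials_le ?K (\<lambda>m. a ^ m * M m) (g \<epsilon>) (C * e0 \<epsilon>)" by blast
      have "partials_le ?K (\<lambda>m. a ^ m * M m) (g \<epsilon>) (\<bar>C\<bar> * e0 \<epsilon>)" if "0 < \<epsilon>" "\<epsilon> < \<epsilon>2" for \<epsilon>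
        unfolding partials_le_def
      proof (intro ballI allI)
        fix x "is" assume "x \<in> ?K"
        then have "norm (partials is (g \<epsilon>) x) \<le> C * e0 \<epsilon> * (a ^ length is * M (length is))"
          by (rule partials_leD[OF C(2)[OF that]])
        also have "\<dots> \<le> \<bar>C\<bar> * e0 \<epsilon> * (a ^ length is * M (length is))"
          using a(1) by (intro mult_right_mono) (auto simp: e0_def)
        finally show "norm (partials is (g \<epsilon>) x) \<le> \<bar>C\<bar> * e0 \<epsilon> * (a ^ length is * M (length is))" .
      qed
      then have "\<bar>C\<bar> \<ge> 0 \<and> (\<exists>\<epsilon>2>0. (\<forall>m. (H * (a + a)) ^ m * M m \<le> w n m) \<and>
        (\<forall>m. (H\<^sup>2 * (a + a)) ^ m * M m \<le> 1 * wt m) \<and>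
        (\<forall>\<epsilon>. 0 < \<epsilon> \<longrightarrow> \<epsilon> < \<epsilon>2 \<longrightarrow> partials_le ?K (\<lambda>m. a ^ m * M m) (g \<epsilon>) (\<bar>C\<bar> * e0 \<epsilon>)))"
        using 1 2 C(1) by (intro conjI exI[of _ \<epsilon>2]) auto
      then show ?thesis using a(1) by blast
    qed
    show "\<exists>C. \<forall>\<epsilon>. 0 < \<epsilon> \<longrightarrow> \<epsilon> < \<epsilon>0 \<longrightarrow> norm (pairing S (g \<epsilon>) \<kappa>) * e \<epsilon> \<le> C"
      if e: "e \<in> gauges_B" and \<kappa>: "\<kappa> \<in> test_space S ?K w" for e \<kappa>
    proof -
      have "\<kappa> \<in> E_gen weights_B S"
      proof (rule test_space_E_gen[OF S \<kappa> _ _ w_pos])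
        show "0 < v n" if "v \<in> weights_B" for v n using that by (rule weights_B_pos)
        fix v assume "v \<in> weights_B"
        then obtain h where h: "0 < h" "v = (\<lambda>p. h ^ p * M p)" by (auto simp: weights_B_def)
        obtain n :: nat where n: "0 < n" "inverse (real n) < h" using ex_inverse_of_nat_less[OF h(1)] by blast
        have "w n m \<le> 1 * v m" for m
        proof -
          have "1 / real (Suc n) \<le> 1 / real n" using n(1) by (intro frac_le) auto
          then have "1 / real (Suc n) \<le> h" using n(2) by (simp add: inverse_eq_divide)
          then show ?thesis unfolding h(2) w_def mult_1 by (intro le_weight) auto
        qed
        then show "\<exists>n C. \<forall>m. w n m \<le> C * v m" by blast
      qed
      moreover have supp: "supported_in S ?K \<kappa>" using \<kappa> by (simp add: test_space_def)
      ultimately have "\<kappa> \<in> D_B M S" "supp S \<kappa> \<subseteq> ?K"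
        using supp_subset_if_supported_in[OF supp compact_cball] r(2) by (auto simp: D_B_def E_B_eq)
      from \<epsilon>0(3)[OF e this] show ?thesis by (meson greaterThanLessThan_iff less_imp_le)
    qed
  qed (use \<epsilon>0(1) in auto)
qed

text \<open>Komatsu's lemma gives one geometric constant \<open>a\<close> for the net at all small
  \<epsilon>. The test functions needed then lie in the Banach space with the weight
  \<open>(H * (a + 1)) ^ m * M m\<close>, whose elements satisfy the bounds for every sequence in
  \<open>Rseq\<close> and so are Roumieu test functions.\<close>

lemma decay_R:
  fixes x0 :: "real^'d::finite" and g :: "'d net"
  assumes S: "open S" and r: "0 < r" "cball x0 (2 * r) \<subseteq> S"
    and g: "\<And>\<epsilon>. \<lbrakk>0 < \<epsilon>; \<epsilon> < 1\<rbrakk> \<Longrightarrow> g \<epsilon> \<in> E_R M S"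
    and regular: "\<exists>k\<in>Rseq. \<forall>h\<in>Rseq.
        bigO_net (\<lambda>\<epsilon>. norm_R M (cball x0 (2 * r)) h (g \<epsilon>)) (\<lambda>\<epsilon>. exp (assoc_fun_seq M k (1 / \<epsilon>)))"
    and wt: "wt \<in> weights_R" and et: "et \<in> gauges_R"
    and decay: "decay_gen gauges_R S {\<kappa>\<in>D_R M S. supp S \<kappa> \<subseteq> cball x0 (2 * r)} g"
  shows "decays_on (cball x0 r) wt et g"
proof -
  let ?K = "cball x0 (2 * r)"
  obtain k where k: "k \<in> Rseq" "\<And>h. h \<in> Rseq \<Longrightarrow>
      bigO_net (\<lambda>\<epsilon>. norm_R M ?K h (g \<epsilon>)) (\<lambda>\<epsilon>. exp (assoc_fun_seq M k (1 / \<epsilon>)))"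
    using regular by blast
  obtain rt where rt: "rt \<in> Rseq" "wt = seq_weight M rt" using wt by (auto simp: weights_R_def)
  define e0 where "e0 = (\<lambda>\<epsilon>. exp (assoc_fun_seq M k (1 / \<epsilon>)))"
  have e0: "e0 \<in> gauges_R" using k(1) by (auto simp: e0_def gauges_R_def)
  have e0_pos: "0 < e0 \<epsilon>" for \<epsilon> by (simp add: e0_def)
  obtain \<epsilon>0 where \<epsilon>0: "0 < \<epsilon>0" "\<epsilon>0 < 1" "\<And>e \<kappa>. \<lbrakk>e \<in> gauges_R; \<kappa> \<in> D_R M S; supp S \<kappa> \<subseteq> ?K\<rbrakk> \<Longrightarrow>
      \<exists>C>0. \<forall>\<epsilon>\<in>{0<..<\<epsilon>0}. norm (pairing S (g \<epsilon>) \<kappa>) * e \<epsilon> < C"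
    using decay unfolding decay_gen_def by fastforce
  have smooth: "smooth_on S (g \<epsilon>)" if "0 < \<epsilon>" "\<epsilon> < 1" for \<epsilon> using g[OF that] by (simp add: E_R_def)
  \<comment> \<open>Derivatives normalized by \<open>M\<close> and by the rate \<open>e0\<close>; a
    pair of a point and a list is the element to which \<open>Rseq_diagonal\<close> is applied, with
    the length of the list as \<open>len\<close>.\<close>
  define F where "F \<epsilon> z = norm (partials (snd z) (g \<epsilon>) (fst z)) / (M (length (snd z)) * e0 \<epsilon>)" for \<epsilon> z
  have "\<exists>N::nat. \<forall>\<epsilon>. 0 < \<epsilon> \<longrightarrow> \<epsilon> < 1 / real (N + 2) \<longrightarrow>
      (\<forall>z\<in>?K \<times> UNIV. F \<epsilon> z \<le> real N * real (N + 1) ^ length (snd z))"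
  proof (rule Rseq_diagonal)
    fix h assume h: "h \<in> Rseq"
    have big: "bigO_net (\<lambda>\<epsilon>. ultra_norm (seq_weight M h) ?K (g \<epsilon>)) e0"
      using k(2)[OF h] by (simp add: norm_R_def e0_def)
    have "\<exists>C. \<exists>\<epsilon>2>0. \<forall>\<epsilon>. 0 < \<epsilon> \<longrightarrow> \<epsilon> < \<epsilon>2 \<longrightarrow> partials_le ?K (seq_weight M h) (g \<epsilon>) (C * e0 \<epsilon>)"
      using big by (subst (asm) bigO_net_ultra_norm_iff[OF S smooth r(2) seq_weight_pos[OF h]])
        (auto simp: e0_def)
    then obtain C \<epsilon>2 where C: "0 < \<epsilon>2"
      "\<And>\<epsilon>. 0 < \<epsilon> \<Longrightarrow> \<epsilon> < \<epsilon>2 \<Longrightarrow> partials_le ?K (seq_weight M h) (g \<epsilon>) (C * e0 \<epsilon>)" by blast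
    have "F \<epsilon> z \<le> C * (\<Prod>i=1..length (snd z). h i)" if "0 < \<epsilon>" "\<epsilon> < \<epsilon>2" "z \<in> ?K \<times> UNIV" for \<epsilon> z
    proof -
      have "norm (partials (snd z) (g \<epsilon>) (fst z)) \<le> C * e0 \<epsilon> * seq_weight M h (length (snd z))"
        using that(3) by (intro partials_leD[OF C(2)[OF that(1,2)]]) auto
      then show ?thesis using e0_pos[of \<epsilon>] M_pos[of "length (snd z)"]
        by (simp add: F_def divide_le_eq seq_weight_def mult_ac)
    qed
    then show "\<exists>C. \<exists>e>0. \<forall>\<epsilon>. 0 < \<epsilon> \<longrightarrow> \<epsilon> < e \<longrightarrow> (\<forall>z\<in>?K \<times> UNIV. F \<epsilon> z \<le> C * (\<Prod>i=1..length (snd z). h i))"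
      using C(1) by blast
  qed
  then obtain N :: nat where N: "\<And>\<epsilon> z. \<lbrakk>0 < \<epsilon>; \<epsilon> < 1 / real (N + 2); z \<in> ?K \<times> UNIV\<rbrakk> \<Longrightarrow>
      F \<epsilon> z \<le> real N * real (N + 1) ^ length (snd z)" by blast
  define a where "a = real (N + 1)"
  have a: "0 < a" by (simp add: a_def)
  have reg: "partials_le ?K (\<lambda>m. a ^ m * M m) (g \<epsilon>) (real N * e0 \<epsilon>)" if "0 < \<epsilon>" "\<epsilon> < 1 / real (N + 2)" for \<epsilon>
    unfolding partials_le_def
  proof (intro ballI allI)
    fix x "is" assume "x \<in> ?K"
    then show "norm (partials is (g \<epsilon>) x) \<le> real N * e0 \<epsilon> * (a ^ length is * M (length is))"
      using N[OF that, of "(x, is)"] e0_pos[of \<epsilon>] M_pos[of "length is"]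
      by (simp add: F_def divide_le_eq a_def mult_ac)
  qed
  \<comment> \<open>The 1 in \<open>a + 1\<close> is the geometric constant chosen for the bump
    functions.\<close>
  define w where "w n m = (H * (a + 1)) ^ m * M m" for n m :: nat
  have w_pos: "0 < w n m" for n m using a H by (simp add: w_def)
  have geometric_le: "\<exists>C. \<forall>m. x ^ m * M m \<le> C * seq_weight M s m" if s: "s \<in> Rseq" and x: "0 \<le> x" for s x
  proof -
    obtain C where C: "\<And>m. x ^ m \<le> C * (\<Prod>i=1..m. s i)" using Rseq_power_le_prod[OF s x] by blast
    have "x ^ m * M m \<le> C * seq_weight M s m" for m
      using mult_right_mono[OF C[of m], of "M m"] by (simp add: seq_weight_def mult_ac)
    then show ?thesis by blast
  qed
  obtain Ct where Ct: "\<And>m. (H\<^sup>2 * (a + 1)) ^ m * M m \<le> Ct * wt m"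
    using geometric_le[OF rt(1), of "H\<^sup>2 * (a + 1)"] a unfolding rt(2) by auto
  \<comment> \<open>Decay of the pairings is available below \<open>\<epsilon>0\<close>, the
    geometric bound with the constant \<open>a\<close> below
    \<open>1 / real (N + 2)\<close>.\<close>
  define \<epsilon>1 where "\<epsilon>1 = min \<epsilon>0 (1 / real (N + 2))"
  have \<epsilon>1: "0 < \<epsilon>1" "\<epsilon>1 \<le> \<epsilon>0" "\<epsilon>1 \<le> 1 / real (N + 2)" using \<epsilon>0(1) by (auto simp: \<epsilon>1_def)
  show ?thesis
  proof (rule decay_of_regular[where w = w and ?\<epsilon>1.0 = \<epsilon>1 and Ct = Ct, OF S r gauge_family_R e0 et w_pos])
    show "smooth_on S (g \<epsilon>)" if "0 < \<epsilon>" "\<epsilon> < \<epsilon>1" for \<epsilon> using that \<epsilon>1 \<epsilon>0(2) by (intro smooth) auto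
    show "\<exists>b>0. \<exists>c>0. \<exists>A. (\<forall>m. (H * (b + c)) ^ m * M m \<le> w n m) \<and> partials_le ?K (\<lambda>m. b ^ m * M m) (g \<epsilon>) A"
      if "0 < \<epsilon>" "\<epsilon> < \<epsilon>1" for \<epsilon> n
    proof -
      have "(\<forall>m. (H * (a + 1)) ^ m * M m \<le> w n m) \<and> partials_le ?K (\<lambda>m. a ^ m * M m) (g \<epsilon>) (real N * e0 \<epsilon>)"
        using reg[of \<epsilon>] that \<epsilon>1 by (simp add: w_def)
      then show ?thesis using a zero_less_one by blast
    qed
    show "\<exists>b>0. \<exists>c>0. \<exists>A\<ge>0. \<exists>\<epsilon>2>0. (\<forall>m. (H * (b + c)) ^ m * M m \<le> w n m) \<and>
        (\<forall>m. (H\<^sup>2 * (b + c)) ^ m * M m \<le> Ct * wt m) \<and>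
        (\<forall>\<epsilon>. 0 < \<epsilon> \<longrightarrow> \<epsilon> < \<epsilon>2 \<longrightarrow> partials_le ?K (\<lambda>m. b ^ m * M m) (g \<epsilon>) (A * e0 \<epsilon>))" for n
    proof -
      have "0 < \<epsilon>1 \<and> (\<forall>m. (H * (a + 1)) ^ m * M m \<le> w n m) \<and>
        (\<forall>m. (H\<^sup>2 * (a + 1)) ^ m * M m \<le> Ct * wt m) \<and>
        (\<forall>\<epsilon>. 0 < \<epsilon> \<longrightarrow> \<epsilon> < \<epsilon>1 \<longrightarrow> partials_le ?K (\<lambda>m. a ^ m * M m) (g \<epsilon>) (real N * e0 \<epsilon>))"
        using reg Ct \<epsilon>1 by (simp add: w_def)
      then show ?thesis using a zero_less_one of_nat_0_le_iff by blast
    qed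
    show "\<exists>C. \<forall>\<epsilon>. 0 < \<epsilon> \<longrightarrow> \<epsilon> < \<epsilon>1 \<longrightarrow> norm (pairing S (g \<epsilon>) \<kappa>) * e \<epsilon> \<le> C"
      if e: "e \<in> gauges_R" and \<kappa>: "\<kappa> \<in> test_space S ?K w" for e \<kappa>
    proof -
      have "\<kappa> \<in> E_gen weights_R S"
      proof (rule test_space_E_gen[OF S \<kappa> _ _ w_pos])
        show "0 < v n" if "v \<in> weights_R" for v n using that by (rule weights_R_pos)
        fix v assume "v \<in> weights_R"
        then obtain s where "s \<in> Rseq" "v = seq_weight M s" by (auto simp: weights_R_def)
        then show "\<exists>n C. \<forall>m. w n m \<le> C * v m"
          using geometric_le[of s "H * (a + 1)"] a H by (simp add: w_def)
      qed
      moreover have supp: "supported_in S ?K \<kappa>" using \<kappa> by (simp add: test_space_def)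
      ultimately have "\<kappa> \<in> D_R M S" "supp S \<kappa> \<subseteq> ?K"
        using supp_subset_if_supported_in[OF supp compact_cball] r(2) by (auto simp: D_R_def E_R_eq)
      from \<epsilon>0(3)[OF e this] obtain C where
        "\<And>\<epsilon>. \<epsilon> \<in> {0<..<\<epsilon>0} \<Longrightarrow> norm (pairing S (g \<epsilon>) \<kappa>) * e \<epsilon> < C" by blast
      then have "norm (pairing S (g \<epsilon>) \<kappa>) * e \<epsilon> \<le> C" if "0 < \<epsilon>" "\<epsilon> < \<epsilon>1" for \<epsilon>
        using that \<epsilon>1(2) by (intro less_imp_le) auto
      then show ?thesis by blast
    qed
  qed (use \<epsilon>1(1) in \<open>auto simp: w_def\<close>)
qed

lemma zero_moderate_B: "(\<lambda>\<epsilon> x. 0) \<in> moderate_B M (S :: (real^'d::finite) set)"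
  by (auto simp: moderate_B_def E_B_def norm_B_def ultra_norm_zero smooth_on_zero bigO_net_zero)

lemma real_in_Rseq: "real \<in> Rseq"
  by (auto simp: Rseq_def mono_on_def filterlim_real_sequentially)

lemma zero_moderate_R: "(\<lambda>\<epsilon> x. 0) \<in> moderate_R M (S :: (real^'d::finite) set)"
  using real_in_Rseq
  by (auto simp: moderate_R_def E_R_def norm_R_def ultra_norm_zero smooth_on_zero bigO_net_zero)

lemma beurling_case:
  fixes S :: "(real^'d::finite) set"
  assumes S: "open S" and f: "f \<in> Ginf_B M S" "fe \<in> moderate_B M S" "f = class_B M S fe"
  shows "f = zero_B M S \<longleftrightarrow> (\<forall>K\<in>cpts S. weak_decay_B M S {\<kappa>\<in>D_B M S. supp S \<kappa> \<subseteq> K} fe)"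
proof -
  obtain g where g: "g \<in> moderate_B M S" "f = class_B M S g"
    "\<And>K. K \<in> cpts S \<Longrightarrow> \<exists>k>0. \<forall>h>0. bigO_net (\<lambda>\<epsilon>. norm_B M K h (g \<epsilon>)) (\<lambda>\<epsilon>. exp (assoc_fun M (k / \<epsilon>)))"
    using f(1) unfolding Ginf_B_def by blast
  show ?thesis
    unfolding weak_decay_B_eq f(3) class_B_def zero_B_def negligible_B_eq
  proof (rule class_eq_zero_iff_decay[OF S _ _ gauge_family_B])
    show "(\<lambda>p. 1 ^ p * M p) \<in> weights_B" unfolding weights_B_def using zero_less_one by blast
    show "(\<lambda>\<epsilon>. exp (assoc_fun M (1 / \<epsilon>))) \<in> gauges_B" unfolding gauges_B_def using zero_less_one by blast
    show "u \<epsilon> \<in> E_gen weights_B S" if "u \<in> moderate_B M S" "0 < \<epsilon>" "\<epsilon> < 1" for u \<epsilon>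
      using that by (auto simp: moderate_B_def E_B_eq)
    show "quot_rel (moderate_B M S) (negligible_gen weights_B gauges_B S) `` {fe}
        = quot_rel (moderate_B M S) (negligible_gen weights_B gauges_B S) `` {g}"
      using f(3) g(2) by (simp add: class_B_def negligible_B_eq)
    show "supported_in S K \<kappa>" if "\<kappa> \<in> {\<kappa>\<in>D_B M S. supp S \<kappa> \<subseteq> K}" for K \<kappa>
      using that by (intro supported_in_if_supp_subset) (auto simp: D_B_def E_B_def)
    fix x0 :: "real^'d" and r :: real and w e
    assume r: "0 < r" "cball x0 (2 * r) \<subseteq> S" and we: "w \<in> weights_B" "e \<in> gauges_B"
      and decay: "decay_gen gauges_B S {\<kappa>\<in>D_B M S. supp S \<kappa> \<subseteq> cball x0 (2 * r)} g"
    have "cball x0 (2 * r) \<in> cpts S" using r by (intro cpts_cball) auto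
    from decay_B[OF S r _ g(3)[OF this] we decay] g(1)
    show "decays_on (cball x0 r) w e g"
      by (auto simp: moderate_B_def)
  qed (use weights_B_pos zero_moderate_B f(2) g(1) in auto)
qed

lemma roumieu_case:
  fixes S :: "(real^'d::finite) set"
  assumes S: "open S" and f: "f \<in> Ginf_R M S" "fe \<in> moderate_R M S" "f = class_R M S fe"
  shows "f = zero_R M S \<longleftrightarrow> (\<forall>K\<in>cpts S. weak_decay_R M S {\<kappa>\<in>D_R M S. supp S \<kappa> \<subseteq> K} fe)"
proof -
  obtain g where g: "g \<in> moderate_R M S" "f = class_R M S g"
    "\<And>K. K \<in> cpts S \<Longrightarrow> \<exists>k\<in>Rseq. \<forall>h\<in>Rseq. bigO_net (\<lambda>\<epsilon>. norm_R M K h (g \<epsilon>)) (\<lambda>\<epsilon>. exp (assoc_fun_seq M k (1 / \<epsilon>)))"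
    using f(1) unfolding Ginf_R_def by blast
  show ?thesis
    unfolding weak_decay_R_eq f(3) class_R_def zero_R_def negligible_R_eq
  proof (rule class_eq_zero_iff_decay[OF S _ _ gauge_family_R])
    show "seq_weight M real \<in> weights_R" unfolding weights_R_def using real_in_Rseq by blast
    show "(\<lambda>\<epsilon>. exp (assoc_fun_seq M real (1 / \<epsilon>))) \<in> gauges_R" unfolding gauges_R_def using real_in_Rseq by blast
    show "u \<epsilon> \<in> E_gen weights_R S" if "u \<in> moderate_R M S" "0 < \<epsilon>" "\<epsilon> < 1" for u \<epsilon>
      using that by (auto simp: moderate_R_def E_R_eq)
    show "quot_rel (moderate_R M S) (negligible_gen weights_R gauges_R S) `` {fe}
        = quot_rel (moderate_R M S) (negligible_gen weights_R gauges_R S) `` {g}"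
      using f(3) g(2) by (simp add: class_R_def negligible_R_eq)
    show "supported_in S K \<kappa>" if "\<kappa> \<in> {\<kappa>\<in>D_R M S. supp S \<kappa> \<subseteq> K}" for K \<kappa>
      using that by (intro supported_in_if_supp_subset) (auto simp: D_R_def E_R_def)
    fix x0 :: "real^'d" and r :: real and w e
    assume r: "0 < r" "cball x0 (2 * r) \<subseteq> S" and we: "w \<in> weights_R" "e \<in> gauges_R"
      and decay: "decay_gen gauges_R S {\<kappa>\<in>D_R M S. supp S \<kappa> \<subseteq> cball x0 (2 * r)} g"
    have "cball x0 (2 * r) \<in> cpts S" using r by (intro cpts_cball) auto
    from decay_R[OF S r _ g(3)[OF this] we decay] g(1)
    show "decays_on (cball x0 r) w e g"
      by (auto simp: moderate_R_def)
  qed (use weights_R_pos zero_moderate_R f(2) g(1) in auto)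
qed

end

text \<open>The equivalence has one threshold for each compact set, shared by the test functions
  supported there. The further implication starts from a threshold common to all test functions, a
  stronger condition, since decay passes to smaller sets of test functions.\<close>

theorem theorem5:
  fixes M :: "nat \<Rightarrow> real" and \<Omega> :: "(real^'d::finite) set"
  assumes "open \<Omega>" and "weight_sequence M"
  shows
    "(\<forall>f\<in>Ginf_B M \<Omega>. \<forall>fe\<in>moderate_B M \<Omega>. f = class_B M \<Omega> fe \<longrightarrow>
        (f = zero_B M \<Omega> \<longleftrightarrow> (\<forall>K\<in>cpts \<Omega>. weak_decay_B M \<Omega> {\<kappa>\<in>D_B M \<Omega>. supp \<Omega> \<kappa> \<subseteq> K} fe)) \<and>
        (weak_decay_B M \<Omega> (D_B M \<Omega>) fe \<longrightarrow> f = zero_B M \<Omega>)) \<and>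
     (\<forall>f\<in>Ginf_R M \<Omega>. \<forall>fe\<in>moderate_R M \<Omega>. f = class_R M \<Omega> fe \<longrightarrow>
        (f = zero_R M \<Omega> \<longleftrightarrow> (\<forall>K\<in>cpts \<Omega>. weak_decay_R M \<Omega> {\<kappa>\<in>D_R M \<Omega>. supp \<Omega> \<kappa> \<subseteq> K} fe)) \<and>
        (weak_decay_R M \<Omega> (D_R M \<Omega>) fe \<longrightarrow> f = zero_R M \<Omega>))"
proof -
  obtain c0 H where "weight M c0 H" using weight_sequence_weight[OF assms(2)] by blast
  then interpret weight M c0 H .
  have B: "weak_decay_B M \<Omega> {\<kappa>\<in>D_B M \<Omega>. supp \<Omega> \<kappa> \<subseteq> K} fe" if "weak_decay_B M \<Omega> (D_B M \<Omega>) fe" for K fe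
    using that unfolding weak_decay_B_eq by (rule decay_gen_subset) auto
  have R: "weak_decay_R M \<Omega> {\<kappa>\<in>D_R M \<Omega>. supp \<Omega> \<kappa> \<subseteq> K} fe" if "weak_decay_R M \<Omega> (D_R M \<Omega>) fe" for K fe
    using that unfolding weak_decay_R_eq by (rule decay_gen_subset) auto
  show ?thesis
  proof (intro conjI ballI impI)
    fix f fe assume f: "f \<in> Ginf_B M \<Omega>" "fe \<in> moderate_B M \<Omega>" "f = class_B M \<Omega> fe"
    note case_B = beurling_case[OF assms(1) f]
    show "f = zero_B M \<Omega> \<longleftrightarrow> (\<forall>K\<in>cpts \<Omega>. weak_decay_B M \<Omega> {\<kappa>\<in>D_B M \<Omega>. supp \<Omega> \<kappa> \<subseteq> K} fe)" by (rule case_B)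
    show "f = zero_B M \<Omega>" if "weak_decay_B M \<Omega> (D_B M \<Omega>) fe" unfolding case_B by (intro ballI B that)
  next
    fix f fe assume f: "f \<in> Ginf_R M \<Omega>" "fe \<in> moderate_R M \<Omega>" "f = class_R M \<Omega> fe"
    note case_R = roumieu_case[OF assms(1) f]
    show "f = zero_R M \<Omega> \<longleftrightarrow> (\<forall>K\<in>cpts \<Omega>. weak_decay_R M \<Omega> {\<kappa>\<in>D_R M \<Omega>. supp \<Omega> \<kappa> \<subseteq> K} fe)" by (rule case_R)
    show "f = zero_R M \<Omega>" if "weak_decay_R M \<Omega> (D_R M \<Omega>) fe" unfolding case_R by (intro ballI R that)
  qed
qed

end
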